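(* Let $\lambda$ be a partition and let $\mu=(\mu_1,\ldots,\mu_r)$ be a composition of length $r$ with $|\lambda|=|\mu|$. Then $$\sum_{\eta}K_{\eta\mu}K_{\eta'\lambda}(t)=\sum_{\{\nu\}}\prod_{k=1}^{r-1}\prod_{i\ge 1}\left[\begin{matrix}\nu_i^{(k+1)}-\nu_{i+1}^{(k+1)}\\ \nu_i^{(k)}-\nu_{i+1}^{(k+1)}\end{matrix}\right]_t ,$$ where the left-hand sum is over all partitions $\eta$ of $|\lambda|$, and the right-hand sum is over all flags of partitions $\nu=\{\emptyset=\nu^{(0)}\subset\nu^{(1)}\subset\cdots\subset\nu^{(r)}=\lambda'\}$ such that $\nu^{(k)}/\nu^{(k-1)}$ is a horizontal strip of length $\mu_k$ for each $1\le k\le r$.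
   Context: For a partition $\lambda$, $\lambda'$ is the conjugate partition, $|\lambda|$ the sum of its parts, and $\lambda_i=0$ for $i$ larger than the length. $K_{\eta\lambda}(t)$ is the Kostka–Foulkes polynomial, defined by $s_\eta(x)=\sum_\lambda K_{\eta\lambda}(t)P_\lambda(x;t)$, where $s_\eta$ is the Schur function and $P_\lambda(x;t)$ the Hall–Littlewood symmetric function. For a composition $\mu$, $K_{\eta\mu}$ is the Kostka number, i.e. the number of semistandard Young tableaux of shape $\eta$ and weight $\mu$. A skew diagram $\alpha/\beta$ (with $\beta\subset\alpha$) is a horizontal strip of length $m$ if $|\alpha|-|\beta|=m$ and it has at most one box in each column, i.e. $\alpha_{i+1}\le\beta_i\le\alpha_i$ for all $i$. The $t$-binomial coefficient is $\left[\begin{matrix}N\\ m\end{matrix}\right]_t=\frac{(t;t)_N}{(t;t)_m(t;t)_{N-m}}$ for $0\le m\le N$ and $0$ otherwise, with $(t;t)_m=\prod_{j=1}^m(1-t^j)$. *)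

theory Defs
  imports
    "HOL-Library.Poly_Mapping"
    "HOL-Library.FuncSet"
    "HOL-Combinatorics.Permutations"
    "HOL-Computational_Algebra.Polynomial_Factorial"
begin

text \<open>
  Parts are indexed from 0: the part written $\lambda_i$ ($i \ge 1$) in the mathematical
  literature is \<open>lam (i - 1)\<close>.  Trailing zeros are part of the representation, so every
  partition is represented by exactly one function.
\<close>

definition is_partition :: "(nat \<Rightarrow> nat) \<Rightarrow> bool" where
  "is_partition lam \<longleftrightarrow> antimono lam \<and> finite {i. lam i \<noteq> 0}"

definition psize :: "(nat \<Rightarrow> nat) \<Rightarrow> nat" where
  "psize lam = (\<Sum>i | lam i \<noteq> 0. lam i)"

definition plength :: "(nat \<Rightarrow> nat) \<Rightarrow> nat" where
  "plength lam = card {i. lam i \<noteq> 0}"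

definition partitions_of :: "nat \<Rightarrow> (nat \<Rightarrow> nat) set" where
  "partitions_of n = {lam. is_partition lam \<and> psize lam = n}"

definition conj_part :: "(nat \<Rightarrow> nat) \<Rightarrow> (nat \<Rightarrow> nat)" where
  "conj_part lam = (\<lambda>j. card {i. j < lam i})"

definition diagram :: "(nat \<Rightarrow> nat) \<Rightarrow> (nat \<times> nat) set" where
  "diagram lam = {(i, j). j < lam i}"

definition horizontal_strip :: "(nat \<Rightarrow> nat) \<Rightarrow> (nat \<Rightarrow> nat) \<Rightarrow> nat \<Rightarrow> bool" where
  "horizontal_strip alpha beta m \<longleftrightarrow>
     (\<forall>i. alpha (Suc i) \<le> beta i \<and> beta i \<le> alpha i) \<and> psize alpha = psize beta + m"

lemma finite_partitions_of: "finite (partitions_of n)"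
proof -
  have "partitions_of n \<subseteq>
      {f. \<forall>i. (i \<in> {..<n} \<longrightarrow> f i \<in> {..n}) \<and> (i \<notin> {..<n} \<longrightarrow> f i = 0)}"
  proof
    fix lam assume "lam \<in> partitions_of n"
    then have anti: "antimono lam" and fin: "finite {i. lam i \<noteq> 0}"
      and sz: "(\<Sum>i | lam i \<noteq> 0. lam i) = n"
      by (auto simp: partitions_of_def is_partition_def psize_def)
    have le: "lam i \<le> n" for i
    proof (cases "lam i = 0")
      case False
      then show ?thesis
        using member_le_sum[of i "{i. lam i \<noteq> 0}" lam] fin sz by simp
    qed simp
    have zero: "lam i = 0" if "n \<le> i" for i
    proof (rule ccontr)
      assume "lam i \<noteq> 0"
      then have sub: "{..i} \<subseteq> {i. lam i \<noteq> 0}"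
        using antimonoD[OF anti] by (force simp: le_zero_eq)
      have "Suc i = (\<Sum>j\<le>i. 1)" by simp
      also have "\<dots> \<le> (\<Sum>j\<le>i. lam j)"
        using sub by (intro sum_mono) (auto simp: Suc_le_eq)
      also have "\<dots> \<le> n"
        using sum_mono2[OF fin sub, of lam] sz by simp
      finally show False using that by simp
    qed
    from le zero show "lam \<in> {f. \<forall>i. (i \<in> {..<n} \<longrightarrow> f i \<in> {..n}) \<and>
        (i \<notin> {..<n} \<longrightarrow> f i = 0)}" by simp
  qed
  then show ?thesis
    by (rule finite_subset) (rule finite_set_of_finite_funs; simp)
qed

text \<open>
  A composition $\mu = (\mu_1, \dots, \mu_r)$ is a list of length $r$.  The letters of a
  tableau of weight $\mu$ are $0, \dots, r - 1$, the letter \<open>k\<close> occurring \<open>mu ! k\<close> times.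
\<close>

definition ssyt :: "(nat \<Rightarrow> nat) \<Rightarrow> nat list \<Rightarrow> (nat \<times> nat \<Rightarrow> nat) set" where
  "ssyt eta mu = {T \<in> diagram eta \<rightarrow>\<^sub>E {..<length mu}.
     (\<forall>i j. (i, Suc j) \<in> diagram eta \<longrightarrow> T (i, j) \<le> T (i, Suc j)) \<and>
     (\<forall>i j. (Suc i, j) \<in> diagram eta \<longrightarrow> T (i, j) < T (Suc i, j)) \<and>
     (\<forall>k<length mu. card {c \<in> diagram eta. T c = k} = mu ! k)}"

definition kostka :: "(nat \<Rightarrow> nat) \<Rightarrow> nat list \<Rightarrow> nat" where
  "kostka eta mu = card (ssyt eta mu)"

text \<open>
  The polynomial ring $\mathbb{Z}[t][x_0, x_1, \dots]$ (a monomial is its exponent vector) and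
  its fraction field, in which the defining formulas of the symmetric polynomials are read.
\<close>

type_synonym xpoly = "(nat \<Rightarrow>\<^sub>0 nat) \<Rightarrow>\<^sub>0 int poly"

definition tconst :: "int poly \<Rightarrow> xpoly fract" where
  "tconst c = to_fract (Poly_Mapping.single 0 c)"

definition tvar :: "int poly" where
  "tvar = [:0, 1:]"

definition xvar :: "nat \<Rightarrow> xpoly fract" where
  "xvar i = to_fract (Poly_Mapping.single (Poly_Mapping.single i 1) 1)"

text \<open>
  The Schur polynomial in \<open>n\<close> variables as the ratio of alternants
  $a_{\eta+\delta} / a_\delta$ with $\delta = (n-1, \dots, 1, 0)$.
\<close>

definition schur :: "nat \<Rightarrow> (nat \<Rightarrow> nat) \<Rightarrow> xpoly fract" where
  "schur n eta = (if plength eta \<le> n then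
     (\<Sum>w | w permutes {..<n}. of_int (sign w) * (\<Prod>i<n. xvar (w i) ^ (eta i + (n - 1 - i)))) /
     (\<Prod>j<n. \<Prod>i<j. xvar i - xvar j)
   else 0)"

text \<open>
  $v_m(t) = \prod_{i=1}^{m} \frac{1 - t^i}{1 - t}$ and $v_\lambda(t) = \prod_{a} v_{m_a}(t)$,
  where $m_a$ is the number of parts equal to $a$ among $\lambda_1, \dots, \lambda_n$; the part
  $a = 0$ counts, so $m_0 = n - \ell(\lambda)$.
\<close>

definition hl_v :: "nat \<Rightarrow> xpoly fract" where
  "hl_v m = (\<Prod>i=1..m. (1 - tconst tvar ^ i) / (1 - tconst tvar))"

definition hl_v_part :: "nat \<Rightarrow> (nat \<Rightarrow> nat) \<Rightarrow> xpoly fract" where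
  "hl_v_part n lam = (\<Prod>a \<in> lam ` {..<n}. hl_v (card {i. i < n \<and> lam i = a}))"

text \<open>
  $P_\lambda(x;t) = \frac{1}{v_\lambda(t)} \sum_{w \in S_n}
    w\Bigl(x^\lambda \prod_{i<j} \frac{x_i - t x_j}{x_i - x_j}\Bigr)$ in \<open>n\<close> variables.
\<close>

definition hall_littlewood :: "nat \<Rightarrow> (nat \<Rightarrow> nat) \<Rightarrow> xpoly fract" where
  "hall_littlewood n lam = (if plength lam \<le> n then
     (\<Sum>w | w permutes {..<n}.
        (\<Prod>i<n. xvar (w i) ^ lam i) *
        (\<Prod>j<n. \<Prod>i<j. (xvar (w i) - tconst tvar * xvar (w j)) / (xvar (w i) - xvar (w j)))) /
     hl_v_part n lam
   else 0)"

text \<open>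
  A symmetric function is determined by its images in \<open>n\<close> variables for all \<open>n\<close>, and the
  image of $s_\eta$ or $P_\lambda$ vanishes when \<open>n\<close> is less than the length of the partition.
  Thus the identity $s_\eta(x) = \sum_\lambda K_{\eta\lambda}(t) P_\lambda(x;t)$ of symmetric
  functions is the one below, required in every number of variables; the coefficient family is
  finitely supported.  (For a single \<open>n\<close> the coefficients would not be determined.)
\<close>

definition schur_hl_expansion :: "(nat \<Rightarrow> nat) \<Rightarrow> ((nat \<Rightarrow> nat) \<Rightarrow>\<^sub>0 int poly) \<Rightarrow> bool" where
  "schur_hl_expansion eta K \<longleftrightarrow>
     Poly_Mapping.keys K \<subseteq> {lam. is_partition lam} \<and>
     (\<forall>n. schur n eta =
        (\<Sum>lam \<in> Poly_Mapping.keys K. tconst (Poly_Mapping.lookup K lam) * hall_littlewood n lam))"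

definition kostka_foulkes :: "(nat \<Rightarrow> nat) \<Rightarrow> (nat \<Rightarrow> nat) \<Rightarrow> int poly" where
  "kostka_foulkes eta lam = Poly_Mapping.lookup (THE K. schur_hl_expansion eta K) lam"

definition tpoch :: "nat \<Rightarrow> int poly" where
  "tpoch m = (\<Prod>j=1..m. 1 - tvar ^ j)"

text \<open>The division is exact, see \<open>tbinom_exact\<close>.\<close>

definition tbinom :: "nat \<Rightarrow> nat \<Rightarrow> int poly" where
  "tbinom N m = (if m \<le> N then tpoch N div (tpoch m * tpoch (N - m)) else 0)"

lemma tpoch_0: "tpoch 0 = 1"
  by (simp add: tpoch_def)

lemma tpoch_Suc: "tpoch (Suc m) = (1 - tvar ^ Suc m) * tpoch m"
  by (simp add: tpoch_def mult.commute)

lemma tpoch_dvd: "tpoch m * tpoch n dvd tpoch (m + n)"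
proof (induction "m + n" arbitrary: m n)
  case 0
  then show ?case by (simp add: tpoch_0)
next
  case (Suc N)
  show ?case
  proof (cases "m = 0 \<or> n = 0")
    case True
    then show ?thesis by (auto simp: tpoch_0)
  next
    case False
    then obtain a b where m: "m = Suc a" and n: "n = Suc b"
      by (auto simp: gr0_conv_Suc)
    have 1: "tpoch a * tpoch n dvd tpoch N" and 2: "tpoch m * tpoch b dvd tpoch N"
      using Suc.hyps(1)[of a n] Suc.hyps(1)[of m b] Suc.hyps(2) by (auto simp: m n)
    have "tpoch m * tpoch n dvd (1 - tvar ^ m) * tpoch N"
      using mult_dvd_mono[OF dvd_refl[of "1 - tvar ^ m"] 1]
      by (simp add: m tpoch_Suc mult.assoc)
    moreover have "tpoch m * tpoch n dvd (1 - tvar ^ n) * tpoch N"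
      using mult_dvd_mono[OF dvd_refl[of "1 - tvar ^ n"] 2]
      by (simp only: n tpoch_Suc mult.left_commute)
    then have "tpoch m * tpoch n dvd tvar ^ m * ((1 - tvar ^ n) * tpoch N)"
      by (rule dvd_mult)
    ultimately have "tpoch m * tpoch n dvd
        (1 - tvar ^ m) * tpoch N + tvar ^ m * ((1 - tvar ^ n) * tpoch N)"
      by (rule dvd_add)
    also have "\<dots> = (1 - tvar ^ (m + n)) * tpoch N"
      by (simp add: algebra_simps power_add)
    also have "\<dots> = tpoch (m + n)"
      using Suc.hyps(2)[symmetric] by (simp only: tpoch_Suc)
    finally show ?thesis .
  qed
qed

lemma tbinom_exact:
  assumes "m \<le> N"
  shows "tbinom N m * (tpoch m * tpoch (N - m)) = tpoch N"
  using assms tpoch_dvd[of m "N - m"] by (simp add: tbinom_def)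

text \<open>
  Flags $\emptyset = \nu^{(0)} \subset \dots \subset \nu^{(r)} = \kappa$ of partitions, as lists
  of length $r + 1$, whose successive quotients are horizontal strips of lengths
  $\mu_1, \dots, \mu_r$ (here \<open>mu ! 0, \<dots>, mu ! (r - 1)\<close>).
\<close>

definition strip_flags :: "(nat \<Rightarrow> nat) \<Rightarrow> nat list \<Rightarrow> (nat \<Rightarrow> nat) list set" where
  "strip_flags kappa mu = {nu. length nu = Suc (length mu) \<and>
     (\<forall>k \<le> length mu. is_partition (nu ! k)) \<and>
     nu ! 0 = (\<lambda>_. 0) \<and> nu ! length mu = kappa \<and>
     (\<forall>k \<in> {1..length mu}. horizontal_strip (nu ! k) (nu ! (k - 1)) (mu ! (k - 1)))}"

lemma finite_strip_flags: "finite (strip_flags kappa mu)"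
proof -
  let ?S = "\<Union>n \<le> psize kappa. partitions_of n"
  have "strip_flags kappa mu \<subseteq> {nu. set nu \<subseteq> ?S \<and> length nu = Suc (length mu)}"
  proof
    fix nu assume nu: "nu \<in> strip_flags kappa mu"
    have "psize (nu ! k) \<le> psize kappa" if "k \<le> length mu" for k
      using that
    proof (induction k rule: inc_induct)
      case base
      then show ?case using nu by (simp add: strip_flags_def)
    next
      case (step k)
      have "horizontal_strip (nu ! Suc k) (nu ! k) (mu ! k)"
      proof -
        have "Suc k \<in> {1..length mu}" using step.hyps by simp
        with nu have "horizontal_strip (nu ! Suc k) (nu ! (Suc k - 1)) (mu ! (Suc k - 1))"
          unfolding strip_flags_def by blast
        then show ?thesis by simp
      qed
      then show ?case using step.IH by (simp add: horizontal_strip_def)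
    qed
    then show "nu \<in> {nu. set nu \<subseteq> ?S \<and> length nu = Suc (length mu)}"
      using nu by (auto simp: strip_flags_def partitions_of_def in_set_conv_nth)
  qed
  moreover have "finite ?S" by (simp add: finite_partitions_of)
  ultimately show ?thesis
    using finite_lists_length_eq finite_subset by blast
qed

end

theory Submission
  imports Defs "HOL-Library.Function_Algebras"
begin

text \<open>
  Both sides are the coefficient of $P_\lambda$ in the product
  $e_\mu = e_{\mu_1} \cdots e_{\mu_r}$ of elementary symmetric functions.  Partitions are indexed
  through their conjugates, so that multiplication by $e_m$ adds a horizontal strip of length $m$:
  the Schur functions satisfy this Pieri rule with all coefficients $1$, whence
  $e_\mu = \sum_\eta K_{\eta\mu} s_{\eta'}$, and the Hall--Littlewood functions satisfy it with
  products of Gaussian binomials as coefficients.  The latter rule follows from the straightening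
  relation $R_{(\dots,c,c+1,\dots)} = t R_{(\dots,c+1,c,\dots)}$ for the unnormalized symmetrizations
  $R_\alpha$, which turns $e_m R_\kappa$ into generating functions of subsets by inversions.
  Two families satisfying Pieri rules are unitriangular with respect to each other (remove the last
  row of the conjugate), so the Schur functions expand in the Hall--Littlewood functions with
  coefficients in $\mathbb{Z}[t]$, uniquely because the Schur functions are linearly independent.
\<close>

section \<open>Symmetrization of the Hall--Littlewood kernel\<close>

text \<open>The labels are conjugated because in \<open>n\<close> variables a member of either
  family is 0 as soon as the first row of its conjugate label exceeds \<open>n\<close>, and adding a
  strip can only lengthen that row; so both Pieri rules hold for every \<open>n\<close>, the
  degenerate ones included. Straightening produces binomials whose upper indices are the
  multiplicities of the parts of the old label, whereas the theorem has those of the new label. The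
  normalizing factors v account for the difference, and this is what they contribute to the Pieri
  rule. Nothing is ever divided by a polynomial in t: the strip that fills a new last row has
  coefficient 1 in both rules, so each relation can be solved for its heaviest term, and the
  transition coefficients stay in Z[t] as the definition of K requires. The two initial values, s
  and P of the empty partition being 1, come from one evaluation: the sum of the kernel over all
  permutations is v_n(t), by Lagrange interpolation.\<close>

lemma coeff_lagrange_interpolation:
  fixes p :: "'a::field poly"
  assumes "finite B" "degree p < card B"
  shows "coeff p (card B - 1) = (\<Sum>b\<in>B. poly p b / (\<Prod>c\<in>B - {b}. b - c))"
proof -
  \<comment> \<open>The Lagrange basis polynomials are monic of degree \<open>card B - 1\<close>, so
    each summand of the interpolation formula \<open>q\<close> contributes its scalar weight to the
    coefficient in question.\<close>
  define l where "l b = (\<Prod>c\<in>B - {b}. [:- c, 1:])" for b :: 'a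
  define q where "q = (\<Sum>b\<in>B. smult (poly p b / (\<Prod>c\<in>B - {b}. b - c)) (l b))"
  have deg_l: "degree (l b) = card B - 1" and coeff_l: "coeff (l b) (card B - 1) = 1" if "b \<in> B" for b
  proof -
    show d: "degree (l b) = card B - 1"
      unfolding l_def using that assms(1) by (subst degree_prod_eq_sum_degree) auto
    have "lead_coeff (l b) = 1"
      unfolding l_def by (subst lead_coeff_prod) simp
    then show "coeff (l b) (card B - 1) = 1" by (simp add: d)
  qed
  have poly_l: "poly (l b) x = (\<Prod>c\<in>B - {b}. x - c)" for b x
    by (simp add: l_def poly_prod)
  have "p = q"
  proof (rule poly_eqI_degree)
    fix x assume x: "x \<in> B"
    have "poly q x = (\<Sum>b\<in>B. poly p b / (\<Prod>c\<in>B - {b}. b - c) * (\<Prod>c\<in>B - {b}. x - c))"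
      by (simp add: q_def poly_sum poly_l)
    also have "\<dots> = (\<Sum>b\<in>{x}. poly p b / (\<Prod>c\<in>B - {b}. b - c) * (\<Prod>c\<in>B - {b}. x - c))"
    proof (rule sum.mono_neutral_right)
      show "\<forall>b\<in>B - {x}. poly p b / (\<Prod>c\<in>B - {b}. b - c) * (\<Prod>c\<in>B - {b}. x - c) = 0"
        using x assms(1) by (auto intro!: prod_zero)
    qed (use x assms(1) in auto)
    also have "\<dots> = poly p x"
      using assms(1) by simp
    finally show "poly p x = poly q x" by simp
  next
    have "degree q \<le> card B - 1"
      unfolding q_def using assms(1) deg_l
      by (intro degree_sum_le) (auto intro: order_trans[OF degree_smult_le])
    then show "degree q < card B" using assms(2) by linarith
  qed (use assms in auto)
  then have "coeff p (card B - 1) = coeff q (card B - 1)" by simp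
  also have "\<dots> = (\<Sum>b\<in>B. poly p b / (\<Prod>c\<in>B - {b}. b - c))"
    unfolding q_def coeff_sum by (intro sum.cong refl) (simp only: coeff_smult coeff_l mult_1_right)
  finally show ?thesis .
qed

text \<open>Interpolate $\prod_{c \in A} (c - t z)$ at the points of $A \cup \{0\}$ and compare
  leading coefficients.\<close>

lemma sum_prod_diff_quotients:
  fixes t :: "'a::field"
  assumes A: "finite A" "0 \<notin> A"
  shows "(1 - t) * (\<Sum>b\<in>A. \<Prod>c\<in>A - {b}. (c - t * b) / (c - b)) = 1 - t ^ card A"
proof -
  define N where "N = card A"
  define p where "p = (\<Prod>c\<in>A. [:c, - t:])"
  have pe: "poly p z = (\<Prod>c\<in>A. c - t * z)" for z
    by (simp add: p_def poly_prod mult.commute)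
  have degp: "degree p \<le> N"
    unfolding p_def N_def
    by (rule order_trans[OF degree_prod_sum_le[OF A(1)]])
       (use sum_mono[of A "\<lambda>c. degree [:c, - t:]" "\<lambda>_. 1"] in \<open>auto simp: degree_pCons_eq_if\<close>)
  have cp: "coeff p N = (- t) ^ N"
    unfolding p_def N_def using A(1)
  proof (induction A rule: finite_induct)
    case (insert c A)
    have d: "degree (\<Prod>c\<in>A. [:c, - t:]) \<le> card A"
      by (rule order_trans[OF degree_prod_sum_le[OF insert(1)]])
         (use sum_mono[of A "\<lambda>c. degree [:c, - t:]" "\<lambda>_. 1"] in \<open>auto simp: degree_pCons_eq_if\<close>)
    have "coeff (\<Prod>c\<in>A. [:c, - t:]) (Suc (card A)) = 0"
      using d by (intro coeff_eq_0) auto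
    then show ?case using insert by simp
  qed simp
  have cB: "card (insert 0 A) = Suc N" using A by (simp add: N_def)
  have "(- t) ^ N = (\<Sum>b\<in>insert 0 A. poly p b / (\<Prod>c\<in>insert 0 A - {b}. b - c))"
    using coeff_lagrange_interpolation[of "insert 0 A" p] A degp cp cB by simp
  also have "\<dots> = poly p 0 / (\<Prod>c\<in>A. - c) + (\<Sum>b\<in>A. poly p b / (\<Prod>c\<in>insert 0 A - {b}. b - c))"
    using A by simp
  also have "poly p 0 / (\<Prod>c\<in>A. - c) = (- 1) ^ N"
  proof -
    have "(\<Prod>c\<in>A. - c) = (- 1) ^ N * \<Prod>A"
      using prod.distrib[of "\<lambda>_. - 1" "\<lambda>c. c" A] by (simp add: N_def)
    moreover have "\<Prod>A \<noteq> 0" using A by auto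
    ultimately show ?thesis
      by (simp add: pe field_simps flip: power_mult_distrib)
  qed
  \<comment> \<open>At a node \<open>b\<close> in \<open>A\<close> the factor of \<open>p\<close>
    belonging to \<open>b\<close> is \<open>b * (1 - t)\<close>; its \<open>b\<close> cancels
    against the node 0 in the denominator, and reversing the remaining differences gives the
    sign.\<close>
  also have "(\<Sum>b\<in>A. poly p b / (\<Prod>c\<in>insert 0 A - {b}. b - c))
     = (\<Sum>b\<in>A. - ((- 1) ^ N * (1 - t)) * (\<Prod>c\<in>A - {b}. (c - t * b) / (c - b)))"
  proof (rule sum.cong)
    fix b assume b: "b \<in> A"
    then have b0: "b \<noteq> 0" using A by auto
    have s: "insert 0 A - {b} = insert 0 (A - {b})" using b0 by auto
    have N: "N = Suc (card (A - {b}))" using b A by (metis N_def card_Suc_Diff1)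
    have d: "(\<Prod>c\<in>insert 0 A - {b}. b - c) = b * (\<Prod>c\<in>A - {b}. b - c)"
      unfolding s using A by simp
    have e: "(\<Prod>c\<in>A - {b}. b - c) = (- 1) ^ card (A - {b}) * (\<Prod>c\<in>A - {b}. c - b)"
      using prod.distrib[of "\<lambda>_. - 1" "\<lambda>c. c - b" "A - {b}"] by simp
    have f: "poly p b = b * (1 - t) * (\<Prod>c\<in>A - {b}. c - t * b)"
      unfolding pe using A b by (subst prod.remove[of A b]) (auto simp: algebra_simps)
    have g: "(\<Prod>c\<in>A - {b}. c - b) \<noteq> 0" using A by auto
    have h: "(- 1 :: 'a) ^ card (A - {b}) * (- 1) ^ card (A - {b}) = 1"
      by (simp flip: power_mult_distrib)
    show "poly p b / (\<Prod>c\<in>insert 0 A - {b}. b - c) =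
        - ((- 1) ^ N * (1 - t)) * (\<Prod>c\<in>A - {b}. (c - t * b) / (c - b))"
      unfolding d e f prod_dividef using b0 g h by (simp add: N field_simps)
  qed simp
  also have "\<dots> = - ((- 1) ^ N * (1 - t)) * (\<Sum>b\<in>A. \<Prod>c\<in>A - {b}. (c - t * b) / (c - b))"
    by (rule sum_distrib_left[symmetric])
  finally have "(- t) ^ N = (- 1) ^ N - (- 1) ^ N * ((1 - t) * (\<Sum>b\<in>A. \<Prod>c\<in>A - {b}. (c - t * b) / (c - b)))"
    by (simp only: mult_minus_left mult.assoc diff_conv_add_uminus)
  then have "(- 1) ^ N * ((- t) ^ N) = (- 1) ^ N * ((- 1) ^ N - (- 1) ^ N * ((1 - t) * (\<Sum>b\<in>A. \<Prod>c\<in>A - {b}. (c - t * b) / (c - b))))"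
    by simp
  then show ?thesis
    by (simp add: right_diff_distrib N_def flip: power_mult_distrib mult.assoc)
qed

text \<open>Values \<open>y\<close> in an arbitrary field replace the variables:
  \<open>sum_hl_ker\<close> permutes them in its induction, and \<open>schur_0\<close> uses the
  kernel at \<open>t = 0\<close>.\<close>

definition hl_ker :: "nat \<Rightarrow> 'a::field \<Rightarrow> (nat \<Rightarrow> 'a) \<Rightarrow> 'a" where
  "hl_ker n t y = (\<Prod>j<n. \<Prod>i<j. (y i - t * y j) / (y i - y j))"

definition hl_sym :: "nat \<Rightarrow> 'a::field \<Rightarrow> (nat \<Rightarrow> 'a) \<Rightarrow> (nat \<Rightarrow> nat) \<Rightarrow> 'a" where
  "hl_sym n t y \<alpha> = (\<Sum>w | w permutes {..<n}. (\<Prod>i<n. y (w i) ^ \<alpha> i) * hl_ker n t (y \<circ> w))"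

text \<open>Sort the permutations by the image \<open>b\<close> of the last index. The pairs
  containing that index contribute \<open>L b\<close>, the others form a kernel in the remaining
  \<open>n\<close> values, so the sum splits into the induction hypothesis and the interpolation
  identity. The value 0 is excluded because it serves as an extra node there.\<close>

lemma sum_hl_ker:
  fixes t :: "'a::field"
  assumes "inj_on y {..<n}" "0 \<notin> y ` {..<n}"
  shows "(1 - t) ^ n * (\<Sum>w | w permutes {..<n}. hl_ker n t (y \<circ> w)) = (\<Prod>i=1..n. 1 - t ^ i)"
  using assms
proof (induction n arbitrary: y)
  case 0
  have "{w. w permutes {..<0::nat}} = {id}" by auto
  then show ?case by (simp add: hl_ker_def)
next
  case (Suc n)
  define L where "L b = (\<Prod>c\<in>{..<Suc n} - {b}. (y c - t * y b) / (y c - y b))" for b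
  have step: "hl_ker (Suc n) t (y \<circ> (transpose n b \<circ> q)) = hl_ker n t ((y \<circ> transpose n b) \<circ> q) * L b"
    if b: "b \<in> {..<Suc n}" and q: "q permutes {..<n}" for b q
  proof -
    have qn: "q n = n" using q by (simp add: permutes_not_in)
    have im: "bij_betw (transpose n b \<circ> q) {..<n} ({..<Suc n} - {b})"
    proof -
      have "bij_betw q {..<n} {..<n}" using q by (rule permutes_imp_bij)
      moreover have "bij_betw (transpose n b) {..<n} ({..<Suc n} - {b})"
        by (rule bij_betw_byWitness[where f' = "transpose n b"])
           (use b in \<open>auto simp: transpose_def less_Suc_eq\<close>)
      ultimately show ?thesis by (rule bij_betw_trans)
    qed
    have "(\<Prod>i<n. (y (transpose n b (q i)) - t * y b) / (y (transpose n b (q i)) - y b)) = L b"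
      unfolding L_def using prod.reindex_bij_betw[OF im, of "\<lambda>c. (y c - t * y b) / (y c - y b)"]
      by simp
    then show ?thesis by (simp add: hl_ker_def qn)
  qed
  have IH: "(1 - t) ^ n * (\<Sum>w | w permutes {..<n}. hl_ker n t ((y \<circ> transpose n b) \<circ> w)) = (\<Prod>i=1..n. 1 - t ^ i)"
    if b: "b \<in> {..<Suc n}" for b
  proof (rule Suc.IH)
    have sub: "transpose n b ` {..<n} \<subseteq> {..<Suc n}" using b by (auto simp: transpose_def)
    show "inj_on (y \<circ> transpose n b) {..<n}"
      by (intro comp_inj_on inj_on_subset[OF Suc.prems(1) sub]) simp
    have "(y \<circ> transpose n b) ` {..<n} \<subseteq> y ` {..<Suc n}"
      using sub by (auto simp: image_iff)
    then show "0 \<notin> (y \<circ> transpose n b) ` {..<n}" using Suc.prems(2) by blast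
  qed
  have Lsum: "(1 - t) * (\<Sum>b<Suc n. L b) = 1 - t ^ Suc n"
  proof -
    have "(\<Sum>b<Suc n. L b) = (\<Sum>b\<in>y ` {..<Suc n}. \<Prod>c\<in>y ` {..<Suc n} - {b}. (c - t * b) / (c - b))"
    proof (subst sum.reindex[OF Suc.prems(1)], rule sum.cong)
      fix b assume b: "b \<in> {..<Suc n}"
      have "y ` {..<Suc n} - {y b} = y ` ({..<Suc n} - {b})"
        using Suc.prems(1) b by (auto simp: inj_on_def)
      moreover have "inj_on y ({..<Suc n} - {b})" using Suc.prems(1) by (rule inj_on_subset) auto
      ultimately show "L b = ((\<lambda>b. \<Prod>c\<in>y ` {..<Suc n} - {b}. (c - t * b) / (c - b)) \<circ> y) b"
        by (simp add: L_def prod.reindex)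
    qed simp
    moreover have "card (y ` {..<Suc n}) = Suc n" using Suc.prems(1) by (simp add: card_image)
    ultimately show ?thesis
      using sum_prod_diff_quotients[of "y ` {..<Suc n}" t] Suc.prems(2) by simp
  qed
  \<comment> \<open>Every permutation of the \<open>Suc n\<close> indices is uniquely
    \<open>transpose n b \<circ> q\<close> with \<open>q\<close> fixing \<open>n\<close>, and it
    sends \<open>n\<close> to \<open>b\<close>.\<close>
  have "(\<Sum>w | w permutes {..<Suc n}. hl_ker (Suc n) t (y \<circ> w))
     = (\<Sum>b<Suc n. \<Sum>q | q permutes {..<n}. hl_ker (Suc n) t (y \<circ> (transpose n b \<circ> q)))"
    unfolding lessThan_Suc
    by (subst sum_over_permutations_insert) auto
  also have "\<dots> = (\<Sum>b<Suc n. (\<Sum>q | q permutes {..<n}. hl_ker n t ((y \<circ> transpose n b) \<circ> q)) * L b)"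
    by (intro sum.cong refl) (simp add: step sum_distrib_right)
  finally have "(1 - t) ^ Suc n * (\<Sum>w | w permutes {..<Suc n}. hl_ker (Suc n) t (y \<circ> w))
      = (1 - t) * (\<Sum>b<Suc n. ((1 - t) ^ n * (\<Sum>q | q permutes {..<n}. hl_ker n t ((y \<circ> transpose n b) \<circ> q))) * L b)"
    by (simp only: power_Suc mult.assoc sum_distrib_left[of "(1 - t) ^ n" _ "{..<Suc n}"])
  also have "\<dots> = (1 - t) * (\<Sum>b<Suc n. (\<Prod>i=1..n. 1 - t ^ i) * L b)"
    by (intro arg_cong[of _ _ "\<lambda>x. (1 - t) * x"] sum.cong refl) (simp only: IH)
  also have "\<dots> = (\<Prod>i=1..n. 1 - t ^ i) * ((1 - t) * (\<Sum>b<Suc n. L b))"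
    by (simp only: sum_distrib_left ac_simps)
  also have "\<dots> = (\<Prod>i=1..Suc n. 1 - t ^ i)"
    unfolding Lsum by simp
  finally show ?case .
qed

section \<open>Multiplication by elementary symmetric polynomials\<close>

definition ksubsets :: "nat \<Rightarrow> nat \<Rightarrow> nat set set" where
  "ksubsets n m = {S. S \<subseteq> {..<n} \<and> card S = m}"

lemma finite_ksubsets: "finite (ksubsets n m)"
  by (rule finite_subset[of _ "Pow {..<n}"]) (auto simp: ksubsets_def)

definition esymp :: "nat \<Rightarrow> (nat \<Rightarrow> 'a::comm_semiring_1) \<Rightarrow> nat \<Rightarrow> 'a" where
  "esymp n y m = (\<Sum>S\<in>ksubsets n m. \<Prod>i\<in>S. y i)"

lemma esymp_permutes:
  assumes "w permutes {..<n}"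
  shows "esymp n (y \<circ> w) m = esymp n y m"
  unfolding esymp_def
proof (rule sum.reindex_bij_witness[where i = "(`) (inv w)" and j = "(`) w"])
  have inj: "inj w" using assms by (rule permutes_inj)
  show "inv w ` w ` S = S" "w ` inv w ` S = S" for S
    using assms by (auto simp: image_image permutes_inverses)
  have im: "v ` S \<in> ksubsets n m" if "v permutes {..<n}" "S \<in> ksubsets n m" for v S
    using that permutes_image[OF that(1)] inj_on_subset[OF permutes_inj[OF that(1)], of S]
    by (auto simp: ksubsets_def card_image)
  show "S \<in> ksubsets n m \<Longrightarrow> w ` S \<in> ksubsets n m" for S using im assms by blast
  show "S \<in> ksubsets n m \<Longrightarrow> inv w ` S \<in> ksubsets n m" for S
    using im permutes_inv[OF assms] by blast
  show "prod y (w ` S) = prod (y \<circ> w) S" for S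
    using inj by (simp add: prod.reindex inj_on_subset)
qed

lemma prod_power_mult_esymp:
  "(\<Prod>i<n. z i ^ \<alpha> i) * esymp n z m = (\<Sum>S\<in>ksubsets n m. \<Prod>i<n. z i ^ (\<alpha> i + of_bool (i \<in> S)))"
  unfolding esymp_def sum_distrib_left
proof (rule sum.cong[OF refl])
  fix S assume "S \<in> ksubsets n m"
  then have S: "S \<subseteq> {..<n}" by (simp add: ksubsets_def)
  have "prod z S = (\<Prod>i<n. z i ^ of_bool (i \<in> S))"
    using S by (intro prod.mono_neutral_cong_left) auto
  then show "(\<Prod>i<n. z i ^ \<alpha> i) * prod z S = (\<Prod>i<n. z i ^ (\<alpha> i + of_bool (i \<in> S)))"
    by (simp add: prod.distrib power_add)
qed

text \<open>The elementary symmetric polynomial is invariant under \<open>w\<close>, so it can be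
  evaluated at \<open>y \<circ> w\<close> inside the sum, where it meets only the monomial and
  leaves the kernel untouched.\<close>

lemma hl_sym_mult_esymp:
  "hl_sym n t y \<alpha> * esymp n y m = (\<Sum>S\<in>ksubsets n m. hl_sym n t y (\<lambda>i. \<alpha> i + of_bool (i \<in> S)))"
proof -
  have "hl_sym n t y \<alpha> * esymp n y m =
      (\<Sum>w | w permutes {..<n}. ((\<Prod>i<n. (y \<circ> w) i ^ \<alpha> i) * esymp n (y \<circ> w) m) * hl_ker n t (y \<circ> w))"
    unfolding hl_sym_def sum_distrib_right
    by (intro sum.cong refl) (simp add: esymp_permutes)
  also have "\<dots> = (\<Sum>w | w permutes {..<n}. \<Sum>S\<in>ksubsets n m.
      (\<Prod>i<n. y (w i) ^ (\<alpha> i + of_bool (i \<in> S))) * hl_ker n t (y \<circ> w))"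
    unfolding prod_power_mult_esymp sum_distrib_right by simp
  also have "\<dots> = (\<Sum>S\<in>ksubsets n m. hl_sym n t y (\<lambda>i. \<alpha> i + of_bool (i \<in> S)))"
    unfolding hl_sym_def by (rule sum.swap)
  finally show ?thesis .
qed

text \<open>Exchanging the neighbours \<open>p\<close> and \<open>Suc p\<close> permutes all other
  ordered pairs among themselves and reverses only their own. The unspecified \<open>g\<close>
  serves both the kernel and the Vandermonde product.\<close>

lemma pair_prod_transpose:
  fixes g :: "'b \<Rightarrow> 'b \<Rightarrow> 'a::comm_monoid_mult" and z :: "nat \<Rightarrow> 'b"
  assumes p: "Suc p < n"
  obtains \<psi> where
    "(\<Prod>j<n. \<Prod>i<j. g (z i) (z j)) = g (z p) (z (Suc p)) * \<psi>"
    "(\<Prod>j<n. \<Prod>i<j. g (z (transpose p (Suc p) i)) (z (transpose p (Suc p) j))) = g (z (Suc p)) (z p) * \<psi>"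
proof -
  define \<tau> where "\<tau> = transpose p (Suc p)"
  define P where "P = Sigma {..<n} (\<lambda>j. {..<j})"
  define h where "h z = (\<lambda>(j, i). g (z i) (z j))" for z :: "nat \<Rightarrow> 'b"
  have ker: "(\<Prod>j<n. \<Prod>i<j. g (z i) (z j)) = h z (Suc p, p) * prod (h z) (P - {(Suc p, p)})" for z
  proof -
    have "(\<Prod>j<n. \<Prod>i<j. g (z i) (z j)) = prod (h z) P"
      unfolding P_def h_def by (subst prod.Sigma) auto
    also have "\<dots> = h z (Suc p, p) * prod (h z) (P - {(Suc p, p)})"
      using p by (intro prod.remove) (auto simp: P_def)
    finally show ?thesis .
  qed
  have bij: "bij_betw (map_prod \<tau> \<tau>) (P - {(Suc p, p)}) (P - {(Suc p, p)})"
    by (rule bij_betw_byWitness[where f' = "map_prod \<tau> \<tau>"])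
       (use p in \<open>auto simp: P_def \<tau>_def transpose_def split: if_splits\<close>)
  have "prod (h (z \<circ> \<tau>)) (P - {(Suc p, p)}) = prod (h z) (P - {(Suc p, p)})"
    using prod.reindex_bij_betw[OF bij, of "h z"] by (simp add: h_def case_prod_unfold)
  then show ?thesis
    using ker[of z] ker[of "z \<circ> \<tau>"]
    by (intro that[of "prod (h z) (P - {(Suc p, p)})"]) (simp_all add: h_def \<tau>_def)
qed

lemma hl_ker_transpose:
  assumes p: "Suc p < n"
  obtains \<psi> where
    "hl_ker n t z = (z p - t * z (Suc p)) / (z p - z (Suc p)) * \<psi>"
    "hl_ker n t (z \<circ> transpose p (Suc p)) = (z (Suc p) - t * z p) / (z (Suc p) - z p) * \<psi>"
  unfolding hl_ker_def comp_def
  by (rule pair_prod_transpose[OF p, of "\<lambda>u v. (u - t * v) / (u - v)" z])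

text \<open>The terms of \<open>w\<close> and \<open>w \<circ> \<tau>\<close> share everything but
  the factors in the values at \<open>p\<close> and \<open>Suc p\<close>, so the claim reduces to an
  identity in two values. Summing over all \<open>w\<close> counts each such pair twice, whence the
  condition on 2.\<close>

lemma hl_sym_transpose:
  fixes t :: "'a::field"
  assumes p: "Suc p < n" and \<alpha>: "\<alpha> (Suc p) = Suc (\<alpha> p)" and inj: "inj_on y {..<n}"
    and two: "(2::'a) \<noteq> 0"
  shows "hl_sym n t y \<alpha> = t * hl_sym n t y (\<alpha> \<circ> transpose p (Suc p))"
proof -
  define \<tau> where "\<tau> = transpose p (Suc p)"
  have \<tau>: "\<tau> permutes {..<n}" unfolding \<tau>_def using p by (intro permutes_swap_id) auto
  define F where "F \<alpha> w = (\<Prod>i<n. y (w i) ^ \<alpha> i) * hl_ker n t (y \<circ> w)" for \<alpha> w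
  have double: "2 * hl_sym n t y \<alpha> = (\<Sum>w | w permutes {..<n}. F \<alpha> w + F \<alpha> (w \<circ> \<tau>))" for \<alpha>
  proof -
    have "(\<Sum>w | w permutes {..<n}. F \<alpha> w) = (\<Sum>w | w permutes {..<n}. F \<alpha> (w \<circ> \<tau>))"
      using sum_permutations_compose_right[OF \<tau>, of "F \<alpha>"] .
    then show ?thesis by (simp add: hl_sym_def sum.distrib F_def)
  qed
  have pair: "F \<alpha> w + F \<alpha> (w \<circ> \<tau>) = t * (F (\<alpha> \<circ> \<tau>) w + F (\<alpha> \<circ> \<tau>) (w \<circ> \<tau>))"
    if w: "w permutes {..<n}" for w
  proof -
    define z where "z = y \<circ> w"
    have "z p \<noteq> z (Suc p)"
      using inj_onD[OF inj, of "w p" "w (Suc p)"] injD[OF permutes_inj[OF w], of p "Suc p"]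
        p permutes_in_image[OF w]
      by (auto simp: z_def)
    then have ne: "z p - z (Suc p) \<noteq> 0" "z (Suc p) - z p \<noteq> 0" by auto
    obtain \<psi> where \<psi>: "hl_ker n t z = (z p - t * z (Suc p)) / (z p - z (Suc p)) * \<psi>"
        "hl_ker n t (z \<circ> \<tau>) = (z (Suc p) - t * z p) / (z (Suc p) - z p) * \<psi>"
      unfolding \<tau>_def by (rule hl_ker_transpose[OF p])
    define C where "C = (\<Prod>i\<in>{..<n} - {p, Suc p}. z i ^ \<alpha> i)"
    have split: "(\<Prod>i<n. f i) = f p * f (Suc p) * (\<Prod>i\<in>{..<n} - {p, Suc p}. f i)" for f :: "nat \<Rightarrow> 'a"
    proof -
      have "(\<Prod>i<n. f i) = f p * (\<Prod>i\<in>{..<n} - {p}. f i)"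
        using p by (intro prod.remove) auto
      also have "(\<Prod>i\<in>{..<n} - {p}. f i) = f (Suc p) * (\<Prod>i\<in>{..<n} - {p} - {Suc p}. f i)"
        using p by (intro prod.remove) auto
      also have "{..<n} - {p} - {Suc p} = {..<n} - {p, Suc p}" by auto
      finally show ?thesis by (simp add: mult.assoc)
    qed
    have C\<tau>: "(\<Prod>i\<in>{..<n} - {p, Suc p}. z i ^ \<alpha> (\<tau> i)) = C"
        "(\<Prod>i\<in>{..<n} - {p, Suc p}. z (\<tau> i) ^ \<alpha> i) = C"
        "(\<Prod>i\<in>{..<n} - {p, Suc p}. z (\<tau> i) ^ \<alpha> (\<tau> i)) = C"
      unfolding C_def by (auto intro!: prod.cong simp: \<tau>_def transpose_def)
    have m: "(\<Prod>i<n. z i ^ \<alpha> i) = z p ^ \<alpha> p * z (Suc p) ^ Suc (\<alpha> p) * C"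
        "(\<Prod>i<n. z i ^ \<alpha> (\<tau> i)) = z p ^ Suc (\<alpha> p) * z (Suc p) ^ \<alpha> p * C"
        "(\<Prod>i<n. z (\<tau> i) ^ \<alpha> i) = z p ^ Suc (\<alpha> p) * z (Suc p) ^ \<alpha> p * C"
        "(\<Prod>i<n. z (\<tau> i) ^ \<alpha> (\<tau> i)) = z p ^ \<alpha> p * z (Suc p) ^ Suc (\<alpha> p) * C"
      unfolding split[of "\<lambda>i. z i ^ \<alpha> i"] split[of "\<lambda>i. z i ^ \<alpha> (\<tau> i)"]
        split[of "\<lambda>i. z (\<tau> i) ^ \<alpha> i"] split[of "\<lambda>i. z (\<tau> i) ^ \<alpha> (\<tau> i)"] C\<tau> C_def[symmetric]
      by (simp_all add: \<alpha> \<tau>_def)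
    define u v where "u = z p" and "v = z (Suc p)"
    \<comment> \<open>Over the common denominator \<open>u - v\<close> both sides become
      \<open>t * (u + v)\<close>.\<close>
    have key: "v * ((u - t * v) / (u - v)) + u * ((v - t * u) / (v - u))
        = t * (u * ((u - t * v) / (u - v)) + v * ((v - t * u) / (v - u)))"
    proof -
      have "(v - t * u) / (v - u) = - (v - t * u) / (u - v)"
        using ne by (metis minus_diff_eq minus_divide_divide minus_minus)
      then show ?thesis
        using ne by (simp add: u_def v_def divide_simps) (simp add: algebra_simps)
    qed
    have F: "F \<alpha> w = u ^ \<alpha> p * v ^ \<alpha> p * C * \<psi> * (v * ((u - t * v) / (u - v)))"
        "F \<alpha> (w \<circ> \<tau>) = u ^ \<alpha> p * v ^ \<alpha> p * C * \<psi> * (u * ((v - t * u) / (v - u)))"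
        "F (\<alpha> \<circ> \<tau>) w = u ^ \<alpha> p * v ^ \<alpha> p * C * \<psi> * (u * ((u - t * v) / (u - v)))"
        "F (\<alpha> \<circ> \<tau>) (w \<circ> \<tau>) = u ^ \<alpha> p * v ^ \<alpha> p * C * \<psi> * (v * ((v - t * u) / (v - u)))"
      using \<psi> m unfolding F_def z_def u_def v_def by (simp_all add: o_assoc)
    show ?thesis
      unfolding F by (simp only: key flip: distrib_left) (simp only: ac_simps)
  qed
  have "2 * hl_sym n t y \<alpha> = t * (2 * hl_sym n t y (\<alpha> \<circ> \<tau>))"
    unfolding double by (simp add: pair sum_distrib_left)
  then have "2 * hl_sym n t y \<alpha> = 2 * (t * hl_sym n t y (\<alpha> \<circ> \<tau>))"
    by (simp only: ac_simps)
  then show ?thesis using two by (simp add: \<tau>_def)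
qed

section \<open>Gaussian binomials and conjugate partitions\<close>

lemma tpoch_nonzero: "tpoch n \<noteq> 0"
proof -
  have "1 - tvar ^ j \<noteq> 0" if "0 < j" for j
  proof
    assume "1 - tvar ^ j = 0"
    then have "poly (1 - tvar ^ j) 0 = 0" by simp
    then show False using that by (simp add: tvar_def zero_power)
  qed
  then show ?thesis by (simp add: tpoch_def)
qed

lemma tbinom_0 [simp]: "tbinom n 0 = 1"
  using tbinom_exact[of 0 n] tpoch_nonzero[of n] by (simp add: tpoch_0)

lemma tbinom_self [simp]: "tbinom n n = 1"
  using tbinom_exact[of n n] tpoch_nonzero[of n] by (simp add: tpoch_0)

text \<open>Of the two Pascal rules this one matches the choice whether the last of
  \<open>Suc k\<close> positions is selected: if it is, it forms inversions with the
  \<open>k - r\<close> earlier positions that are not. For \<open>r > k\<close> all three binomials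
  are 0.\<close>

lemma tbinom_Suc_Suc: "tbinom (Suc k) (Suc r) = tbinom k (Suc r) + tvar ^ (k - r) * tbinom k r"
proof (cases r k rule: linorder_cases)
  case less
  then obtain d where k: "k = r + Suc d" by (metis less_iff_Suc_add add_Suc_right)
  have "tbinom (Suc k) (Suc r) * (tpoch (Suc r) * tpoch (Suc d)) = tpoch (Suc k)"
    using tbinom_exact[of "Suc r" "Suc k"] k by simp
  moreover have "tbinom k (Suc r) * (tpoch (Suc r) * tpoch (Suc d)) = (1 - tvar ^ Suc d) * tpoch k"
    using tbinom_exact[of "Suc r" k] k by (simp add: tpoch_Suc[of d] algebra_simps del: power_Suc)
  moreover have "tbinom k r * (tpoch (Suc r) * tpoch (Suc d)) = (1 - tvar ^ Suc r) * tpoch k"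
    using tbinom_exact[of r k] k by (simp add: tpoch_Suc[of r] algebra_simps del: power_Suc)
  moreover have "tpoch (Suc k) = (1 - tvar ^ Suc d) * tpoch k + tvar ^ Suc d * ((1 - tvar ^ Suc r) * tpoch k)"
  proof -
    have "1 - tvar ^ Suc k = (1 - tvar ^ Suc d) + tvar ^ Suc d * (1 - tvar ^ Suc r)"
      by (simp add: k power_add algebra_simps)
    then show ?thesis
      by (simp only: tpoch_Suc[of k] distrib_right mult.assoc)
  qed
  ultimately have "tbinom (Suc k) (Suc r) * (tpoch (Suc r) * tpoch (Suc d))
      = (tbinom k (Suc r) + tvar ^ (k - r) * tbinom k r) * (tpoch (Suc r) * tpoch (Suc d))"
    using k by (simp only: distrib_right mult.assoc) simp
  then show ?thesis using tpoch_nonzero by simp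
next
  case equal
  moreover from this have "tbinom k (Suc r) = 0" by (simp add: tbinom_def)
  ultimately show ?thesis by simp
next
  case greater
  then show ?thesis by (simp add: tbinom_def)
qed

text \<open>A level is a set of positions with equal \<open>\<kappa>\<close>; these are the
  inversions of the 0-1 words that \<open>S\<close> induces on the levels. Each costs one factor t
  when \<open>add_ones \<kappa> S\<close> is sorted.\<close>

definition level_invs :: "nat \<Rightarrow> (nat \<Rightarrow> nat) \<Rightarrow> nat set \<Rightarrow> (nat \<times> nat) set" where
  "level_invs n \<kappa> S = {(p, q). p < q \<and> q < n \<and> \<kappa> p = \<kappa> q \<and> p \<notin> S \<and> q \<in> S}"

lemma finite_level_invs: "finite (level_invs n \<kappa> S)"
  by (rule finite_subset[of _ "{..<n} \<times> {..<n}"]) (auto simp: level_invs_def)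

definition level_subsets :: "nat \<Rightarrow> (nat \<Rightarrow> nat) \<Rightarrow> (nat \<Rightarrow> nat) \<Rightarrow> nat set set" where
  "level_subsets n \<kappa> r = {S. S \<subseteq> {..<n} \<and> (\<forall>a. card {i\<in>S. \<kappa> i = a} = r a)}"

lemma finite_level_subsets: "finite (level_subsets n \<kappa> r)"
  by (rule finite_subset[of _ "Pow {..<n}"]) (auto simp: level_subsets_def)

lemma level_invs_Suc:
  assumes "S \<subseteq> {..<n}"
  shows "level_invs (Suc n) \<kappa> S = level_invs n \<kappa> S"
  using assms by (auto simp: level_invs_def less_Suc_eq)

lemma card_level_invs_insert:
  assumes S: "S \<subseteq> {..<n}"
  shows "card (level_invs (Suc n) \<kappa> (insert n S))
    = card (level_invs n \<kappa> S) + (card {i. i < n \<and> \<kappa> i = \<kappa> n} - card {i\<in>S. \<kappa> i = \<kappa> n})"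
proof -
  let ?D = "{i. i < n \<and> \<kappa> i = \<kappa> n} - {i\<in>S. \<kappa> i = \<kappa> n}"
  have e: "level_invs (Suc n) \<kappa> (insert n S) = level_invs n \<kappa> S \<union> (\<lambda>p. (p, n)) ` ?D"
    using S by (auto simp: level_invs_def less_Suc_eq)
  have d: "level_invs n \<kappa> S \<inter> (\<lambda>p. (p, n)) ` ?D = {}"
    by (auto simp: level_invs_def)
  have "card ((\<lambda>p. (p, n)) ` ?D) = card ?D"
    by (rule card_image) (auto simp: inj_on_def)
  also have "\<dots> = card {i. i < n \<and> \<kappa> i = \<kappa> n} - card {i\<in>S. \<kappa> i = \<kappa> n}"
    using S finite_subset[OF S] by (intro card_Diff_subset) auto
  finally show ?thesis
    unfolding e using d by (subst card_Un_disjoint) (auto simp: finite_level_invs)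
qed

text \<open>The case \<open>r (\<kappa> n) = 0\<close> is separate because truncated subtraction
  would return \<open>r\<close> itself and admit sets with one element too many.\<close>

lemma level_subsets_Suc:
  "level_subsets (Suc n) \<kappa> r = level_subsets n \<kappa> r \<union>
     (if r (\<kappa> n) = 0 then {} else insert n ` level_subsets n \<kappa> (r(\<kappa> n := r (\<kappa> n) - 1)))"
proof -
  have 1: "S \<in> level_subsets (Suc n) \<kappa> r \<longleftrightarrow> S \<in> level_subsets n \<kappa> r" if "n \<notin> S" for S
    using that by (auto simp: level_subsets_def less_Suc_eq subset_iff)
  have 2: "insert n S \<in> level_subsets (Suc n) \<kappa> r \<longleftrightarrow>
      r (\<kappa> n) \<noteq> 0 \<and> S \<in> level_subsets n \<kappa> (r(\<kappa> n := r (\<kappa> n) - 1))" if n: "n \<notin> S" for S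
  proof (cases "S \<subseteq> {..<n}")
    case True
    have fin: "finite S" using True by (rule finite_subset) simp
    have c: "card {i\<in>insert n S. \<kappa> i = a} = card {i\<in>S. \<kappa> i = a} + of_bool (a = \<kappa> n)" for a
    proof -
      have "{i\<in>insert n S. \<kappa> i = a} = (if a = \<kappa> n then insert n {i\<in>S. \<kappa> i = a} else {i\<in>S. \<kappa> i = a})"
        by auto
      then show ?thesis using fin n by simp
    qed
    have "(\<forall>a. card {i\<in>S. \<kappa> i = a} + of_bool (a = \<kappa> n) = r a) \<longleftrightarrow>
      r (\<kappa> n) \<noteq> 0 \<and> (\<forall>a. card {i\<in>S. \<kappa> i = a} = (r(\<kappa> n := r (\<kappa> n) - 1)) a)" (is "?L \<longleftrightarrow> ?R")
    proof
      assume L: ?L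
      then have "card {i\<in>S. \<kappa> i = \<kappa> n} + 1 = r (\<kappa> n)" by (rule allE[of _ "\<kappa> n"]) simp
      moreover have "card {i\<in>S. \<kappa> i = a} = r a" if "a \<noteq> \<kappa> n" for a
        using spec[OF L, of a] that by simp
      ultimately show ?R by (intro conjI allI) (simp_all add: fun_upd_apply, linarith+)
    next
      assume R: ?R
      show ?L
      proof
        fix a
        show "card {i\<in>S. \<kappa> i = a} + of_bool (a = \<kappa> n) = r a"
          using conjunct1[OF R] spec[OF conjunct2[OF R], of a] by (cases "a = \<kappa> n") simp_all
      qed
    qed
    moreover have "insert n S \<subseteq> {..<Suc n}" using True by auto
    ultimately show ?thesis
      using True by (simp only: level_subsets_def mem_Collect_eq c simp_thms)
  next
    case False
    then have "\<not> insert n S \<subseteq> {..<Suc n}" using n by (auto simp: less_Suc_eq)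
    then show ?thesis using False by (simp only: level_subsets_def mem_Collect_eq simp_thms)
  qed
  show ?thesis
  proof (rule set_eqI)
    fix S
    show "S \<in> level_subsets (Suc n) \<kappa> r \<longleftrightarrow> S \<in> level_subsets n \<kappa> r \<union>
     (if r (\<kappa> n) = 0 then {} else insert n ` level_subsets n \<kappa> (r(\<kappa> n := r (\<kappa> n) - 1)))"
    proof (cases "n \<in> S")
      case False
      then show ?thesis using 1 by auto
    next
      case True
      then have S: "insert n (S - {n}) = S" by auto
      have no: "S \<notin> level_subsets n \<kappa> r" using True by (auto simp: level_subsets_def)
      have "S \<in> insert n ` X \<longleftrightarrow> S - {n} \<in> X" if X: "\<And>T. T \<in> X \<Longrightarrow> n \<notin> T" for X :: "nat set set"
      proof
        assume "S \<in> insert n ` X"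
        then obtain T where "T \<in> X" "S = insert n T" by blast
        then show "S - {n} \<in> X" using X by simp
      next
        assume "S - {n} \<in> X"
        then show "S \<in> insert n ` X" using S by (intro image_eqI[of _ _ "S - {n}"]) simp_all
      qed
      moreover have "n \<notin> T" if "T \<in> level_subsets n \<kappa> r'" for T r'
        using that by (auto simp: level_subsets_def)
      ultimately show ?thesis using 2[of "S - {n}"] S no by auto
    qed
  qed
qed

text \<open>Different levels do not interact, and on one level the generating function of 0-1 words
  by inversions is a Gaussian binomial. The induction decides whether \<open>n\<close> is selected,
  which is the Pascal rule in the factor of the level of \<open>n\<close>.\<close>

lemma sum_level_invs:
  assumes "\<And>i. i < n \<Longrightarrow> \<kappa> i < B" and "\<And>a. B \<le> a \<Longrightarrow> r a = 0"
  shows "(\<Sum>S\<in>level_subsets n \<kappa> r. tvar ^ card (level_invs n \<kappa> S))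
    = (\<Prod>a<B. tbinom (card {i. i < n \<and> \<kappa> i = a}) (r a))"
  using assms
proof (induction n arbitrary: r)
  case 0
  have "level_subsets 0 \<kappa> r = (if r = (\<lambda>_. 0) then {{}} else {})"
    by (auto simp: level_subsets_def)
  \<comment> \<open>Without positions a nonzero \<open>r\<close> is unattainable, and one factor on
    the right vanishes accordingly; as \<open>r\<close> is 0 from \<open>B\<close> on, that factor
    does occur in the product.\<close>
  moreover have "\<exists>a<B. tbinom 0 (r a) = 0" if "r \<noteq> (\<lambda>_. 0)"
  proof -
    from that obtain a where "r a \<noteq> 0" by auto
    moreover from this have "a < B" using 0(2)[of a] by (cases "a < B") auto
    ultimately show ?thesis by (auto simp: tbinom_def)
  qed
  ultimately show ?case
    by (auto simp: level_invs_def)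
next
  case (Suc n)
  define a where "a = \<kappa> n"
  define c where "c b = card {i. i < n \<and> \<kappa> i = b}" for b
  have aB: "a < B" using Suc.prems by (simp add: a_def)
  have c': "card {i. i < Suc n \<and> \<kappa> i = b} = (if b = a then Suc (c a) else c b)" for b
  proof -
    have "{i. i < Suc n \<and> \<kappa> i = b} = (if b = a then insert n {i. i < n \<and> \<kappa> i = b} else {i. i < n \<and> \<kappa> i = b})"
      by (auto simp: a_def less_Suc_eq)
    then show ?thesis by (simp add: c_def)
  qed
  define R where "R = (\<Prod>b\<in>{..<B} - {a}. tbinom (c b) (r b))"
  have IH: "(\<Sum>S\<in>level_subsets n \<kappa> r'. tvar ^ card (level_invs n \<kappa> S)) = tbinom (c a) (r' a) * R"
    if "\<And>b. b \<noteq> a \<Longrightarrow> r' b = r b" for r'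
  proof -
    have "(\<Sum>S\<in>level_subsets n \<kappa> r'. tvar ^ card (level_invs n \<kappa> S)) = (\<Prod>b<B. tbinom (c b) (r' b))"
      unfolding c_def
    proof (rule Suc.IH)
      show "r' b = 0" if "B \<le> b" for b
        using that Suc.prems(2) aB \<open>\<And>b. b \<noteq> a \<Longrightarrow> r' b = r b\<close>[of b] by auto
    qed (use Suc.prems in auto)
    also have "\<dots> = tbinom (c a) (r' a) * (\<Prod>b\<in>{..<B} - {a}. tbinom (c b) (r' b))"
      using aB by (intro prod.remove) auto
    finally show ?thesis using that by (simp add: R_def)
  qed
  have "(\<Prod>b<B. tbinom (card {i. i < Suc n \<and> \<kappa> i = b}) (r b))
     = tbinom (Suc (c a)) (r a) * (\<Prod>b\<in>{..<B} - {a}. tbinom (card {i. i < Suc n \<and> \<kappa> i = b}) (r b))"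
    unfolding c' using aB by (subst prod.remove[of _ a]) auto
  also have "(\<Prod>b\<in>{..<B} - {a}. tbinom (card {i. i < Suc n \<and> \<kappa> i = b}) (r b)) = R"
    unfolding R_def c' by (intro prod.cong) auto
  finally have rhs: "(\<Prod>b<B. tbinom (card {i. i < Suc n \<and> \<kappa> i = b}) (r b)) = tbinom (Suc (c a)) (r a) * R" .
  have old: "(\<Sum>S\<in>level_subsets n \<kappa> r. tvar ^ card (level_invs (Suc n) \<kappa> S)) = tbinom (c a) (r a) * R"
  proof -
    have "(\<Sum>S\<in>level_subsets n \<kappa> r. tvar ^ card (level_invs (Suc n) \<kappa> S))
        = (\<Sum>S\<in>level_subsets n \<kappa> r. tvar ^ card (level_invs n \<kappa> S))"
      by (intro sum.cong refl) (simp add: level_subsets_def level_invs_Suc)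
    then show ?thesis using IH[of r] by simp
  qed
  show ?case
  proof (cases "r a")
    case 0
    then show ?thesis unfolding rhs level_subsets_Suc using old by (simp add: a_def)
  next
    case (Suc s)
    define X where "X = level_subsets n \<kappa> (r(a := s))"
    have X: "S \<subseteq> {..<n}" "card {i\<in>S. \<kappa> i = a} = s" if "S \<in> X" for S
      using that by (auto simp: X_def level_subsets_def)
    have inj: "inj_on (insert n) X"
    proof (rule inj_onI)
      fix S S' assume "S \<in> X" "S' \<in> X" "insert n S = insert n S'"
      moreover have "n \<notin> S" "n \<notin> S'" using X(1) \<open>S \<in> X\<close> \<open>S' \<in> X\<close> by auto
      ultimately show "S = S'" by (metis Diff_insert_absorb)
    qed
    have "(\<Sum>S\<in>insert n ` X. tvar ^ card (level_invs (Suc n) \<kappa> S))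
        = (\<Sum>S\<in>X. tvar ^ (c a - s) * tvar ^ card (level_invs n \<kappa> S))"
      unfolding sum.reindex[OF inj] using X
      by (intro sum.cong refl) (simp add: card_level_invs_insert c_def a_def add.commute flip: power_add)
    also have "\<dots> = tvar ^ (c a - s) * (tbinom (c a) s * R)"
      unfolding sum_distrib_left[symmetric] X_def by (subst IH) auto
    finally have new: "(\<Sum>S\<in>insert n ` X. tvar ^ card (level_invs (Suc n) \<kappa> S))
        = tvar ^ (c a - s) * (tbinom (c a) s * R)" .
    have un: "level_subsets (Suc n) \<kappa> r = level_subsets n \<kappa> r \<union> insert n ` X"
      unfolding level_subsets_Suc X_def using Suc by (simp add: a_def)
    have dis: "level_subsets n \<kappa> r \<inter> insert n ` X = {}"
      by (auto simp: level_subsets_def)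
    show ?thesis
      unfolding rhs un
      by (subst sum.union_disjoint)
         (use dis in \<open>auto simp: finite_level_subsets X_def old new[unfolded X_def] Suc tbinom_Suc_Suc algebra_simps\<close>)
  qed
qed

text \<open>Since \<open>lam\<close> decreases, the rows longer than \<open>j\<close> form an
  initial segment and are determined by their number. The translations between rows and columns
  below go through this symmetric form.\<close>

lemma less_iff_less_conj_part:
  assumes "is_partition lam"
  shows "j < lam i \<longleftrightarrow> i < conj_part lam j"
proof -
  have anti: "antimono lam" and fin: "finite {i. j < lam i}"
    using assms by (auto simp: is_partition_def elim!: rev_finite_subset)
  have "{i. j < lam i} = {..<conj_part lam j}"
  proof (cases "{i. j < lam i} = {}")
    case False
    have "{i. j < lam i} = {..Max {i. j < lam i}}"
    proof
      show "{i. j < lam i} \<subseteq> {..Max {i. j < lam i}}" using fin by auto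
      show "{..Max {i. j < lam i}} \<subseteq> {i. j < lam i}"
      proof
        fix i assume "i \<in> {..Max {i. j < lam i}}"
        then have "lam (Max {i. j < lam i}) \<le> lam i" using anti by (auto dest: antimonoD)
        moreover have "j < lam (Max {i. j < lam i})" using Max_in[OF fin False] by simp
        ultimately show "i \<in> {i. j < lam i}" by simp
      qed
    qed
    then have "{i. j < lam i} = {..<Suc (Max {i. j < lam i})}" by (simp add: lessThan_Suc_atMost)
    moreover from this have "conj_part lam j = Suc (Max {i. j < lam i})"
      unfolding conj_part_def by (metis card_lessThan)
    ultimately show ?thesis by simp
  qed (simp add: conj_part_def)
  then show ?thesis by blast
qed

lemma conj_part_conj_part: "is_partition lam \<Longrightarrow> conj_part (conj_part lam) = lam"
  by (rule ext) (simp add: conj_part_def[of "conj_part lam"] flip: less_iff_less_conj_part)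

text \<open>Stated for finite support because \<open>conj_part\<close> is also applied to
  \<open>add_ones \<kappa> S\<close>, which may fail to decrease; conjugating such a vector twice
  sorts it.\<close>

lemma is_partition_conj_part:
  assumes "finite {i. f i \<noteq> 0}"
  shows "is_partition (conj_part f)"
  unfolding is_partition_def
proof
  have fin: "finite {i. j < f i}" for j
    using assms by (auto elim!: rev_finite_subset)
  show "antimono (conj_part f)"
    unfolding conj_part_def by (intro antimonoI card_mono fin) auto
  have "{j. conj_part f j \<noteq> 0} \<subseteq> {..Max (f ` {i. f i \<noteq> 0})}"
  proof
    fix j assume "j \<in> {j. conj_part f j \<noteq> 0}"
    then have "{i. j < f i} \<noteq> {}" by (auto simp: conj_part_def simp del: Collect_empty_eq)
    then obtain i where "j < f i" by blast
    moreover from this have "f i \<le> Max (f ` {i. f i \<noteq> 0})" using assms by (intro Max_ge) auto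
    ultimately show "j \<in> {..Max (f ` {i. f i \<noteq> 0})}" by simp
  qed
  then show "finite {j. conj_part f j \<noteq> 0}" by (rule finite_subset) simp
qed

lemma finite_diagram:
  assumes "finite {i. f i \<noteq> 0}"
  shows "finite (diagram f)" "card (diagram f) = psize f"
proof -
  have "diagram f = Sigma {i. f i \<noteq> 0} (\<lambda>i. {..<f i})" by (auto simp: diagram_def)
  then show "finite (diagram f)" "card (diagram f) = psize f"
    using assms by (simp_all add: psize_def card_SigmaI)
qed

text \<open>Transposition of the cells of \<open>diagram f\<close>, which may fail to be a Young
  diagram.\<close>

lemma psize_conj_part:
  assumes "finite {i. f i \<noteq> 0}"
  shows "psize (conj_part f) = psize f"
proof -
  have fin: "finite {j. conj_part f j \<noteq> 0}" "\<And>j. finite {i. j < f i}"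
    using is_partition_conj_part[OF assms] assms
    by (auto simp: is_partition_def elim!: rev_finite_subset)
  have "bij_betw (\<lambda>(i, j). (j, i)) (diagram f) (Sigma {j. conj_part f j \<noteq> 0} (\<lambda>j. {i. j < f i}))"
    by (rule bij_betw_byWitness[where f' = "\<lambda>(j, i). (i, j)"])
       (use fin in \<open>auto simp: diagram_def conj_part_def card_gt_0_iff\<close>)
  then have "psize f = card (Sigma {j. conj_part f j \<noteq> 0} (\<lambda>j. {i. j < f i}))"
    using finite_diagram(2)[OF assms] by (simp add: bij_betw_same_card)
  also have "\<dots> = psize (conj_part f)"
    using fin by (simp add: card_SigmaI psize_def conj_part_def)
  finally show ?thesis by simp
qed

lemma plength_eq_conj_part: "plength f = conj_part f 0"
  by (simp add: plength_def conj_part_def)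

lemma is_partition_finite: "is_partition lam \<Longrightarrow> finite {i. lam i \<noteq> 0}"
  by (simp add: is_partition_def)

lemma plength_conj_part: "is_partition lam \<Longrightarrow> plength (conj_part lam) = lam 0"
  by (simp add: plength_eq_conj_part conj_part_conj_part)

lemma eq_0_iff_plength_le:
  assumes "is_partition lam"
  shows "lam i = 0 \<longleftrightarrow> plength lam \<le> i"
  using less_iff_less_conj_part[OF assms, of 0 i] by (auto simp: plength_eq_conj_part)

lemma conj_part_0: "conj_part (\<lambda>_. 0) = (\<lambda>_. 0)"
  by (simp add: conj_part_def)

lemma is_partition_0: "is_partition (\<lambda>_. 0)"
  by (simp add: is_partition_def monotone_def)

section \<open>The Pieri rule for Hall--Littlewood polynomials\<close>

lemma partition_le: "is_partition lam \<Longrightarrow> i \<le> j \<Longrightarrow> lam j \<le> lam i"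
  by (simp add: is_partition_def antimonoD)

definition hstrips :: "(nat \<Rightarrow> nat) \<Rightarrow> nat \<Rightarrow> (nat \<Rightarrow> nat) set" where
  "hstrips \<xi> m = {\<eta>. is_partition \<eta> \<and> horizontal_strip \<eta> \<xi> m}"

lemma hstripsD:
  assumes "\<eta> \<in> hstrips \<xi> m"
  shows "is_partition \<eta>" "\<eta> (Suc i) \<le> \<xi> i" "\<xi> i \<le> \<eta> i" "psize \<eta> = psize \<xi> + m"
  using assms by (auto simp: hstrips_def horizontal_strip_def)

lemma finite_hstrips: "finite (hstrips \<xi> m)"
  by (rule finite_subset[OF _ finite_partitions_of[of "psize \<xi> + m"]])
     (auto simp: hstrips_def horizontal_strip_def partitions_of_def)

abbreviation add_ones :: "(nat \<Rightarrow> nat) \<Rightarrow> nat set \<Rightarrow> nat \<Rightarrow> nat" where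
  "add_ones \<kappa> S \<equiv> (\<lambda>i. \<kappa> i + of_bool (i \<in> S))"

lemma finite_support_add_ones:
  "finite {i. \<kappa> i \<noteq> 0} \<Longrightarrow> finite S \<Longrightarrow> finite {i. add_ones \<kappa> S i \<noteq> 0}"
  by (rule finite_subset[of _ "{i. \<kappa> i \<noteq> 0} \<union> S"]) auto

text \<open>Raising an entry from \<open>j\<close> to \<open>j + 1\<close> gives row
  \<open>j\<close> of the conjugate one more box and changes no other row. Thus the conjugate sees
  \<open>S\<close> only through its counts on the levels.\<close>

lemma conj_part_add_ones:
  assumes "finite {i. \<kappa> i \<noteq> 0}" "finite S"
  shows "conj_part (add_ones \<kappa> S) j = conj_part \<kappa> j + card {i\<in>S. \<kappa> i = j}"
proof -
  have "{i. j < add_ones \<kappa> S i} = {i. j < \<kappa> i} \<union> {i\<in>S. \<kappa> i = j}"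
    by auto
  moreover have "finite {i. j < \<kappa> i}"
    using assms(1) by (auto elim!: rev_finite_subset)
  ultimately show ?thesis
    unfolding conj_part_def using assms(2) by (subst card_Un_disjoint[symmetric]) auto
qed

lemma psize_add_ones:
  assumes "finite {i. \<kappa> i \<noteq> 0}" "finite S"
  shows "psize (add_ones \<kappa> S) = psize \<kappa> + card S"
proof -
  let ?X = "{i. \<kappa> i \<noteq> 0} \<union> S"
  have "psize (add_ones \<kappa> S) = (\<Sum>i\<in>?X. add_ones \<kappa> S i)"
    unfolding psize_def using assms by (intro sum.mono_neutral_left) auto
  also have "\<dots> = (\<Sum>i\<in>?X. \<kappa> i) + (\<Sum>i\<in>?X. of_bool (i \<in> S))"
    by (rule sum.distrib)
  also have "(\<Sum>i\<in>?X. \<kappa> i) = psize \<kappa>"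
    unfolding psize_def using assms by (intro sum.mono_neutral_right) auto
  also have "(\<Sum>i\<in>?X. of_bool (i \<in> S)) = (\<Sum>i\<in>S. 1)"
    using assms by (intro sum.mono_neutral_cong_right) auto
  finally show ?thesis by simp
qed

text \<open>No entry grows by more than one, so no column of the conjugate receives two
  boxes.\<close>

lemma conj_part_add_ones_hstrips:
  assumes "finite {i. \<kappa> i \<noteq> 0}" "finite S"
  shows "conj_part (add_ones \<kappa> S) \<in> hstrips (conj_part \<kappa>) (card S)"
  unfolding hstrips_def horizontal_strip_def mem_Collect_eq
proof (intro conjI allI)
  note fin = finite_support_add_ones[OF assms]
  show "is_partition (conj_part (add_ones \<kappa> S))" by (rule is_partition_conj_part[OF fin])
  show "psize (conj_part (add_ones \<kappa> S)) = psize (conj_part \<kappa>) + card S"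
    by (simp only: psize_conj_part[OF fin] psize_conj_part[OF assms(1)] psize_add_ones[OF assms])
  show "conj_part \<kappa> i \<le> conj_part (add_ones \<kappa> S) i" for i
    by (simp only: conj_part_add_ones[OF assms])
  have f: "finite {i. j < \<kappa> i}" for j
    using assms(1) by (auto elim!: rev_finite_subset)
  show "conj_part (add_ones \<kappa> S) (Suc i) \<le> conj_part \<kappa> i" for i
    unfolding conj_part_def by (rule card_mono[OF f]) (auto split: if_splits simp: of_bool_def)
qed

text \<open>Row \<open>a\<close> gains as many boxes as \<open>S\<close> has elements on level
  \<open>a\<close>, so the sets that lead to a given \<open>\<eta>\<close> are those with prescribed
  level counts; comparing sizes then gives \<open>card S = m\<close>.\<close>

lemma add_ones_level_fibre:
  assumes \<xi>: "is_partition \<xi>" and \<eta>: "\<eta> \<in> hstrips \<xi> m"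
  shows "{S \<in> ksubsets n m. conj_part (add_ones (conj_part \<xi>) S) = \<eta>}
    = level_subsets n (conj_part \<xi>) (\<lambda>a. \<eta> a - \<xi> a)"
proof -
  have fin: "finite {i. conj_part \<xi> i \<noteq> 0}"
    using is_partition_conj_part[OF is_partition_finite[OF \<xi>]] by (rule is_partition_finite)
  have "card S = m \<and> conj_part (add_ones (conj_part \<xi>) S) = \<eta> \<longleftrightarrow>
      (\<forall>a. card {i\<in>S. conj_part \<xi> i = a} = \<eta> a - \<xi> a)" if "S \<subseteq> {..<n}" for S
  proof -
    have S: "finite S" using that by (rule finite_subset) simp
    note ca = conj_part_add_ones[OF fin S, unfolded conj_part_conj_part[OF \<xi>]]
    have h: "conj_part (add_ones (conj_part \<xi>) S) \<in> hstrips \<xi> (card S)"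
      using conj_part_add_ones_hstrips[OF fin S] by (simp only: conj_part_conj_part[OF \<xi>])
    have "conj_part (add_ones (conj_part \<xi>) S) = \<eta> \<longleftrightarrow>
      (\<forall>a. card {i\<in>S. conj_part \<xi> i = a} = \<eta> a - \<xi> a)"
      unfolding fun_eq_iff ca
    proof (intro all_cong1)
      fix a
      show "\<xi> a + card {i\<in>S. conj_part \<xi> i = a} = \<eta> a \<longleftrightarrow> card {i\<in>S. conj_part \<xi> i = a} = \<eta> a - \<xi> a"
        using hstripsD(3)[OF \<eta>, of a] by linarith
    qed
    moreover have "card S = m" if "conj_part (add_ones (conj_part \<xi>) S) = \<eta>"
      using hstripsD(4)[OF h] hstripsD(4)[OF \<eta>] that by simp
    ultimately show ?thesis by blast
  qed
  then show ?thesis unfolding ksubsets_def level_subsets_def by blast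
qed

text \<open>Monotonicity can fail only at neighbours with equal parts of which just the second is
  raised. The Hall-Littlewood side straightens such a pair, the Schur side loses the term.\<close>

lemma is_partition_add_ones:
  assumes "is_partition \<kappa>" "S \<subseteq> {..<n}"
    "\<And>p. Suc p < n \<Longrightarrow> p \<notin> S \<Longrightarrow> Suc p \<in> S \<Longrightarrow> \<kappa> p \<noteq> \<kappa> (Suc p)"
  shows "is_partition (add_ones \<kappa> S)"
  unfolding is_partition_def
proof
  have "add_ones \<kappa> S (Suc i) \<le> add_ones \<kappa> S i" for i
  proof -
    have "\<kappa> (Suc i) \<le> \<kappa> i" using partition_le[OF assms(1)] by simp
    moreover have "Suc i \<in> S \<Longrightarrow> i \<notin> S \<Longrightarrow> \<kappa> i \<noteq> \<kappa> (Suc i)"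
      using assms(2,3) by blast
    ultimately show ?thesis by (cases "Suc i \<in> S"; cases "i \<in> S") auto
  qed
  then show "antimono (add_ones \<kappa> S)" by (simp only: antimono_iff_le_Suc) blast
  have "finite S" using assms(2) by (rule finite_subset) simp
  then show "finite {i. add_ones \<kappa> S i \<noteq> 0}"
    using is_partition_finite[OF assms(1)] by (rule finite_support_add_ones[rotated])
qed

text \<open>As long as the vector is not decreasing, some adjacent pair is inverted; exchanging it
  costs one t and removes exactly one inversion. The double conjugate denotes the sorted
  vector.\<close>

lemma hl_sym_add_ones:
  fixes t :: "'a::field"
  assumes \<kappa>: "is_partition \<kappa>" and S: "S \<subseteq> {..<n}"
    and y: "inj_on y {..<n}" "(2::'a) \<noteq> 0"
  shows "hl_sym n t y (add_ones \<kappa> S)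
    = t ^ card (level_invs n \<kappa> S) * hl_sym n t y (conj_part (conj_part (add_ones \<kappa> S)))"
  using S
proof (induction "card (level_invs n \<kappa> S)" arbitrary: S rule: less_induct)
  case (less S)
  show ?case
  proof (cases "\<exists>p. Suc p < n \<and> p \<notin> S \<and> Suc p \<in> S \<and> \<kappa> p = \<kappa> (Suc p)")
    case True
    then obtain p where p: "Suc p < n" "p \<notin> S" "Suc p \<in> S" "\<kappa> p = \<kappa> (Suc p)" by blast
    define \<tau> where "\<tau> = transpose p (Suc p)"
    define S' where "S' = insert p (S - {Suc p})"
    have eq: "add_ones \<kappa> S \<circ> \<tau> = add_ones \<kappa> S'"
      using p by (auto simp: fun_eq_iff \<tau>_def S'_def transpose_def)
    \<comment> \<open>Moving entries to other positions does not change how many of them exceed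
      \<open>j\<close>, so the target of the sorting stays the same.\<close>
    have conj: "conj_part (add_ones \<kappa> S') = conj_part (add_ones \<kappa> S)"
    proof (rule ext)
      fix j
      have "{i. j < (add_ones \<kappa> S \<circ> \<tau>) i} = \<tau> ` {i. j < add_ones \<kappa> S i}"
      proof (intro equalityI subsetI)
        fix i assume "i \<in> {i. j < (add_ones \<kappa> S \<circ> \<tau>) i}"
        then show "i \<in> \<tau> ` {i. j < add_ones \<kappa> S i}"
          by (intro image_eqI[of _ _ "\<tau> i"]) (simp_all add: \<tau>_def)
      next
        fix i assume "i \<in> \<tau> ` {i. j < add_ones \<kappa> S i}"
        then obtain i' where "i = \<tau> i'" "j < add_ones \<kappa> S i'" by blast
        then show "i \<in> {i. j < (add_ones \<kappa> S \<circ> \<tau>) i}" by (simp add: \<tau>_def)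
      qed
      moreover have "inj_on \<tau> X" for X by (simp add: \<tau>_def)
      ultimately show "conj_part (add_ones \<kappa> S') j = conj_part (add_ones \<kappa> S) j"
        unfolding eq[symmetric] conj_part_def by (simp only: card_image)
    qed
    have \<tau>\<tau>: "\<tau> (\<tau> i) = i" for i by (simp add: \<tau>_def)
    have \<kappa>\<tau>: "\<kappa> (\<tau> i) = \<kappa> i" for i using p(4) by (simp add: \<tau>_def transpose_def)
    have n\<tau>: "\<tau> i < n \<longleftrightarrow> i < n" for i using p(1) by (simp add: \<tau>_def transpose_def)
    have S\<tau>: "\<tau> i \<in> S' \<longleftrightarrow> i \<in> S" for i using p(2,3) by (simp add: \<tau>_def transpose_def S'_def)
    then have S'\<tau>: "\<tau> i \<in> S \<longleftrightarrow> i \<in> S'" for i by (metis \<tau>\<tau>)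
    have less\<tau>: "\<tau> a < \<tau> b" if "a < b" "(a, b) \<noteq> (p, Suc p)" for a b
      using that by (auto simp: \<tau>_def transpose_def)
    \<comment> \<open>The exchange reverses the order of the pair \<open>(p, Suc p)\<close> only, so
      it carries the inversions of \<open>S'\<close> bijectively to those of \<open>S\<close> other
      than this pair.\<close>
    have invs: "level_invs n \<kappa> S = insert (p, Suc p) (map_prod \<tau> \<tau> ` level_invs n \<kappa> S')"
    proof (intro equalityI subsetI)
      fix x assume x: "x \<in> level_invs n \<kappa> S"
      obtain a b where ab: "x = (a, b)" by (cases x)
      show "x \<in> insert (p, Suc p) (map_prod \<tau> \<tau> ` level_invs n \<kappa> S')"
      proof (cases "x = (p, Suc p)")
        case False
        then have "(\<tau> a, \<tau> b) \<in> level_invs n \<kappa> S'"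
          using x ab less\<tau>[of a b] by (simp add: level_invs_def \<kappa>\<tau> n\<tau> S\<tau>)
        moreover have "x = map_prod \<tau> \<tau> (\<tau> a, \<tau> b)" by (simp add: ab \<tau>\<tau>)
        ultimately show ?thesis by blast
      qed simp
    next
      fix x assume "x \<in> insert (p, Suc p) (map_prod \<tau> \<tau> ` level_invs n \<kappa> S')"
      then consider "x = (p, Suc p)" | a b where "x = (\<tau> a, \<tau> b)" "(a, b) \<in> level_invs n \<kappa> S'"
        by auto
      then show "x \<in> level_invs n \<kappa> S"
      proof cases
        case 1
        then show ?thesis using p by (simp add: level_invs_def)
      next
        case 2
        then have "(a, b) \<noteq> (p, Suc p)" by (auto simp: level_invs_def S'_def)
        then show ?thesis using 2 less\<tau>[of a b] by (simp add: level_invs_def \<kappa>\<tau> n\<tau> S'\<tau>)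
      qed
    qed
    have "(p, Suc p) \<notin> map_prod \<tau> \<tau> ` level_invs n \<kappa> S'"
    proof
      assume "(p, Suc p) \<in> map_prod \<tau> \<tau> ` level_invs n \<kappa> S'"
      then obtain a b where "\<tau> a = p" "\<tau> b = Suc p" "a < b" by (auto simp: level_invs_def)
      then show False by (auto simp: \<tau>_def transpose_def split: if_splits)
    qed
    moreover have "inj_on (map_prod \<tau> \<tau>) X" for X
      by (rule inj_on_subset[OF _ subset_UNIV]) (intro prod.inj_map, simp_all add: \<tau>_def)
    ultimately have card: "card (level_invs n \<kappa> S) = Suc (card (level_invs n \<kappa> S'))"
      unfolding invs by (simp add: finite_level_invs card_image)
    have S'n: "S' \<subseteq> {..<n}" using less.prems p by (auto simp: S'_def)
    have "hl_sym n t y (add_ones \<kappa> S) = t * hl_sym n t y (add_ones \<kappa> S')"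
      using hl_sym_transpose[OF p(1) _ y, of "add_ones \<kappa> S" t] p eq by (simp add: \<tau>_def)
    also have "hl_sym n t y (add_ones \<kappa> S') =
        t ^ card (level_invs n \<kappa> S') * hl_sym n t y (conj_part (conj_part (add_ones \<kappa> S')))"
      using card S'n by (intro less.hyps) simp_all
    finally show ?thesis by (simp add: card conj)
  next
    case False
    then have part: "is_partition (add_ones \<kappa> S)"
      using less.prems by (intro is_partition_add_ones[OF \<kappa>]) auto
    have "level_invs n \<kappa> S = {}"
    proof (rule equals0I)
      fix x assume "x \<in> level_invs n \<kappa> S"
      then obtain a b where ab: "a < b" "\<kappa> a = \<kappa> b" "a \<notin> S" "b \<in> S" by (auto simp: level_invs_def)
      have "add_ones \<kappa> S b \<le> add_ones \<kappa> S a"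
        using ab(1) by (intro partition_le[OF part]) simp
      then show False using ab by simp
    qed
    then show ?thesis by (simp add: conj_part_conj_part[OF part])
  qed
qed

text \<open>These are the multiplicities that enter the normalization v of the conjugate; only that
  of the part 0 depends on the number of variables.\<close>

lemma card_conj_part_level:
  assumes \<xi>: "is_partition \<xi>" and n: "\<xi> 0 \<le> n"
  shows "card {i. i < n \<and> conj_part \<xi> i = 0} = n - \<xi> 0"
    and "card {i. i < n \<and> conj_part \<xi> i = Suc a} = \<xi> a - \<xi> (Suc a)"
proof -
  have iff: "j < conj_part \<xi> i \<longleftrightarrow> i < \<xi> j" for i j
    using less_iff_less_conj_part[OF is_partition_conj_part[OF is_partition_finite[OF \<xi>]], of j i]
    by (simp only: conj_part_conj_part[OF \<xi>])
  have "{i. i < n \<and> conj_part \<xi> i = 0} = {\<xi> 0..<n}"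
  proof (rule set_eqI)
    fix i
    show "i \<in> {i. i < n \<and> conj_part \<xi> i = 0} \<longleftrightarrow> i \<in> {\<xi> 0..<n}"
      using iff[of 0 i] by auto
  qed
  then show "card {i. i < n \<and> conj_part \<xi> i = 0} = n - \<xi> 0" by simp
  have le: "\<xi> a \<le> n" using partition_le[OF \<xi>, of 0 a] n by simp
  have "{i. i < n \<and> conj_part \<xi> i = Suc a} = {\<xi> (Suc a)..<\<xi> a}"
  proof (rule set_eqI)
    fix i
    show "i \<in> {i. i < n \<and> conj_part \<xi> i = Suc a} \<longleftrightarrow> i \<in> {\<xi> (Suc a)..<\<xi> a}"
      using iff[of a i] iff[of "Suc a" i] le by auto
  qed
  then show "card {i. i < n \<and> conj_part \<xi> i = Suc a} = \<xi> a - \<xi> (Suc a)" by simp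
qed

text \<open>The unbounded product runs over the factors different from 1; for shapes of finite
  support these are finitely many, since \<open>tbinom 0 0 = 1\<close>. It is both the
  Hall-Littlewood Pieri coefficient and the factor for one \<open>k\<close> in the theorem.\<close>

definition strip_coeff :: "(nat \<Rightarrow> nat) \<Rightarrow> (nat \<Rightarrow> nat) \<Rightarrow> int poly" where
  "strip_coeff \<eta> \<xi> = (\<Prod>i. tbinom (\<eta> i - \<eta> (i + 1)) (\<xi> i - \<eta> (i + 1)))"

text \<open>Multiplying by \<open>\<Prod>a. tpoch (r a) * tpoch (k a - r a)\<close>, where \<open>k a\<close> is the number of
  parts \<open>a\<close> of the conjugate of \<open>\<xi>\<close> and \<open>r a\<close> is the number of those that grow, turns both
  products of Gaussian binomials into products of \<open>tpoch\<close>.\<close>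

lemma strip_coeff_mult_tpoch:
  assumes \<xi>: "is_partition \<xi>" and \<eta>: "\<eta> \<in> hstrips \<xi> m" and n: "\<eta> 0 \<le> n"
    and C: "\<And>a. C \<le> a \<Longrightarrow> \<eta> a = 0"
  shows "strip_coeff \<eta> \<xi> * (\<Prod>a<Suc C. tpoch (card {i. i < n \<and> conj_part \<xi> i = a}))
    = (\<Prod>a<Suc C. tbinom (card {i. i < n \<and> conj_part \<xi> i = a}) (\<eta> a - \<xi> a))
      * (\<Prod>a<Suc C. tpoch (card {i. i < n \<and> conj_part \<eta> i = a}))"
proof -
  note le = hstripsD(2,3)[OF \<eta>]
  define r where "r a = \<eta> a - \<xi> a" for a
  define k where "k a = card {i. i < n \<and> conj_part \<xi> i = a}" for a
  define l where "l a = card {i. i < n \<and> conj_part \<eta> i = a}" for a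
  have \<xi>n: "\<xi> 0 \<le> n" using le(2)[of 0] n by simp
  have k: "k 0 = n - \<xi> 0" "k (Suc a) = \<xi> a - \<xi> (Suc a)" for a
    unfolding k_def by (rule card_conj_part_level[OF \<xi> \<xi>n])+
  have l: "l 0 = n - \<eta> 0" "l (Suc a) = \<eta> a - \<eta> (Suc a)" for a
    unfolding l_def by (rule card_conj_part_level[OF hstripsD(1)[OF \<eta>] n])+
  have C\<xi>: "\<xi> a = 0" if "C \<le> a" for a using C[OF that] le(2)[of a] by simp
  have rk: "r a \<le> k a" for a
  proof (cases a)
    case 0
    then show ?thesis using n k by (simp add: r_def)
  next
    case (Suc b)
    then show ?thesis using le(1)[of b] le(2)[of "Suc b"] k(2)[of b] by (simp add: r_def)
  qed
  define D where "D = (\<Prod>a<Suc C. tpoch (r a) * tpoch (k a - r a))"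
  have kD: "(\<Prod>a<Suc C. tbinom (k a) (r a)) * D = (\<Prod>a<Suc C. tpoch (k a))"
    unfolding D_def prod.distrib[symmetric] by (intro prod.cong refl tbinom_exact rk)
  have coeff: "strip_coeff \<eta> \<xi> = (\<Prod>a<C. tbinom (\<eta> a - \<eta> (Suc a)) (\<xi> a - \<eta> (Suc a)))"
    unfolding strip_coeff_def Suc_eq_plus1[symmetric]
  proof (rule Prod_any.expand_superset)
    show "{a. tbinom (\<eta> a - \<eta> (Suc a)) (\<xi> a - \<eta> (Suc a)) \<noteq> 1} \<subseteq> {..<C}"
    proof
      fix a assume "a \<in> {a. tbinom (\<eta> a - \<eta> (Suc a)) (\<xi> a - \<eta> (Suc a)) \<noteq> 1}"
      then show "a \<in> {..<C}" using C[of a] C\<xi>[of a] by (cases "a < C") auto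
    qed
  qed simp
  \<comment> \<open>Both products are re-indexed by the rows of \<open>\<eta>\<close>: level
    \<open>C\<close> gains nothing because \<open>\<eta> C = 0\<close>, and level 0 of the second
    product yields \<open>tpoch (n - \<eta> 0)\<close>, the factor that the conjugate of
    \<open>\<eta>\<close> has for the part 0.\<close>
  have "D = (\<Prod>a<Suc C. tpoch (r a)) * (\<Prod>a<Suc C. tpoch (k a - r a))"
    unfolding D_def by (rule prod.distrib)
  also have "(\<Prod>a<Suc C. tpoch (r a)) = (\<Prod>a<C. tpoch (r a))"
    using C[of C] by (simp add: r_def tpoch_0)
  also have "(\<Prod>a<Suc C. tpoch (k a - r a)) = tpoch (k 0 - r 0) * (\<Prod>a<C. tpoch (k (Suc a) - r (Suc a)))"
    by (rule prod.lessThan_Suc_shift)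
  also have "k 0 - r 0 = n - \<eta> 0" using le(2)[of 0] n by (simp add: k r_def)
  also have "(\<Prod>a<C. tpoch (k (Suc a) - r (Suc a))) = (\<Prod>a<C. tpoch (\<xi> a - \<eta> (Suc a)))"
  proof (intro prod.cong refl arg_cong[of _ _ tpoch])
    fix a show "k (Suc a) - r (Suc a) = \<xi> a - \<eta> (Suc a)"
      using le(1)[of a] le(2)[of "Suc a"] by (simp add: k r_def)
  qed
  finally have D: "D = tpoch (n - \<eta> 0) * (\<Prod>a<C. tpoch (\<xi> a - \<eta> (Suc a)) * tpoch (r a))"
    by (simp add: prod.distrib ac_simps)
  have "strip_coeff \<eta> \<xi> * (\<Prod>a<C. tpoch (\<xi> a - \<eta> (Suc a)) * tpoch (r a)) = (\<Prod>a<C. tpoch (\<eta> a - \<eta> (Suc a)))"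
    unfolding coeff prod.distrib[symmetric]
  proof (intro prod.cong refl)
    fix a
    have "\<eta> a - \<eta> (Suc a) - (\<xi> a - \<eta> (Suc a)) = r a" "\<xi> a - \<eta> (Suc a) \<le> \<eta> a - \<eta> (Suc a)"
      using le(1)[of a] le(2)[of a] by (auto simp: r_def)
    then show "tbinom (\<eta> a - \<eta> (Suc a)) (\<xi> a - \<eta> (Suc a)) * (tpoch (\<xi> a - \<eta> (Suc a)) * tpoch (r a))
        = tpoch (\<eta> a - \<eta> (Suc a))"
      using tbinom_exact by metis
  qed
  then have lD: "strip_coeff \<eta> \<xi> * D = (\<Prod>a<Suc C. tpoch (l a))"
    unfolding D prod.lessThan_Suc_shift l by (simp add: mult.left_commute)
  have "strip_coeff \<eta> \<xi> * (\<Prod>a<Suc C. tpoch (k a)) =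
      (\<Prod>a<Suc C. tbinom (k a) (r a)) * (strip_coeff \<eta> \<xi> * D)"
    unfolding kD[symmetric] by (simp only: ac_simps)
  then show ?thesis unfolding lD k_def l_def r_def .
qed

section \<open>Constants, variables and normalizing factors in the fraction field\<close>

lemma tconst_0 [simp]: "tconst 0 = 0"
  by (simp add: tconst_def)

lemma tconst_1 [simp]: "tconst 1 = 1"
  by (simp add: tconst_def)

lemma tconst_add: "tconst (a + b) = tconst a + tconst b"
  by (simp add: tconst_def single_add)

lemma tconst_diff: "tconst (a - b) = tconst a - tconst b"
  by (simp add: tconst_def single_diff)

lemma tconst_mult: "tconst (a * b) = tconst a * tconst b"
  by (simp add: tconst_def mult_single flip: to_fract_mult)

lemma tconst_power: "tconst (a ^ n) = tconst a ^ n"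
  by (induction n) (simp_all add: tconst_mult)

lemma tconst_sum: "tconst (sum f A) = (\<Sum>x\<in>A. tconst (f x))"
  by (induction A rule: infinite_finite_induct) (simp_all add: tconst_add)

lemma tconst_prod: "tconst (prod f A) = (\<Prod>x\<in>A. tconst (f x))"
  by (induction A rule: infinite_finite_induct) (simp_all add: tconst_mult)

lemma single_eq_0_iff: "Poly_Mapping.single k a = 0 \<longleftrightarrow> a = 0"
  by (metis lookup_single_eq lookup_zero single_zero)

lemma tconst_eq_0_iff [simp]: "tconst a = 0 \<longleftrightarrow> a = 0"
  by (simp add: tconst_def single_eq_0_iff)

lemma xvar_eq_iff: "xvar i = xvar j \<longleftrightarrow> i = j"
proof
  assume "xvar i = xvar j"
  then have "Poly_Mapping.single (Poly_Mapping.single i (1::nat)) (1::int poly) =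
      Poly_Mapping.single (Poly_Mapping.single j 1) 1"
    by (simp add: xvar_def)
  then have "Poly_Mapping.keys (Poly_Mapping.single (Poly_Mapping.single i (1::nat)) (1::int poly)) =
      Poly_Mapping.keys (Poly_Mapping.single (Poly_Mapping.single j (1::nat)) (1::int poly))"
    by (rule arg_cong)
  then have "Poly_Mapping.single j (1::nat) = Poly_Mapping.single i 1" by simp
  then have "Poly_Mapping.lookup (Poly_Mapping.single j (1::nat)) i = 1" by simp
  then show "i = j" by (simp add: lookup_single when_def split: if_splits)
qed simp

lemma xvar_nonzero: "xvar i \<noteq> 0"
  by (simp add: xvar_def single_eq_0_iff)

lemma inj_on_xvar: "inj_on xvar A"
  by (simp add: inj_on_def xvar_eq_iff)

lemma two_nonzero: "(2 :: xpoly fract) \<noteq> 0"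
proof -
  have "(2 :: xpoly fract) = to_fract 2"
    by (metis one_add_one to_fract_1 to_fract_add)
  moreover have "(2 :: xpoly) \<noteq> 0" by simp
  ultimately show ?thesis by (metis to_fract_eq_0_iff)
qed

lemma one_minus_tvar_nonzero: "1 - tconst tvar \<noteq> 0"
  using tpoch_nonzero[of 1] tconst_eq_0_iff[of "1 - tvar"] by (simp add: tpoch_def tconst_diff)

lemma hl_v_eq: "(1 - tconst tvar) ^ m * hl_v m = tconst (tpoch m)"
proof -
  have "hl_v m = (\<Prod>i=1..m. 1 - tconst tvar ^ i) / (1 - tconst tvar) ^ m"
    by (simp add: hl_v_def prod_dividef)
  then show ?thesis
    using one_minus_tvar_nonzero by (simp add: tpoch_def tconst_prod tconst_diff tconst_power)
qed

lemma hl_v_nonzero: "hl_v m \<noteq> 0"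
  using hl_v_eq[of m] tpoch_nonzero[of m] by auto

text \<open>The multiplicities sum to \<open>n\<close>, so one power of \<open>1 - t\<close> clears
  all denominators at once. The product may run over all values below \<open>B\<close> because an
  absent one contributes \<open>hl_v 0 = 1\<close>.\<close>

lemma hl_v_part_eq:
  assumes "\<And>i. i < n \<Longrightarrow> lam i < B"
  shows "(1 - tconst tvar) ^ n * hl_v_part n lam = tconst (\<Prod>a<B. tpoch (card {i. i < n \<and> lam i = a}))"
proof -
  have "hl_v_part n lam = (\<Prod>a<B. hl_v (card {i. i < n \<and> lam i = a}))"
    unfolding hl_v_part_def
  proof (rule prod.mono_neutral_left)
    show "lam ` {..<n} \<subseteq> {..<B}" using assms by auto
    show "\<forall>a\<in>{..<B} - lam ` {..<n}. hl_v (card {i. i < n \<and> lam i = a}) = 1"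
    proof
      fix a assume "a \<in> {..<B} - lam ` {..<n}"
      then have "{i. i < n \<and> lam i = a} = {}" by auto
      then show "hl_v (card {i. i < n \<and> lam i = a}) = 1" by (simp only: card.empty) (simp add: hl_v_def)
    qed
  qed simp
  moreover have "(1 - tconst tvar) ^ n = (\<Prod>a<B. (1 - tconst tvar) ^ card {i. i < n \<and> lam i = a})"
  proof -
    have "(\<Sum>a<B. card {i. i < n \<and> lam i = a}) = (\<Sum>a<B. \<Sum>i\<in>{i\<in>{..<n}. lam i = a}. 1)"
      by (intro sum.cong refl) (simp add: lessThan_def)
    also have "\<dots> = (\<Sum>i<n. 1)"
      using assms by (intro sum.group) auto
    finally show ?thesis by (simp flip: power_sum)
  qed
  ultimately show ?thesis
    by (simp add: tconst_prod hl_v_eq flip: prod.distrib)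
qed

lemma hl_v_part_nonzero: "hl_v_part n lam \<noteq> 0"
  by (simp add: hl_v_part_def hl_v_nonzero)

lemma hall_littlewood_eq:
  "hall_littlewood n lam = (if plength lam \<le> n
     then hl_sym n (tconst tvar) xvar lam / hl_v_part n lam else 0)"
  by (simp add: hall_littlewood_def hl_sym_def hl_ker_def)

text \<open>Symmetrizing the monomial 1 gives the bare sum of the kernels, which
  \<open>sum_hl_ker\<close> evaluates to v_n, the normalization for \<open>n\<close> parts equal to
  0.\<close>

lemma hall_littlewood_0: "hall_littlewood n (\<lambda>_. 0) = 1"
proof -
  have "(1 - tconst tvar) ^ n * hl_v_part n (\<lambda>_. 0) = tconst (tpoch n)"
    using hl_v_part_eq[of n "\<lambda>_. 0" 1] by (simp add: lessThan_def)
  moreover have "(1 - tconst tvar) ^ n * hl_sym n (tconst tvar) xvar (\<lambda>_. 0) = tconst (tpoch n)"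
  proof -
    have "0 \<notin> xvar ` {..<n}" using xvar_nonzero by (metis imageE)
    then show ?thesis
      using sum_hl_ker[OF inj_on_xvar, of n "tconst tvar"]
      by (simp add: hl_sym_def tpoch_def tconst_prod tconst_diff tconst_power)
  qed
  ultimately have "(1 - tconst tvar) ^ n * hl_sym n (tconst tvar) xvar (\<lambda>_. 0)
      = (1 - tconst tvar) ^ n * hl_v_part n (\<lambda>_. 0)" by simp
  then have "hl_sym n (tconst tvar) xvar (\<lambda>_. 0) = hl_v_part n (\<lambda>_. 0)"
    using one_minus_tvar_nonzero by simp
  then show ?thesis
    using hl_v_part_nonzero by (simp add: hall_littlewood_eq plength_def)
qed

text \<open>Expanding over subsets and sorting each exponent vector leaves, for each
  \<open>\<eta>\<close>, the inversion generating function of a level fibre times the symmetrization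
  for the conjugate of \<open>\<eta>\<close>. Passing to normalized polynomials on both sides turns
  these binomials into \<open>strip_coeff\<close>. If \<open>\<xi> 0 > n\<close>, everything is
  0.\<close>

lemma hall_littlewood_pieri:
  assumes \<xi>: "is_partition \<xi>"
  shows "hall_littlewood n (conj_part \<xi>) * esymp n xvar m
    = (\<Sum>\<eta>\<in>hstrips \<xi> m. tconst (strip_coeff \<eta> \<xi>) * hall_littlewood n (conj_part \<eta>))"
proof (cases "\<xi> 0 \<le> n")
  case False
  have "hall_littlewood n (conj_part \<eta>) = 0" if "\<eta> \<in> hstrips \<xi> m" for \<eta>
    using hstripsD(3)[OF that, of 0] False plength_conj_part[OF hstripsD(1)[OF that]]
    by (simp add: hall_littlewood_eq)
  then show ?thesis using False plength_conj_part[OF \<xi>] by (simp add: hall_littlewood_eq)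
next
  case True
  define T where "T = tconst tvar"
  define \<kappa> where "\<kappa> = conj_part \<xi>"
  have \<kappa>: "is_partition \<kappa>" "conj_part \<kappa> = \<xi>" "plength \<kappa> \<le> n"
    using is_partition_conj_part[OF is_partition_finite[OF \<xi>]] conj_part_conj_part[OF \<xi>]
      plength_conj_part[OF \<xi>] True
    by (simp_all add: \<kappa>_def)
  \<comment> \<open>Subsets of \<open>n\<close> positions lead only to these strips; for the others
    the polynomial in \<open>n\<close> variables is 0 by definition.\<close>
  define X where "X = {\<eta>\<in>hstrips \<xi> m. \<eta> 0 \<le> n}"
  have conj_in: "conj_part (add_ones \<kappa> S) \<in> X" if "S \<in> ksubsets n m" for S
  proof -
    have S: "S \<subseteq> {..<n}" "finite S" "card S = m"
      using that finite_subset[of S "{..<n}"] by (auto simp: ksubsets_def)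
    have "conj_part (add_ones \<kappa> S) \<in> hstrips \<xi> m"
      using conj_part_add_ones_hstrips[OF is_partition_finite[OF \<kappa>(1)] S(2)] S(3) \<kappa>(2) by simp
    moreover have "conj_part (add_ones \<kappa> S) 0 \<le> card {..<n}"
      unfolding conj_part_def
    proof (intro card_mono subsetI)
      fix i assume "i \<in> {i. 0 < add_ones \<kappa> S i}"
      then show "i \<in> {..<n}"
        using eq_0_iff_plength_le[OF \<kappa>(1), of i] \<kappa>(3) S(1) by (cases "i \<in> S") auto
    qed simp
    ultimately show ?thesis by (simp add: X_def)
  qed
  have fibre: "(\<Sum>S\<in>{S\<in>ksubsets n m. conj_part (add_ones \<kappa> S) = \<eta>}. hl_sym n T xvar (add_ones \<kappa> S))
      = hl_v_part n \<kappa> * (tconst (strip_coeff \<eta> \<xi>) * hall_littlewood n (conj_part \<eta>))"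
    if "\<eta> \<in> X" for \<eta>
  proof -
    have \<eta>: "\<eta> \<in> hstrips \<xi> m" "\<eta> 0 \<le> n" using that by (auto simp: X_def)
    note p\<eta> = hstripsD(1)[OF \<eta>(1)]
    \<comment> \<open>\<open>C\<close> bounds the number of rows of \<open>\<eta>\<close>, hence the
      parts of both conjugates; the levels are therefore 0 to \<open>C\<close>, which explains the
      bound \<open>Suc C\<close>.\<close>
    obtain C where C: "\<And>a. C \<le> a \<Longrightarrow> \<eta> a = 0"
      using eq_0_iff_plength_le[OF p\<eta>] by blast
    have C\<xi>: "\<xi> a = 0" if "C \<le> a" for a using C[OF that] hstripsD(3)[OF \<eta>(1), of a] by simp
    have bound: "\<kappa> i < Suc C" "conj_part \<eta> i < Suc C" for i
    proof -
      have "\<not> C < \<kappa> i" using less_iff_less_conj_part[OF \<kappa>(1), of C i] \<kappa>(2) C\<xi>[of C] by simp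
      then show "\<kappa> i < Suc C" by simp
      have "\<not> C < conj_part \<eta> i"
        using less_iff_less_conj_part[OF is_partition_conj_part[OF is_partition_finite[OF p\<eta>]], of C i]
          conj_part_conj_part[OF p\<eta>] C[of C] by simp
      then show "conj_part \<eta> i < Suc C" by simp
    qed
    define b where "b = (\<Prod>a<Suc C. tbinom (card {i. i < n \<and> \<kappa> i = a}) (\<eta> a - \<xi> a))"
    \<comment> \<open>The exchange of normalizations: multiplied by \<open>(1 - T) ^ n\<close>, both
      factors v become products of \<open>tpoch\<close>, to which
      \<open>strip_coeff_mult_tpoch\<close> applies.\<close>
    have key: "tconst (strip_coeff \<eta> \<xi>) * hl_v_part n \<kappa> = tconst b * hl_v_part n (conj_part \<eta>)"
    proof -
      have "(1 - T) ^ n * (tconst (strip_coeff \<eta> \<xi>) * hl_v_part n \<kappa>)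
          = tconst (strip_coeff \<eta> \<xi> * (\<Prod>a<Suc C. tpoch (card {i. i < n \<and> \<kappa> i = a})))"
        using hl_v_part_eq[of n \<kappa> "Suc C"] bound(1)
        by (simp only: T_def tconst_mult mult.left_commute)
      also have "\<dots> = tconst (b * (\<Prod>a<Suc C. tpoch (card {i. i < n \<and> conj_part \<eta> i = a})))"
        using strip_coeff_mult_tpoch[OF \<xi> \<eta> C] by (simp only: b_def \<kappa>_def)
      also have "\<dots> = (1 - T) ^ n * (tconst b * hl_v_part n (conj_part \<eta>))"
        using hl_v_part_eq[of n "conj_part \<eta>" "Suc C"] bound(2)
        by (simp only: T_def tconst_mult mult.left_commute)
      finally show ?thesis using one_minus_tvar_nonzero by (simp add: T_def)
    qed
    have "(\<Sum>S\<in>{S\<in>ksubsets n m. conj_part (add_ones \<kappa> S) = \<eta>}. hl_sym n T xvar (add_ones \<kappa> S))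
       = (\<Sum>S\<in>{S\<in>ksubsets n m. conj_part (add_ones \<kappa> S) = \<eta>}.
            T ^ card (level_invs n \<kappa> S) * hl_sym n T xvar (conj_part \<eta>))"
    proof (rule sum.cong[OF refl])
      fix S assume S: "S \<in> {S\<in>ksubsets n m. conj_part (add_ones \<kappa> S) = \<eta>}"
      then have "S \<subseteq> {..<n}" by (simp add: ksubsets_def)
      from hl_sym_add_ones[OF \<kappa>(1) this inj_on_xvar two_nonzero, of T] S
      show "hl_sym n T xvar (add_ones \<kappa> S) = T ^ card (level_invs n \<kappa> S) * hl_sym n T xvar (conj_part \<eta>)"
        by simp
    qed
    also have "\<dots> = tconst (\<Sum>S\<in>level_subsets n \<kappa> (\<lambda>a. \<eta> a - \<xi> a). tvar ^ card (level_invs n \<kappa> S))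
        * hl_sym n T xvar (conj_part \<eta>)"
      using add_ones_level_fibre[OF \<xi> \<eta>(1), of n]
      by (simp only: \<kappa>_def tconst_sum tconst_power T_def sum_distrib_right)
    also have "(\<Sum>S\<in>level_subsets n \<kappa> (\<lambda>a. \<eta> a - \<xi> a). tvar ^ card (level_invs n \<kappa> S)) = b"
      unfolding b_def using bound C by (intro sum_level_invs) auto
    also have "hl_sym n T xvar (conj_part \<eta>) = hl_v_part n (conj_part \<eta>) * hall_littlewood n (conj_part \<eta>)"
      using \<eta>(2) plength_conj_part[OF p\<eta>] hl_v_part_nonzero by (simp add: hall_littlewood_eq T_def)
    also have "tconst b * (hl_v_part n (conj_part \<eta>) * hall_littlewood n (conj_part \<eta>))
        = (tconst (strip_coeff \<eta> \<xi>) * hl_v_part n \<kappa>) * hall_littlewood n (conj_part \<eta>)"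
      unfolding key by (rule mult.assoc[symmetric])
    finally show ?thesis by (simp only: ac_simps)
  qed
  have "hl_sym n T xvar \<kappa> * esymp n xvar m = (\<Sum>S\<in>ksubsets n m. hl_sym n T xvar (add_ones \<kappa> S))"
    by (rule hl_sym_mult_esymp)
  also have "\<dots> = (\<Sum>\<eta>\<in>X. \<Sum>S\<in>{S\<in>ksubsets n m. conj_part (add_ones \<kappa> S) = \<eta>}. hl_sym n T xvar (add_ones \<kappa> S))"
    using conj_in by (intro sum.group[symmetric]) (auto simp: X_def finite_ksubsets finite_hstrips)
  also have "\<dots> = (\<Sum>\<eta>\<in>X. hl_v_part n \<kappa> * (tconst (strip_coeff \<eta> \<xi>) * hall_littlewood n (conj_part \<eta>)))"
    by (intro sum.cong refl fibre)
  also have "\<dots> = (\<Sum>\<eta>\<in>hstrips \<xi> m. hl_v_part n \<kappa> * (tconst (strip_coeff \<eta> \<xi>) * hall_littlewood n (conj_part \<eta>)))"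
  proof (intro sum.mono_neutral_left ballI)
    fix \<eta> assume "\<eta> \<in> hstrips \<xi> m - X"
    then have "\<not> plength (conj_part \<eta>) \<le> n"
      using plength_conj_part[OF hstripsD(1), of \<eta> \<xi> m] by (simp add: X_def)
    then show "hl_v_part n \<kappa> * (tconst (strip_coeff \<eta> \<xi>) * hall_littlewood n (conj_part \<eta>)) = 0"
      by (simp add: hall_littlewood_eq)
  qed (auto simp: X_def finite_hstrips)
  finally have "hl_sym n T xvar \<kappa> * esymp n xvar m = hl_v_part n \<kappa> *
      (\<Sum>\<eta>\<in>hstrips \<xi> m. tconst (strip_coeff \<eta> \<xi>) * hall_littlewood n (conj_part \<eta>))"
    by (simp only: sum_distrib_left)
  then show ?thesis
    using \<kappa>(3) hl_v_part_nonzero[of n \<kappa>]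
    by (simp add: hall_littlewood_eq field_simps flip: \<kappa>_def T_def)
qed

section \<open>The Pieri rule for Schur polynomials\<close>

definition alternant :: "nat \<Rightarrow> (nat \<Rightarrow> nat) \<Rightarrow> xpoly fract" where
  "alternant n \<alpha> = (\<Sum>w | w permutes {..<n}. of_int (sign w) * (\<Prod>i<n. xvar (w i) ^ \<alpha> i))"

definition vdm :: "nat \<Rightarrow> xpoly fract" where
  "vdm n = (\<Prod>j<n. \<Prod>i<j. xvar i - xvar j)"

lemma vdm_nonzero: "vdm n \<noteq> 0"
  by (auto simp: vdm_def xvar_eq_iff)

lemma schur_eq:
  "schur n lam = (if plength lam \<le> n then alternant n (\<lambda>i. lam i + (n - 1 - i)) / vdm n else 0)"
  by (simp add: schur_def alternant_def vdm_def)

lemma alternant_mult_esymp: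
  "alternant n \<alpha> * esymp n xvar m = (\<Sum>S\<in>ksubsets n m. alternant n (add_ones \<alpha> S))"
proof -
  have "alternant n \<alpha> * esymp n xvar m = (\<Sum>w | w permutes {..<n}.
      of_int (sign w) * ((\<Prod>i<n. (xvar \<circ> w) i ^ \<alpha> i) * esymp n (xvar \<circ> w) m))"
    unfolding alternant_def sum_distrib_right
    by (intro sum.cong refl) (simp add: esymp_permutes)
  also have "\<dots> = (\<Sum>w | w permutes {..<n}. \<Sum>S\<in>ksubsets n m.
      of_int (sign w) * (\<Prod>i<n. xvar (w i) ^ (add_ones \<alpha> S i)))"
    unfolding prod_power_mult_esymp sum_distrib_left by simp
  also have "\<dots> = (\<Sum>S\<in>ksubsets n m. alternant n (add_ones \<alpha> S))"
    unfolding alternant_def by (rule sum.swap)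
  finally show ?thesis .
qed

text \<open>Composing with the exchange of two positions of equal exponent keeps the monomial and
  flips the sign, so the alternant is its own negative.\<close>

lemma alternant_eq_0:
  assumes p: "Suc p < n" and \<alpha>: "\<alpha> p = \<alpha> (Suc p)"
  shows "alternant n \<alpha> = 0"
proof -
  define \<tau> where "\<tau> = transpose p (Suc p)"
  have \<tau>: "\<tau> permutes {..<n}" unfolding \<tau>_def using p by (intro permutes_swap_id) auto
  define F where "F w = of_int (sign w) * (\<Prod>i<n. xvar (w i) ^ \<alpha> i)" for w
  have neg: "F (w \<circ> \<tau>) = - F w" if w: "w permutes {..<n}" for w
  proof -
    have "sign (w \<circ> \<tau>) = - sign w"
      using w \<tau> by (simp add: \<tau>_def sign_compose sign_swap_id permutation_swap_id
          permutation_permutes[THEN iffD2] exI[of _ "{..<n}"])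
    moreover have "(\<Prod>i<n. xvar ((w \<circ> \<tau>) i) ^ \<alpha> i) = (\<Prod>i<n. xvar (w i) ^ \<alpha> i)"
    proof -
      have "(\<Prod>i<n. xvar (w i) ^ \<alpha> i) = (\<Prod>i<n. xvar (w (\<tau> i)) ^ \<alpha> (\<tau> i))"
        using prod.permute[OF \<tau>, of "\<lambda>i. xvar (w i) ^ \<alpha> i"] by (simp add: comp_def)
      moreover have "\<alpha> (\<tau> i) = \<alpha> i" for i using \<alpha> by (simp add: \<tau>_def transpose_def)
      ultimately show ?thesis by simp
    qed
    ultimately show ?thesis by (simp add: F_def)
  qed
  have "(\<Sum>w | w permutes {..<n}. F w) = (\<Sum>w | w permutes {..<n}. F (w \<circ> \<tau>))"
    by (rule sum_permutations_compose_right[OF \<tau>])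
  also have "\<dots> = (\<Sum>w | w permutes {..<n}. - F w)"
    by (intro sum.cong refl) (simp add: neg)
  also have "\<dots> = - (\<Sum>w | w permutes {..<n}. F w)"
    by (rule sum_negf)
  finally have "(\<Sum>w | w permutes {..<n}. F w) = - (\<Sum>w | w permutes {..<n}. F w)" .
  then have "2 * (\<Sum>w | w permutes {..<n}. F w) = 0" by (simp only: mult_2 eq_neg_iff_add_eq_0)
  then show ?thesis using two_nonzero by (simp add: F_def alternant_def)
qed

text \<open>Adding ones on a set to the exponents of an alternant leads either to another partition
  shifted by \<delta> or to two equal neighbouring exponents, which kill the alternant. Each
  surviving partition comes from exactly one set, so no multiplicities arise.\<close>

lemma schur_pieri:
  assumes \<xi>: "is_partition \<xi>"
  shows "schur n (conj_part \<xi>) * esymp n xvar m = (\<Sum>\<eta>\<in>hstrips \<xi> m. schur n (conj_part \<eta>))"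
proof (cases "\<xi> 0 \<le> n")
  case False
  have "schur n (conj_part \<eta>) = 0" if "\<eta> \<in> hstrips \<xi> m" for \<eta>
    using hstripsD(3)[OF that, of 0] False plength_conj_part[OF hstripsD(1)[OF that]]
    by (simp add: schur_eq)
  then show ?thesis using False plength_conj_part[OF \<xi>] by (simp add: schur_eq)
next
  case True
  define \<kappa> where "\<kappa> = conj_part \<xi>"
  have \<kappa>: "is_partition \<kappa>" "conj_part \<kappa> = \<xi>" "plength \<kappa> \<le> n"
    using is_partition_conj_part[OF is_partition_finite[OF \<xi>]] conj_part_conj_part[OF \<xi>]
      plength_conj_part[OF \<xi>] True
    by (simp_all add: \<kappa>_def)
  define alt where "alt lam = alternant n (\<lambda>i. lam i + (n - 1 - i))" for lam
  define Y where "Y = {S\<in>ksubsets n m. is_partition (add_ones \<kappa> S)}"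
  define X where "X = {\<eta>\<in>hstrips \<xi> m. \<eta> 0 \<le> n}"
  have "alt \<kappa> * esymp n xvar m = (\<Sum>S\<in>ksubsets n m. alt (add_ones \<kappa> S))"
    unfolding alt_def alternant_mult_esymp by (intro sum.cong refl arg_cong[of _ _ "alternant n"]) auto
  also have "\<dots> = (\<Sum>S\<in>Y. alt (add_ones \<kappa> S))"
  proof (rule sum.mono_neutral_right[OF finite_ksubsets])
    show "\<forall>S\<in>ksubsets n m - Y. alt (add_ones \<kappa> S) = 0"
    proof
      fix S assume S: "S \<in> ksubsets n m - Y"
      then obtain p where p: "Suc p < n" "p \<notin> S" "Suc p \<in> S" "\<kappa> p = \<kappa> (Suc p)"
        using is_partition_add_ones[OF \<kappa>(1), of S n] by (auto simp: Y_def ksubsets_def)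
      \<comment> \<open>From \<open>p\<close> to \<open>Suc p\<close> the exponent
        \<open>n - 1 - i\<close> drops by one, and raising only the entry at \<open>Suc p\<close>
        makes up for it.\<close>
      show "alt (add_ones \<kappa> S) = 0"
        unfolding alt_def by (rule alternant_eq_0[OF p(1)]) (use p in simp)
    qed
  qed (simp add: Y_def)
  also have "\<dots> = (\<Sum>\<eta>\<in>X. alt (conj_part \<eta>))"
  \<comment> \<open>The set is recovered from the strip as the positions whose entry grew.\<close>
  proof (rule sum.reindex_bij_witness[where i = "\<lambda>\<eta>. {i. \<kappa> i < conj_part \<eta> i}"
        and j = "\<lambda>S. conj_part (add_ones \<kappa> S)"])
    fix S assume "S \<in> Y"
    then have S: "S \<subseteq> {..<n}" "finite S" "card S = m" and part: "is_partition (add_ones \<kappa> S)"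
      using finite_subset[of S "{..<n}"] by (auto simp: Y_def ksubsets_def)
    note cc = conj_part_conj_part[OF part]
    show "{i. \<kappa> i < conj_part (conj_part (add_ones \<kappa> S)) i} = S" by (simp add: cc)
    show "alt (conj_part (conj_part (add_ones \<kappa> S))) = alt (add_ones \<kappa> S)" by (simp only: cc)
    have "conj_part (add_ones \<kappa> S) \<in> hstrips \<xi> m"
      using conj_part_add_ones_hstrips[OF is_partition_finite[OF \<kappa>(1)] S(2)] S(3) \<kappa>(2) by simp
    moreover have "add_ones \<kappa> S n = 0"
      using eq_0_iff_plength_le[OF \<kappa>(1), of n] \<kappa>(3) S(1) by auto
    then have "conj_part (add_ones \<kappa> S) 0 \<le> n"
      using eq_0_iff_plength_le[OF part] by (simp only: plength_eq_conj_part)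
    ultimately show "conj_part (add_ones \<kappa> S) \<in> X" by (simp add: X_def)
  next
    fix \<eta> assume "\<eta> \<in> X"
    then have \<eta>: "\<eta> \<in> hstrips \<xi> m" "\<eta> 0 \<le> n" by (auto simp: X_def)
    note p\<eta> = hstripsD(1)[OF \<eta>(1)]
    define lam where "lam = conj_part \<eta>"
    have lam: "is_partition lam" "conj_part lam = \<eta>"
      using is_partition_conj_part[OF is_partition_finite[OF p\<eta>]] conj_part_conj_part[OF p\<eta>]
      by (simp_all add: lam_def)
    define S where "S = {i. \<kappa> i < lam i}"
    have iff: "j < \<kappa> i \<longleftrightarrow> i < \<xi> j" "j < lam i \<longleftrightarrow> i < \<eta> j" for i j
      using less_iff_less_conj_part[OF \<kappa>(1), of j i] less_iff_less_conj_part[OF lam(1), of j i]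
      by (simp_all only: \<kappa>(2) lam(2))
    \<comment> \<open>Read through \<open>iff\<close>, containment of \<open>\<xi>\<close> in
      \<open>\<eta>\<close> gives this bound and interlacing gives the next one: each entry grows by
      0 or 1.\<close>
    have le: "\<kappa> i \<le> lam i" for i
    proof (rule ccontr)
      assume "\<not> \<kappa> i \<le> lam i"
      then have "i < \<xi> (lam i)" using iff(1)[of "lam i" i] by simp
      then have "lam i < lam i" using iff(2)[of "lam i" i] hstripsD(3)[OF \<eta>(1), of "lam i"] by simp
      then show False by simp
    qed
    have ge: "lam i \<le> Suc (\<kappa> i)" for i
    proof (rule ccontr)
      assume "\<not> lam i \<le> Suc (\<kappa> i)"
      then have "i < \<eta> (Suc (\<kappa> i))" using iff(2)[of "Suc (\<kappa> i)" i] by simp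
      then have "\<kappa> i < \<kappa> i" using iff(1)[of "\<kappa> i" i] hstripsD(2)[OF \<eta>(1), of "\<kappa> i"] by simp
      then show False by simp
    qed
    have eq: "add_ones \<kappa> S = lam"
    proof
      fix i show "add_ones \<kappa> S i = lam i"
        using le[of i] ge[of i] by (cases "\<kappa> i < lam i") (auto simp: S_def)
    qed
    have Sn: "S \<subseteq> {..<n}"
    proof
      fix i assume "i \<in> S"
      then have "i < \<eta> 0" using iff(2)[of 0 i] by (simp add: S_def)
      then show "i \<in> {..<n}" using \<eta>(2) by simp
    qed
    then have "finite S" by (rule finite_subset) simp
    have "conj_part (add_ones \<kappa> S) \<in> hstrips \<xi> (card S)"
      using conj_part_add_ones_hstrips[OF is_partition_finite[OF \<kappa>(1)] \<open>finite S\<close>] \<kappa>(2) by simp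
    then have "card S = m"
      using hstripsD(4)[OF \<eta>(1)] hstripsD(4) eq lam(2) by fastforce
    then show "{i. \<kappa> i < conj_part \<eta> i} \<in> Y"
      using Sn eq lam(1) by (simp add: Y_def ksubsets_def S_def lam_def)
    show "conj_part (add_ones \<kappa> {i. \<kappa> i < conj_part \<eta> i}) = \<eta>"
      using eq lam(2) by (simp only: S_def lam_def)
  qed
  finally have "schur n \<kappa> * esymp n xvar m = (\<Sum>\<eta>\<in>X. alt (conj_part \<eta>) / vdm n)"
    using \<kappa>(3) by (simp add: schur_eq alt_def flip: sum_divide_distrib)
  also have "\<dots> = (\<Sum>\<eta>\<in>X. schur n (conj_part \<eta>))"
    by (intro sum.cong refl)
       (auto simp: X_def schur_eq alt_def plength_conj_part dest: hstripsD(1))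
  also have "\<dots> = (\<Sum>\<eta>\<in>hstrips \<xi> m. schur n (conj_part \<eta>))"
  proof (intro sum.mono_neutral_left ballI)
    fix \<eta> assume "\<eta> \<in> hstrips \<xi> m - X"
    then have "\<not> plength (conj_part \<eta>) \<le> n"
      using plength_conj_part[OF hstripsD(1), of \<eta> \<xi> m] by (simp add: X_def)
    then show "schur n (conj_part \<eta>) = 0" by (simp add: schur_eq)
  qed (auto simp: X_def finite_hstrips)
  finally show ?thesis by (simp only: \<kappa>_def)
qed

section \<open>Bases satisfying a Pieri rule\<close>

text \<open>A symmetric function is a function of the number \<open>n\<close> of variables; the scalars are the
  polynomials in \<open>t\<close>.\<close>

interpretation fam: module "\<lambda>(c::int poly) (f::nat \<Rightarrow> xpoly fract) n. tconst c * f n"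
  by unfold_locales (auto simp: fun_eq_iff algebra_simps tconst_add tconst_mult)

text \<open>Boxes count more the lower they lie, so among strips of one length on one shape those
  further down are heavier. The factor is \<open>Suc i\<close> and not \<open>i\<close> so that
  deleting the only row of a one-row shape lowers the weight too.\<close>

definition wt :: "(nat \<Rightarrow> nat) \<Rightarrow> nat" where
  "wt \<eta> = (\<Sum>i | \<eta> i \<noteq> 0. Suc i * \<eta> i)"

lemma wt_eq:
  assumes "is_partition \<eta>" "plength \<eta> \<le> N"
  shows "wt \<eta> = (\<Sum>i<N. Suc i * \<eta> i)"
  unfolding wt_def using eq_0_iff_plength_le[OF assms(1)] assms(2)
  by (intro sum.mono_neutral_left) (auto simp: not_less[symmetric])

lemma psize_eq:
  assumes "is_partition \<eta>" "plength \<eta> \<le> N"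
  shows "psize \<eta> = (\<Sum>i<N. \<eta> i)"
  unfolding psize_def using eq_0_iff_plength_le[OF assms(1)] assms(2)
  by (intro sum.mono_neutral_left) (auto simp: not_less[symmetric])

lemma hstrips_plength:
  assumes "is_partition \<xi>" "\<zeta> \<in> hstrips \<xi> m"
  shows "plength \<zeta> \<le> Suc (plength \<xi>)"
proof -
  have "\<zeta> (Suc (plength \<xi>)) = 0"
    using hstripsD(2)[OF assms(2), of "plength \<xi>"] eq_0_iff_plength_le[OF assms(1), of "plength \<xi>"]
    by simp
  then show ?thesis using eq_0_iff_plength_le[OF hstripsD(1)[OF assms(2)]] by blast
qed

text \<open>The added boxes lie in the first \<open>plength \<xi> + 1\<close> rows; equality of weights forces all
  of them into the last of these rows.\<close>

lemma hstrips_wt: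
  assumes \<xi>: "is_partition \<xi>" and \<zeta>: "\<zeta> \<in> hstrips \<xi> m"
  shows "wt \<zeta> + (\<Sum>i<plength \<xi>. (plength \<xi> - i) * (\<zeta> i - \<xi> i)) = wt \<xi> + Suc (plength \<xi>) * m"
proof -
  define L where "L = plength \<xi>"
  note le = hstripsD(3)[OF \<zeta>]
  have pl: "plength \<zeta> \<le> Suc L" "plength \<xi> \<le> Suc L"
    using hstrips_plength[OF \<xi> \<zeta>] by (auto simp: L_def)
  have "m = psize \<zeta> - psize \<xi>" using hstripsD(4)[OF \<zeta>] by simp
  also have "\<dots> = (\<Sum>i<Suc L. \<zeta> i - \<xi> i)"
    unfolding psize_eq[OF \<xi> pl(2)] psize_eq[OF hstripsD(1)[OF \<zeta>] pl(1)]
    by (rule sum_subtractf_nat[symmetric]) (rule le)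
  finally have m: "m = (\<Sum>i<Suc L. \<zeta> i - \<xi> i)" .
  have "wt \<zeta> + (\<Sum>i<L. (L - i) * (\<zeta> i - \<xi> i)) = wt \<zeta> + (\<Sum>i<Suc L. (L - i) * (\<zeta> i - \<xi> i))"
    by simp
  also have "\<dots> = (\<Sum>i<Suc L. Suc i * \<zeta> i + (L - i) * (\<zeta> i - \<xi> i))"
    unfolding wt_eq[OF hstripsD(1)[OF \<zeta>] pl(1)] by (rule sum.distrib[symmetric])
  also have "\<dots> = (\<Sum>i<Suc L. Suc i * \<xi> i + Suc L * (\<zeta> i - \<xi> i))"
  proof (rule sum.cong[OF refl])
    fix i assume "i \<in> {..<Suc L}"
    then obtain d where d: "L = i + d" by (metis le_add_diff_inverse lessThan_iff less_Suc_eq_le)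
    obtain e where e: "\<zeta> i = \<xi> i + e" using le le_Suc_ex by blast
    show "Suc i * \<zeta> i + (L - i) * (\<zeta> i - \<xi> i) = Suc i * \<xi> i + Suc L * (\<zeta> i - \<xi> i)"
      by (simp add: d e algebra_simps)
  qed
  also have "\<dots> = wt \<xi> + Suc L * m"
    unfolding wt_eq[OF \<xi> pl(2)] m sum.distrib sum_distrib_left ..
  finally show ?thesis unfolding L_def .
qed

definition drop_row :: "(nat \<Rightarrow> nat) \<Rightarrow> (nat \<Rightarrow> nat)" where
  "drop_row \<eta> = \<eta>(plength \<eta> - 1 := 0)"

text \<open>The boxes of the last row form a horizontal strip. Any other strip of the same length on
  the remaining shape has boxes in earlier rows, so \<open>\<eta>\<close> is the unique heaviest;
  this is the source of triangularity.\<close>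

lemma drop_row:
  assumes \<eta>: "is_partition \<eta>" "\<eta> \<noteq> (\<lambda>_. 0)"
  obtains m where "0 < m" "is_partition (drop_row \<eta>)" "Suc (plength (drop_row \<eta>)) = plength \<eta>"
    "\<eta> \<in> hstrips (drop_row \<eta>) m" "wt \<eta> = wt (drop_row \<eta>) + plength \<eta> * m"
    "\<And>\<zeta>. \<zeta> \<in> hstrips (drop_row \<eta>) m \<Longrightarrow> \<zeta> \<noteq> \<eta> \<Longrightarrow> wt \<zeta> < wt \<eta>"
proof -
  note z = eq_0_iff_plength_le[OF \<eta>(1)]
  obtain l where l: "plength \<eta> = Suc l"
  proof (cases "plength \<eta>")
    case 0
    then have "\<eta> = (\<lambda>_. 0)" using z by auto
    then show ?thesis using \<eta>(2) by simp
  qed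
  define m where "m = \<eta> l"
  define \<xi> where "\<xi> = drop_row \<eta>"
  have \<xi>_eq: "\<xi> i = (if i = l then 0 else \<eta> i)" for i by (simp add: \<xi>_def drop_row_def l)
  have m0: "0 < m" using z[of l] l by (auto simp: m_def)
  have big: "\<eta> i = 0" if "l < i" for i using z[of i] l that by simp
  have \<xi>: "is_partition \<xi>"
    unfolding is_partition_def
  proof
    show "antimono \<xi>"
      unfolding antimono_iff_le_Suc
      using partition_le[OF \<eta>(1)] big by (auto simp: \<xi>_eq)
    show "finite {i. \<xi> i \<noteq> 0}"
      by (rule finite_subset[OF _ is_partition_finite[OF \<eta>(1)]]) (auto simp: \<xi>_eq)
  qed
  have pl: "plength \<xi> = l"
  proof (rule antisym)
    show "plength \<xi> \<le> l" using eq_0_iff_plength_le[OF \<xi>, of l] by (simp add: \<xi>_eq)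
    show "l \<le> plength \<xi>"
      using eq_0_iff_plength_le[OF \<xi>, of "plength \<xi>"] z[of "plength \<xi>"] l by (auto simp: \<xi>_eq split: if_splits)
  qed
  have size: "psize \<eta> = psize \<xi> + m"
    using psize_eq[OF \<eta>(1), of "Suc l"] psize_eq[OF \<xi>, of "Suc l"] l pl
    by (simp add: \<xi>_eq m_def cong: sum.cong_simp)
  have hs: "\<eta> \<in> hstrips \<xi> m"
    using \<eta>(1) size partition_le[OF \<eta>(1)] big by (auto simp: hstrips_def horizontal_strip_def \<xi>_eq)
  have wt: "wt \<eta> = wt \<xi> + Suc l * m"
    using wt_eq[OF \<eta>(1), of "Suc l"] wt_eq[OF \<xi>, of "Suc l"] l pl
    by (simp add: \<xi>_eq m_def cong: sum.cong_simp)
  have less: "wt \<zeta> < wt \<eta>" if \<zeta>: "\<zeta> \<in> hstrips \<xi> m" "\<zeta> \<noteq> \<eta>" for \<zeta>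
  proof (rule ccontr)
    assume "\<not> wt \<zeta> < wt \<eta>"
    then have "(\<Sum>i<l. (l - i) * (\<zeta> i - \<xi> i)) = 0"
      using hstrips_wt[OF \<xi> \<zeta>(1)] wt unfolding pl by linarith
    then have "\<forall>i\<in>{..<l}. \<zeta> i \<le> \<xi> i" by auto
    then have eq: "\<zeta> i = \<xi> i" if "i < l" for i
      by (intro antisym hstripsD(3)[OF \<zeta>(1)]) (use that in simp)
    have pz: "plength \<zeta> \<le> Suc l" using hstrips_plength[OF \<xi> \<zeta>(1)] pl by simp
    have "(\<Sum>i<Suc l. \<zeta> i) = (\<Sum>i<Suc l. \<eta> i)"
      using psize_eq[OF hstripsD(1)[OF \<zeta>(1)] pz] psize_eq[OF \<eta>(1), of "Suc l"] l
        hstripsD(4)[OF \<zeta>(1)] size by simp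
    moreover have "(\<Sum>i<l. \<zeta> i) = (\<Sum>i<l. \<eta> i)" using eq by (simp add: \<xi>_eq)
    ultimately have "\<zeta> l = \<eta> l" by simp
    have "\<zeta> = \<eta>"
    proof
      fix i
      show "\<zeta> i = \<eta> i"
        using eq[of i] \<open>\<zeta> l = \<eta> l\<close> big[of i] pz eq_0_iff_plength_le[OF hstripsD(1)[OF \<zeta>(1)], of i]
        by (cases i l rule: linorder_cases) (auto simp: \<xi>_eq)
    qed
    then show False using \<zeta>(2) by simp
  qed
  show ?thesis
    using m0 \<xi> pl l hs wt less by (intro that[of m]) (simp_all add: \<xi>_def)
qed

abbreviation famprod :: "(nat \<Rightarrow> xpoly fract) \<Rightarrow> nat \<Rightarrow> nat \<Rightarrow> xpoly fract" where
  "famprod f m \<equiv> (\<lambda>n. f n * esymp n xvar m)"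

text \<open>Members are labelled by the conjugates of the usual labels. The last assumption allows
  the Pieri relation at \<open>drop_row \<eta>\<close> to be solved for \<open>A \<eta>\<close>
  without division.\<close>

locale pieri_family =
  fixes A :: "(nat \<Rightarrow> nat) \<Rightarrow> nat \<Rightarrow> xpoly fract" and a :: "(nat \<Rightarrow> nat) \<Rightarrow> (nat \<Rightarrow> nat) \<Rightarrow> int poly"
  assumes family_0: "A (\<lambda>_. 0) n = 1"
    and pieri: "is_partition \<xi> \<Longrightarrow>
      A \<xi> n * esymp n xvar m = (\<Sum>\<eta>\<in>hstrips \<xi> m. tconst (a \<eta> \<xi>) * A \<eta> n)"
    and coeff_drop_row: "is_partition \<eta> \<Longrightarrow> \<eta> \<noteq> (\<lambda>_. 0) \<Longrightarrow> a \<eta> (drop_row \<eta>) = 1"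
begin

text \<open>The weight bound is accompanied by a bound on the rows because a strip of length m adds
  up to m times one more than the number of rows; both are needed to control multiplication by
  \<open>esymp\<close>.\<close>

definition lower :: "nat \<Rightarrow> nat \<Rightarrow> (nat \<Rightarrow> xpoly fract) set" where
  "lower w l = fam.span (A ` {\<xi>. is_partition \<xi> \<and> wt \<xi> < w \<and> plength \<xi> \<le> l})"

lemma lower_mono: "w \<le> w' \<Longrightarrow> l \<le> l' \<Longrightarrow> lower w l \<subseteq> lower w' l'"
  unfolding lower_def by (intro fam.span_mono image_mono) auto

lemma lower_base: "is_partition \<xi> \<Longrightarrow> wt \<xi> < w \<Longrightarrow> plength \<xi> \<le> l \<Longrightarrow> A \<xi> \<in> lower w l"
  unfolding lower_def by (intro fam.span_base) auto

lemma sum_in_lower: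
  assumes "\<And>x. x \<in> X \<Longrightarrow> f x \<in> lower w l"
  shows "(\<lambda>n. \<Sum>x\<in>X. tconst (c x) * f x n) \<in> lower w l"
proof -
  have "(\<Sum>x\<in>X. (\<lambda>n. tconst (c x) * f x n)) \<in> lower w l"
    unfolding lower_def using assms by (intro fam.span_sum fam.span_scale) (auto simp: lower_def)
  moreover have "(\<Sum>x\<in>X. (\<lambda>n. tconst (c x) * f x n)) = (\<lambda>n. \<Sum>x\<in>X. tconst (c x) * f x n)"
    by (induction X rule: infinite_finite_induct) (auto simp: fun_eq_iff)
  ultimately show ?thesis by simp
qed

lemma lower_mult_esymp:
  assumes "f \<in> lower w l"
  shows "famprod f m \<in> lower (w + Suc l * m) (Suc l)"
  using assms unfolding lower_def[of w l]
proof (induction rule: fam.span_induct)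
  case base
  have zero: "famprod 0 m = 0" by (simp add: fun_eq_iff)
  have add: "famprod (f + g) m = famprod f m + famprod g m" for f g
    by (simp add: fun_eq_iff distrib_right)
  have scale: "famprod (\<lambda>n. tconst c * f n) m = (\<lambda>n. tconst c * famprod f m n)" for c f
    by (simp add: fun_eq_iff mult.assoc)
  show ?case
    unfolding fam.subspace_def mem_Collect_eq zero add scale unfolding lower_def
    by (auto intro: fam.span_zero fam.span_add fam.span_scale)
next
  case (step f)
  then obtain \<xi> where \<xi>: "is_partition \<xi>" "wt \<xi> < w" "plength \<xi> \<le> l" "f = A \<xi>" by blast
  have "A \<eta> \<in> lower (w + Suc l * m) (Suc l)" if "\<eta> \<in> hstrips \<xi> m" for \<eta>
  proof (rule lower_base)
    show "is_partition \<eta>" by (rule hstripsD(1)[OF that])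
    have "wt \<eta> \<le> wt \<xi> + Suc (plength \<xi>) * m" using hstrips_wt[OF \<xi>(1) that] by linarith
    also have "\<dots> < w + Suc l * m" using \<xi>(2,3) by (intro add_less_le_mono mult_le_mono1) auto
    finally show "wt \<eta> < w + Suc l * m" .
    show "plength \<eta> \<le> Suc l" using hstrips_plength[OF \<xi>(1) that] \<xi>(3) by simp
  qed
  then show ?case unfolding \<xi>(4) pieri[OF \<xi>(1)] by (rule sum_in_lower)
qed

lemma family_eq_drop_row:
  assumes \<eta>: "is_partition \<eta>" "\<eta> \<noteq> (\<lambda>_. 0)" and hs: "\<eta> \<in> hstrips (drop_row \<eta>) m"
    and part: "is_partition (drop_row \<eta>)"
  shows "A \<eta> n = A (drop_row \<eta>) n * esymp n xvar m
    - (\<Sum>\<zeta>\<in>hstrips (drop_row \<eta>) m - {\<eta>}. tconst (a \<zeta> (drop_row \<eta>)) * A \<zeta> n)"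
  unfolding pieri[OF part] using coeff_drop_row[OF \<eta>]
  by (subst sum.remove[OF finite_hstrips hs]) simp

end

text \<open>Both members arise by the same recipe from those at \<xi>, the shape
  \<open>drop_row \<eta>\<close>. The difference of the latter lies below \<open>wt \<xi>\<close>
  with at most \<open>plength \<xi>\<close> rows, and multiplication raises this bound exactly to
  \<open>wt \<eta>\<close>; the other strips on \<xi> are lighter than
  \<open>\<eta>\<close>.\<close>

lemma pieri_family_triangular:
  assumes "pieri_family A a" "pieri_family B b" and \<eta>: "is_partition \<eta>"
  shows "A \<eta> - B \<eta> \<in> pieri_family.lower B (wt \<eta>) (plength \<eta>)"
proof -
  interpret A: pieri_family A a by fact
  interpret B: pieri_family B b by fact
  from \<eta> show ?thesis
  proof (induction "wt \<eta>" arbitrary: \<eta> rule: less_induct)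
    case (less \<eta>)
    show ?case
    proof (cases "\<eta> = (\<lambda>_. 0)")
      case True
      have "A \<eta> n = B \<eta> n" for n by (simp only: True A.family_0 B.family_0)
      then have "A \<eta> - B \<eta> = 0" by (simp add: fun_eq_iff)
      then show ?thesis by (simp add: B.lower_def fam.span_zero)
    next
      case False
      define \<xi> where "\<xi> = drop_row \<eta>"
      obtain m where m: "0 < m" "is_partition \<xi>" "Suc (plength \<xi>) = plength \<eta>" "\<eta> \<in> hstrips \<xi> m"
        "wt \<eta> = wt \<xi> + plength \<eta> * m" "\<And>\<zeta>. \<zeta> \<in> hstrips \<xi> m \<Longrightarrow> \<zeta> \<noteq> \<eta> \<Longrightarrow> wt \<zeta> < wt \<eta>"
        unfolding \<xi>_def using drop_row[OF less.prems False] by blast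
      define Z where "Z = hstrips \<xi> m - {\<eta>}"
      have "wt \<xi> < wt \<eta>" using m(1,3,5) by simp
      then have "A \<xi> - B \<xi> \<in> B.lower (wt \<xi>) (plength \<xi>)" using less.hyps m(2) by blast
      from B.lower_mult_esymp[OF this, of m]
      have 1: "famprod (A \<xi> - B \<xi>) m \<in> B.lower (wt \<eta>) (plength \<eta>)"
        by (simp only: m(3,5))
      have B\<zeta>: "B \<zeta> \<in> B.lower (wt \<eta>) (plength \<eta>)" if "\<zeta> \<in> Z" for \<zeta>
        using that hstripsD(1) m(6) hstrips_plength[OF m(2), of \<zeta> m] m(3)
        by (intro B.lower_base) (auto simp: Z_def)
      have A\<zeta>: "A \<zeta> \<in> B.lower (wt \<eta>) (plength \<eta>)" if \<zeta>: "\<zeta> \<in> Z" for \<zeta>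
      proof -
        have z: "is_partition \<zeta>" "wt \<zeta> < wt \<eta>" "plength \<zeta> \<le> plength \<eta>"
          using \<zeta> hstripsD(1) m(6) hstrips_plength[OF m(2), of \<zeta> m] m(3) by (auto simp: Z_def)
        then have "A \<zeta> - B \<zeta> \<in> B.lower (wt \<eta>) (plength \<eta>)"
          using less.hyps[OF z(2,1)] B.lower_mono[of "wt \<zeta>" "wt \<eta>" "plength \<zeta>" "plength \<eta>"] by auto
        then have "(A \<zeta> - B \<zeta>) + B \<zeta> \<in> B.lower (wt \<eta>) (plength \<eta>)"
          using B\<zeta>[OF \<zeta>] unfolding B.lower_def by (rule fam.span_add)
        then show ?thesis by simp
      qed
      have "A \<eta> - B \<eta> = famprod (A \<xi> - B \<xi>) m
          - (\<lambda>n. \<Sum>\<zeta>\<in>Z. tconst (a \<zeta> \<xi>) * A \<zeta> n) + (\<lambda>n. \<Sum>\<zeta>\<in>Z. tconst (b \<zeta> \<xi>) * B \<zeta> n)"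
      proof
        fix n
        note eqs = A.family_eq_drop_row[OF less.prems False m(4,2)[unfolded \<xi>_def], of n]
          B.family_eq_drop_row[OF less.prems False m(4,2)[unfolded \<xi>_def], of n]
        show "(A \<eta> - B \<eta>) n = (famprod (A \<xi> - B \<xi>) m
          - (\<lambda>n. \<Sum>\<zeta>\<in>Z. tconst (a \<zeta> \<xi>) * A \<zeta> n) + (\<lambda>n. \<Sum>\<zeta>\<in>Z. tconst (b \<zeta> \<xi>) * B \<zeta> n)) n"
          unfolding plus_fun_apply fun_diff_def eqs \<xi>_def Z_def by (simp add: left_diff_distrib)
      qed
      also have "\<dots> \<in> B.lower (wt \<eta>) (plength \<eta>)"
      proof -
        have "(\<lambda>n. \<Sum>\<zeta>\<in>Z. tconst (a \<zeta> \<xi>) * A \<zeta> n) \<in> B.lower (wt \<eta>) (plength \<eta>)"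
          by (rule B.sum_in_lower) (rule A\<zeta>)
        moreover have "(\<lambda>n. \<Sum>\<zeta>\<in>Z. tconst (b \<zeta> \<xi>) * B \<zeta> n) \<in> B.lower (wt \<eta>) (plength \<eta>)"
          by (rule B.sum_in_lower) (rule B\<zeta>)
        ultimately show ?thesis
          using 1 unfolding B.lower_def by (intro fam.span_add fam.span_diff)
      qed
      finally show ?thesis .
    qed
  qed
qed

text \<open>Distinct indices may give the same member of \<open>B\<close>, so one index is chosen
  for each member that occurs in the combination.\<close>

lemma fam_span_image:
  assumes "f \<in> fam.span (B ` Z)"
  obtains Y d where "finite Y" "Y \<subseteq> Z" "\<And>n. f n = (\<Sum>\<xi>\<in>Y. tconst (d \<xi>) * B \<xi> n)"
proof -
  from assms obtain T r where T: "finite T" "T \<subseteq> B ` Z" "f = (\<Sum>g\<in>T. (\<lambda>n. tconst (r g) * g n))"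
    unfolding fam.span_explicit by blast
  from T(2) obtain Y where Y: "Y \<subseteq> Z" "inj_on B Y" "T = B ` Y" by (auto simp: subset_image_inj)
  have fin: "finite Y" using T(1) Y(2,3) by (simp add: finite_image_iff)
  have "f = (\<Sum>\<xi>\<in>Y. (\<lambda>n. tconst (r (B \<xi>)) * B \<xi> n))"
    unfolding T(3) Y(3) by (simp add: sum.reindex[OF Y(2)])
  also have "\<dots> = (\<lambda>n. \<Sum>\<xi>\<in>Y. tconst (r (B \<xi>)) * B \<xi> n)"
    using fin by (induction Y rule: finite_induct) (auto simp: fun_eq_iff)
  finally show ?thesis using fin Y(1) by (intro that[of Y "\<lambda>\<xi>. r (B \<xi>)"]) auto
qed

lemma (in pieri_family) lowerE:
  assumes "f \<in> lower w l"
  obtains Y d where "finite Y" "\<And>\<xi>. \<xi> \<in> Y \<Longrightarrow> is_partition \<xi> \<and> wt \<xi> < w"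
    "\<And>n. f n = (\<Sum>\<xi>\<in>Y. tconst (d \<xi>) * A \<xi> n)"
  using assms unfolding lower_def by (elim fam_span_image) blast

lemma pieri_family_expand:
  assumes "pieri_family A a" "pieri_family B b" and \<eta>: "is_partition \<eta>"
  obtains Y d where "finite Y" "Y \<subseteq> Collect is_partition"
    "\<And>n. A \<eta> n = (\<Sum>\<xi>\<in>Y. tconst (d \<xi>) * B \<xi> n)"
proof -
  interpret B: pieri_family B b by fact
  have "A \<eta> - B \<eta> \<in> fam.span (B ` Collect is_partition)"
    using pieri_family_triangular[OF assms] unfolding B.lower_def
    by (rule rev_subsetD) (intro fam.span_mono image_mono, auto)
  moreover have "B \<eta> \<in> fam.span (B ` Collect is_partition)" using \<eta> by (intro fam.span_base) auto
  ultimately have "(A \<eta> - B \<eta>) + B \<eta> \<in> fam.span (B ` Collect is_partition)" by (rule fam.span_add)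
  then show ?thesis using that by (elim fam_span_image) auto
qed

text \<open>A relation is required to hold for all \<open>n\<close> simultaneously: for a single
  \<open>n\<close> the families studied here have members that are 0.\<close>

definition fam_independent :: "((nat \<Rightarrow> nat) \<Rightarrow> nat \<Rightarrow> xpoly fract) \<Rightarrow> bool" where
  "fam_independent A \<longleftrightarrow> (\<forall>X c. finite X \<longrightarrow> X \<subseteq> Collect is_partition \<longrightarrow>
     (\<forall>n. (\<Sum>\<xi>\<in>X. tconst (c \<xi>) * A \<xi> n) = 0) \<longrightarrow> (\<forall>\<xi>\<in>X. c \<xi> = 0))"

text \<open>In a relation among the \<open>A\<close>, replacing the terms of maximal weight by the
  corresponding members of \<open>B\<close> changes only combinations of lighter ones, so a
  nontrivial relation among the \<open>B\<close> results.\<close>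

lemma fam_independent_transfer:
  assumes "pieri_family A a" "pieri_family B b" and indep: "fam_independent B"
  shows "fam_independent A"
  unfolding fam_independent_def
proof (intro allI impI, rule ccontr)
  interpret B: pieri_family B b by fact
  fix X c
  assume X: "finite X" "X \<subseteq> Collect is_partition"
    and sum0: "\<forall>n. (\<Sum>\<xi>\<in>X. tconst (c \<xi>) * A \<xi> n) = 0" and "\<not> (\<forall>\<xi>\<in>X. c \<xi> = 0)"
  define X' where "X' = {\<xi>\<in>X. c \<xi> \<noteq> 0}"
  have X': "finite X'" "X' \<noteq> {}" "\<And>\<xi>. \<xi> \<in> X' \<Longrightarrow> is_partition \<xi>"
    using X \<open>\<not> (\<forall>\<xi>\<in>X. c \<xi> = 0)\<close> by (auto simp: X'_def)
  define w where "w = Max (wt ` X')"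
  \<comment> \<open>Different shapes can have the same weight, so the whole top layer is treated at
    once.\<close>
  define W where "W = {\<xi>\<in>X'. wt \<xi> = w}"
  define l where "l = Max (plength ` X')"
  have le: "wt \<xi> \<le> w" "plength \<xi> \<le> l" if "\<xi> \<in> X'" for \<xi>
    using that X'(1) by (auto simp: w_def l_def)
  have "w \<in> wt ` X'" unfolding w_def using X'(1,2) by (intro Max_in) auto
  then have "W \<noteq> {}" by (auto simp: W_def)
  have tri: "A \<xi> - B \<xi> \<in> B.lower w l" if "\<xi> \<in> X'" for \<xi>
    using pieri_family_triangular[OF assms(1,2) X'(3)[OF that]] B.lower_mono[OF le[OF that]] by blast
  have AB: "A \<xi> \<in> B.lower w l" if "\<xi> \<in> X' - W" for \<xi>
  proof -
    have "B \<xi> \<in> B.lower w l"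
      using that X'(3) le[of \<xi>] by (intro B.lower_base) (auto simp: W_def)
    with tri[of \<xi>] that have "(A \<xi> - B \<xi>) + B \<xi> \<in> B.lower w l"
      unfolding B.lower_def by (intro fam.span_add) auto
    then show ?thesis by simp
  qed
  have X'_sum: "(\<Sum>\<xi>\<in>X'. tconst (c \<xi>) * A \<xi> n) = 0" for n
  proof -
    have "(\<Sum>\<xi>\<in>X'. tconst (c \<xi>) * A \<xi> n) = (\<Sum>\<xi>\<in>X. tconst (c \<xi>) * A \<xi> n)"
      using X(1) by (intro sum.mono_neutral_left) (auto simp: X'_def)
    then show ?thesis using sum0 by simp
  qed
  have top: "(\<lambda>n. \<Sum>\<xi>\<in>W. tconst (c \<xi>) * B \<xi> n) =
     - (\<lambda>n. \<Sum>\<xi>\<in>X' - W. tconst (c \<xi>) * A \<xi> n) - (\<lambda>n. \<Sum>\<xi>\<in>W. tconst (c \<xi>) * (A \<xi> - B \<xi>) n)"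
  proof
    fix n
    have "(\<Sum>\<xi>\<in>X'. tconst (c \<xi>) * A \<xi> n) =
        (\<Sum>\<xi>\<in>X' - W. tconst (c \<xi>) * A \<xi> n) + (\<Sum>\<xi>\<in>W. tconst (c \<xi>) * A \<xi> n)"
      using X'(1) by (intro sum.subset_diff) (auto simp: W_def)
    then show "(\<Sum>\<xi>\<in>W. tconst (c \<xi>) * B \<xi> n) =
       (- (\<lambda>n. \<Sum>\<xi>\<in>X' - W. tconst (c \<xi>) * A \<xi> n) - (\<lambda>n. \<Sum>\<xi>\<in>W. tconst (c \<xi>) * (A \<xi> - B \<xi>) n)) n"
      using X'_sum[of n] by (simp add: right_diff_distrib sum_subtractf neg_eq_iff_add_eq_0)
  qed
  have "(\<lambda>n. \<Sum>\<xi>\<in>W. tconst (c \<xi>) * B \<xi> n) \<in> B.lower w l"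
  proof -
    have "(\<lambda>n. \<Sum>\<xi>\<in>X' - W. tconst (c \<xi>) * A \<xi> n) \<in> B.lower w l"
      by (rule B.sum_in_lower) (rule AB)
    moreover have "(\<lambda>n. \<Sum>\<xi>\<in>W. tconst (c \<xi>) * (A \<xi> - B \<xi>) n) \<in> B.lower w l"
      by (rule B.sum_in_lower) (rule tri, simp add: W_def)
    ultimately show ?thesis
      unfolding top unfolding B.lower_def by (intro fam.span_diff fam.span_neg)
  qed
  then obtain Y d where Y: "finite Y" "\<And>\<xi>. \<xi> \<in> Y \<Longrightarrow> is_partition \<xi> \<and> wt \<xi> < w"
    "\<And>n. (\<Sum>\<xi>\<in>W. tconst (c \<xi>) * B \<xi> n) = (\<Sum>\<xi>\<in>Y. tconst (d \<xi>) * B \<xi> n)"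
    by (rule B.lowerE) blast
  have disj: "W \<inter> Y = {}" using Y(2) by (auto simp: W_def)
  \<comment> \<open>The shapes in \<open>Y\<close> are lighter than \<open>w\<close>, so
    \<open>W\<close> and \<open>Y\<close> are disjoint and the two coefficient families can be
    glued.\<close>
  define e where "e \<xi> = (if \<xi> \<in> W then c \<xi> else - d \<xi>)" for \<xi>
  have W: "finite W" "W \<subseteq> X'" using X'(1) by (auto simp: W_def)
  have "(\<Sum>\<xi>\<in>W \<union> Y. tconst (e \<xi>) * B \<xi> n) = 0" for n
  proof -
    have neg: "tconst (- x) = - tconst x" for x using tconst_diff[of 0 x] by simp
    have "(\<Sum>\<xi>\<in>W \<union> Y. tconst (e \<xi>) * B \<xi> n) = (\<Sum>\<xi>\<in>W. tconst (e \<xi>) * B \<xi> n) + (\<Sum>\<xi>\<in>Y. tconst (e \<xi>) * B \<xi> n)"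
      by (rule sum.union_disjoint[OF W(1) Y(1) disj])
    also have "(\<Sum>\<xi>\<in>W. tconst (e \<xi>) * B \<xi> n) = (\<Sum>\<xi>\<in>W. tconst (c \<xi>) * B \<xi> n)"
      by (intro sum.cong) (auto simp: e_def)
    also have "(\<Sum>\<xi>\<in>Y. tconst (e \<xi>) * B \<xi> n) = (\<Sum>\<xi>\<in>Y. - (tconst (d \<xi>) * B \<xi> n))"
      using disj by (intro sum.cong) (auto simp: e_def neg)
    finally show ?thesis by (simp add: sum_negf Y(3))
  qed
  then have "\<forall>\<xi>\<in>W \<union> Y. e \<xi> = 0"
    using indep W Y(1,2) X'(3) unfolding fam_independent_def by (elim allE[of _ "W \<union> Y"] allE[of _ e]) auto
  moreover obtain \<xi> where "\<xi> \<in> W" using \<open>W \<noteq> {}\<close> by blast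
  ultimately have "c \<xi> = 0" by (metis UnI1 e_def)
  then show False using \<open>\<xi> \<in> W\<close> by (simp add: W_def X'_def)
qed

text \<open>One induction for both expansions: \<open>f\<close> is any quantity obeying the
  recursion that the Pieri rule dictates when the last factor is split off. It is applied to Kostka
  numbers with all coefficients 1 and to flag weights with \<open>strip_coeff\<close>.\<close>

lemma (in pieri_family) prod_esymp_expand:
  assumes nil: "\<And>\<eta>. is_partition \<eta> \<Longrightarrow> f \<eta> [] = of_bool (\<eta> = (\<lambda>_. 0))"
    and snoc: "\<And>\<eta> \<mu> m. is_partition \<eta> \<Longrightarrow> f \<eta> (\<mu> @ [m]) =
      (\<Sum>\<xi> | is_partition \<xi> \<and> horizontal_strip \<eta> \<xi> m. a \<eta> \<xi> * f \<xi> \<mu>)"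
  shows "(\<Prod>m\<leftarrow>\<mu>. esymp n xvar m) = (\<Sum>\<eta>\<in>partitions_of (sum_list \<mu>). tconst (f \<eta> \<mu>) * A \<eta> n)"
proof (induction \<mu> rule: rev_induct)
  case Nil
  have "partitions_of 0 = {\<lambda>_. 0}"
    by (auto simp: partitions_of_def is_partition_0 psize_def fun_eq_iff dest: is_partition_finite)
  then show ?case using nil[OF is_partition_0] by (simp add: family_0)
next
  case (snoc m \<mu>)
  let ?P = "partitions_of (sum_list \<mu>)" and ?Q = "partitions_of (sum_list (\<mu> @ [m]))"
  have "(\<Prod>m\<leftarrow>\<mu> @ [m]. esymp n xvar m) = (\<Sum>\<xi>\<in>?P. tconst (f \<xi> \<mu>) * (A \<xi> n * esymp n xvar m))"
    using snoc by (simp add: sum_distrib_right mult.assoc)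
  also have "\<dots> = (\<Sum>\<xi>\<in>?P. \<Sum>\<eta>\<in>{\<eta>\<in>?Q. horizontal_strip \<eta> \<xi> m}. tconst (a \<eta> \<xi> * f \<xi> \<mu>) * A \<eta> n)"
  proof (rule sum.cong[OF refl])
    fix \<xi> assume \<xi>: "\<xi> \<in> ?P"
    then have p: "is_partition \<xi>" by (simp add: partitions_of_def)
    have "hstrips \<xi> m = {\<eta>\<in>?Q. horizontal_strip \<eta> \<xi> m}"
      using \<xi> by (auto simp: hstrips_def partitions_of_def horizontal_strip_def)
    then show "tconst (f \<xi> \<mu>) * (A \<xi> n * esymp n xvar m) =
        (\<Sum>\<eta>\<in>{\<eta>\<in>?Q. horizontal_strip \<eta> \<xi> m}. tconst (a \<eta> \<xi> * f \<xi> \<mu>) * A \<eta> n)"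
      by (simp add: pieri[OF p] sum_distrib_left tconst_mult ac_simps)
  qed
  \<comment> \<open>The Pieri rule sums over outer shapes, the recursion for \<open>f\<close> over
    inner ones.\<close>
  also have "\<dots> = (\<Sum>\<eta>\<in>?Q. \<Sum>\<xi>\<in>{\<xi>\<in>?P. horizontal_strip \<eta> \<xi> m}. tconst (a \<eta> \<xi> * f \<xi> \<mu>) * A \<eta> n)"
    by (rule sum.swap_restrict) (rule finite_partitions_of)+
  also have "\<dots> = (\<Sum>\<eta>\<in>?Q. tconst (f \<eta> (\<mu> @ [m])) * A \<eta> n)"
  proof (rule sum.cong[OF refl])
    fix \<eta> assume \<eta>: "\<eta> \<in> ?Q"
    then have p: "is_partition \<eta>" by (simp add: partitions_of_def)
    have "{\<xi>\<in>?P. horizontal_strip \<eta> \<xi> m} = {\<xi>. is_partition \<xi> \<and> horizontal_strip \<eta> \<xi> m}"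
      using \<eta> by (auto simp: partitions_of_def horizontal_strip_def)
    then show "(\<Sum>\<xi>\<in>{\<xi>\<in>?P. horizontal_strip \<eta> \<xi> m}. tconst (a \<eta> \<xi> * f \<xi> \<mu>) * A \<eta> n)
        = tconst (f \<eta> (\<mu> @ [m])) * A \<eta> n"
      by (simp add: assms(2)[OF p] tconst_sum sum_distrib_right)
  qed
  finally show ?case .
qed

section \<open>Tableaux and flags, one letter at a time\<close>

definition ssyt_shape :: "(nat \<Rightarrow> nat) \<Rightarrow> nat \<Rightarrow> (nat \<times> nat \<Rightarrow> nat) \<Rightarrow> nat \<Rightarrow> nat" where
  "ssyt_shape \<eta> r T i = card {j. j < \<eta> i \<and> T (i, j) < r}"

text \<open>The value \<open>undefined\<close> outside the diagram is what the extensional function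
  space in \<open>ssyt\<close> prescribes.\<close>

definition ssyt_extend :: "(nat \<Rightarrow> nat) \<Rightarrow> nat \<Rightarrow> (nat \<Rightarrow> nat) \<Rightarrow> (nat \<times> nat \<Rightarrow> nat) \<Rightarrow> nat \<times> nat \<Rightarrow> nat" where
  "ssyt_extend \<eta> r \<xi> T = (\<lambda>c. if c \<in> diagram \<xi> then T c else if c \<in> diagram \<eta> then r else undefined)"

lemma finite_ssyt: "is_partition \<eta> \<Longrightarrow> finite (ssyt \<eta> \<mu>)"
  by (rule finite_subset[of _ "diagram \<eta> \<rightarrow>\<^sub>E {..<length \<mu>}"])
     (auto simp: ssyt_def intro!: finite_PiE finite_diagram is_partition_finite)

lemma ssytD:
  assumes "T \<in> ssyt \<eta> \<mu>"
  shows "T \<in> diagram \<eta> \<rightarrow>\<^sub>E {..<length \<mu>}"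
    and "Suc j < \<eta> i \<Longrightarrow> T (i, j) \<le> T (i, Suc j)"
    and "j < \<eta> (Suc i) \<Longrightarrow> T (i, j) < T (Suc i, j)"
    and "k < length \<mu> \<Longrightarrow> card {c \<in> diagram \<eta>. T c = k} = \<mu> ! k"
    and "j < \<eta> i \<Longrightarrow> T (i, j) < length \<mu>"
  using assms by (auto simp: ssyt_def diagram_def)

lemma ssyt_row_mono:
  assumes "T \<in> ssyt \<eta> \<mu>" "j \<le> j'" "j' < \<eta> i"
  shows "T (i, j) \<le> T (i, j')"
  using assms(2,3)
proof (induction j' rule: dec_induct)
  case (step k)
  then show ?case using ssytD(2)[OF assms(1), of k i] by simp
qed simp

text \<open>Rows increase weakly, so the cells of a row with entries below \<open>r\<close> form an
  initial segment, which its length determines.\<close>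

lemma less_ssyt_shape_iff:
  assumes T: "T \<in> ssyt \<eta> \<mu>"
  shows "j < ssyt_shape \<eta> r T i \<longleftrightarrow> j < \<eta> i \<and> T (i, j) < r"
proof -
  let ?X = "{j. j < \<eta> i \<and> T (i, j) < r}"
  have down: "j \<in> ?X" if "j' \<in> ?X" "j \<le> j'" for j j'
    using that ssyt_row_mono[OF T that(2), of i] by auto
  have fin: "finite ?X" by simp
  have "?X = {..<card ?X}"
  proof (cases "?X = {}")
    case False
    have "?X = {..Max ?X}"
      using down[OF Max_in[OF fin False]] Max_ge[OF fin] by blast
    then show ?thesis by (metis card_lessThan lessThan_Suc_atMost)
  next
    case True
    then show ?thesis by (simp only: card.empty lessThan_0)
  qed
  then show ?thesis unfolding ssyt_shape_def by blast
qed

lemma diagram_ssyt_shape: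
  assumes "T \<in> ssyt \<eta> \<mu>"
  shows "diagram (ssyt_shape \<eta> r T) = {c \<in> diagram \<eta>. T c < r}"
  by (auto simp: diagram_def less_ssyt_shape_iff[OF assms])

text \<open>The largest letter, \<open>length \<mu>\<close>, occurs at most once in each column and
  only at its bottom.\<close>

lemma ssyt_shape_strip:
  assumes \<eta>: "is_partition \<eta>" and T: "T \<in> ssyt \<eta> (\<mu> @ [m])"
  shows "is_partition (ssyt_shape \<eta> (length \<mu>) T)"
    and "horizontal_strip \<eta> (ssyt_shape \<eta> (length \<mu>) T) m"
proof -
  define r where "r = length \<mu>"
  define \<xi> where "\<xi> = ssyt_shape \<eta> r T"
  note iff = less_ssyt_shape_iff[OF T, of _ r, folded \<xi>_def]
  have le: "\<xi> i \<le> \<eta> i" for i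
    using iff[of "\<eta> i" i] by (meson less_irrefl not_le)
  have \<eta>_Suc: "\<eta> (Suc i) \<le> \<eta> i" for i using partition_le[OF \<eta>, of i "Suc i"] by simp
  \<comment> \<open>If row \<open>Suc i\<close> of \<open>\<eta>\<close> reached past the end of row
    \<open>i\<close> of \<open>\<xi>\<close>, the cell just past that end would have an entry
    smaller than the one below it, hence below \<open>r\<close>, and would belong to
    \<open>\<xi>\<close>.\<close>
  have interlace: "\<eta> (Suc i) \<le> \<xi> i" for i
  proof (rule ccontr)
    assume "\<not> \<eta> (Suc i) \<le> \<xi> i"
    then have j: "\<xi> i < \<eta> (Suc i)" by simp
    have "T (i, \<xi> i) < T (Suc i, \<xi> i)" by (rule ssytD(3)[OF T j])
    moreover have "T (Suc i, \<xi> i) < Suc r" using ssytD(5)[OF T j] by (simp add: r_def)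
    ultimately have "\<xi> i < \<xi> i" using iff[of "\<xi> i" i] j \<eta>_Suc[of i] by simp
    then show False by simp
  qed
  have part: "is_partition \<xi>"
    unfolding is_partition_def
  proof
    show "antimono \<xi>"
      unfolding antimono_iff_le_Suc by (intro allI order_trans[OF le interlace])
    show "finite {i. \<xi> i \<noteq> 0}"
    proof (rule finite_subset[OF _ is_partition_finite[OF \<eta>]], rule subsetI)
      fix i assume "i \<in> {i. \<xi> i \<noteq> 0}"
      then show "i \<in> {i. \<eta> i \<noteq> 0}" using le[of i] by auto
    qed
  qed
  note fd = finite_diagram[OF is_partition_finite[OF \<eta>]]
  have "card {c \<in> diagram \<eta>. T c < r} + card {c \<in> diagram \<eta>. T c = r} = card (diagram \<eta>)"
  proof -
    have "diagram \<eta> = {c \<in> diagram \<eta>. T c < r} \<union> {c \<in> diagram \<eta>. T c = r}"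
      using ssytD(1)[OF T] by (auto simp: r_def PiE_def Pi_def less_Suc_eq)
    moreover have "card ({c \<in> diagram \<eta>. T c < r} \<union> {c \<in> diagram \<eta>. T c = r}) =
        card {c \<in> diagram \<eta>. T c < r} + card {c \<in> diagram \<eta>. T c = r}"
      using fd(1) by (intro card_Un_disjoint) auto
    ultimately show ?thesis by simp
  qed
  moreover have "card {c \<in> diagram \<eta>. T c < r} = psize \<xi>"
    using finite_diagram(2)[OF is_partition_finite[OF part]] diagram_ssyt_shape[OF T, of r]
    by (simp add: \<xi>_def)
  moreover have "card {c \<in> diagram \<eta>. T c = r} = m"
    using ssytD(4)[OF T, of r] by (simp add: r_def)
  ultimately have "psize \<eta> = psize \<xi> + m" using fd(2) by simp
  then show "is_partition (ssyt_shape \<eta> (length \<mu>) T)"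
    "horizontal_strip \<eta> (ssyt_shape \<eta> (length \<mu>) T) m"
    using part le interlace by (auto simp: horizontal_strip_def \<xi>_def r_def)
qed

lemma ssyt_restrict:
  assumes T: "T \<in> ssyt \<eta> (\<mu> @ [m])" and \<eta>: "is_partition \<eta>"
  defines "\<xi> \<equiv> ssyt_shape \<eta> (length \<mu>) T"
  shows "restrict T (diagram \<xi>) \<in> ssyt \<xi> \<mu>"
proof -
  note d = diagram_ssyt_shape[OF T, of "length \<mu>", folded \<xi>_def]
  have part: "is_partition \<xi>" unfolding \<xi>_def by (rule ssyt_shape_strip(1)[OF \<eta> T])
  have sub: "(i, j) \<in> diagram \<xi>" if "(i, Suc j) \<in> diagram \<xi> \<or> (Suc i, j) \<in> diagram \<xi>" for i j
    using that partition_le[OF part, of i "Suc i"] by (auto simp: diagram_def)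
  have in\<eta>: "c \<in> diagram \<eta>" if "c \<in> diagram \<xi>" for c using that d by blast
  have "card {c \<in> diagram \<xi>. restrict T (diagram \<xi>) c = k} = \<mu> ! k" if "k < length \<mu>" for k
  proof -
    have "{c \<in> diagram \<xi>. restrict T (diagram \<xi>) c = k} = {c \<in> diagram \<eta>. T c = k}"
      using that by (auto simp: d)
    then show ?thesis using ssytD(4)[OF T, of k] that by (simp add: nth_append)
  qed
  moreover have "restrict T (diagram \<xi>) (i, j) \<le> restrict T (diagram \<xi>) (i, Suc j)"
    if "(i, Suc j) \<in> diagram \<xi>" for i j
    using that sub[of i j] in\<eta>[OF that] ssytD(2)[OF T, of j i] by (simp add: diagram_def[of \<eta>])
  moreover have "restrict T (diagram \<xi>) (i, j) < restrict T (diagram \<xi>) (Suc i, j)"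
    if "(Suc i, j) \<in> diagram \<xi>" for i j
    using that sub[of i j] in\<eta>[OF that] ssytD(3)[OF T, of j i] by (simp add: diagram_def[of \<eta>])
  moreover have "restrict T (diagram \<xi>) \<in> diagram \<xi> \<rightarrow>\<^sub>E {..<length \<mu>}"
    using d by auto
  ultimately show ?thesis by (simp add: ssyt_def)
qed

lemma ssyt_extend:
  assumes \<eta>: "is_partition \<eta>" and \<xi>: "is_partition \<xi>" and hs: "horizontal_strip \<eta> \<xi> m"
    and T: "T \<in> ssyt \<xi> \<mu>"
  shows "ssyt_extend \<eta> (length \<mu>) \<xi> T \<in> ssyt \<eta> (\<mu> @ [m])"
    and "ssyt_shape \<eta> (length \<mu>) (ssyt_extend \<eta> (length \<mu>) \<xi> T) = \<xi>"
    and "restrict (ssyt_extend \<eta> (length \<mu>) \<xi> T) (diagram \<xi>) = T"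
proof -
  define r where "r = length \<mu>"
  define E where "E = ssyt_extend \<eta> r \<xi> T"
  have le: "\<xi> i \<le> \<eta> i" and il: "\<eta> (Suc i) \<le> \<xi> i" and size: "psize \<eta> = psize \<xi> + m" for i
    using hs by (auto simp: horizontal_strip_def)
  have sub: "diagram \<xi> \<subseteq> diagram \<eta>" using le by (auto simp: diagram_def intro: less_le_trans)
  have T_less: "T c < r" if "c \<in> diagram \<xi>" for c
    using ssytD(1)[OF T] that by (auto simp: r_def)
  have E: "E c = T c" if "c \<in> diagram \<xi>" for c using that by (simp add: E_def ssyt_extend_def)
  have E': "E c = r" if "c \<in> diagram \<eta>" "c \<notin> diagram \<xi>" for c
    using that by (simp add: E_def ssyt_extend_def)
  have E_le: "E c \<le> r" if "c \<in> diagram \<eta>" for c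
    using E[of c] E'[OF that] T_less[of c] by (cases "c \<in> diagram \<xi>") auto
  have E_iff: "E c < r \<longleftrightarrow> c \<in> diagram \<xi>" if "c \<in> diagram \<eta>" for c
    using E[of c] E'[OF that] T_less[of c] by (cases "c \<in> diagram \<xi>") auto
  have ext: "E \<in> diagram \<eta> \<rightarrow>\<^sub>E {..<length (\<mu> @ [m])}"
  proof (rule PiE_I)
    show "E c \<in> {..<length (\<mu> @ [m])}" if "c \<in> diagram \<eta>" for c
      using E_le[OF that] by (simp add: r_def)
    show "E c = undefined" if "c \<notin> diagram \<eta>" for c
      using that sub by (auto simp: E_def ssyt_extend_def)
  qed
  have rows: "E (i, j) \<le> E (i, Suc j)" if s: "(i, Suc j) \<in> diagram \<eta>" for i j
  proof (cases "(i, Suc j) \<in> diagram \<xi>")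
    case True
    then have "(i, j) \<in> diagram \<xi>" by (simp add: diagram_def)
    then show ?thesis using True ssytD(2)[OF T, of j i] by (simp add: E) (simp add: diagram_def)
  next
    case False
    have "(i, j) \<in> diagram \<eta>" using s by (simp add: diagram_def)
    then show ?thesis using E'[OF s False] E_le by simp
  qed
  have cols: "E (i, j) < E (Suc i, j)" if s: "(Suc i, j) \<in> diagram \<eta>" for i j
  proof -
    \<comment> \<open>Interlacing puts every cell that lies above another cell of
      \<open>\<eta>\<close> into \<open>\<xi>\<close>, so the new letter never stands above
      anything.\<close>
    have ij: "(i, j) \<in> diagram \<xi>" using s il[of i] by (simp add: diagram_def)
    show ?thesis
    proof (cases "(Suc i, j) \<in> diagram \<xi>")
      case True
      then show ?thesis using ij ssytD(3)[OF T, of j i] by (simp add: E) (simp add: diagram_def)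
    next
      case False
      then show ?thesis using E'[OF s] ij T_less[OF ij] by (simp add: E)
    qed
  qed
  have count: "card {c \<in> diagram \<eta>. E c = k} = (\<mu> @ [m]) ! k" if k: "k < length (\<mu> @ [m])" for k
  proof (cases "k < r")
    case True
    have "{c \<in> diagram \<eta>. E c = k} = {c \<in> diagram \<xi>. T c = k}"
      using E E_iff True sub by (metis (mono_tags, lifting) subsetD)
    then show ?thesis using ssytD(4)[OF T, of k] True by (simp add: r_def nth_append)
  next
    case False
    then have kr: "k = r" using k by (simp add: r_def)
    have "{c \<in> diagram \<eta>. E c = k} = diagram \<eta> - diagram \<xi>"
      using E_iff E' kr by fastforce
    moreover have "card (diagram \<eta> - diagram \<xi>) = m"
      using finite_diagram[OF is_partition_finite[OF \<eta>]] finite_diagram[OF is_partition_finite[OF \<xi>]]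
        sub size by (simp add: card_Diff_subset)
    ultimately show ?thesis by (simp add: kr r_def nth_append)
  qed
  show mem: "ssyt_extend \<eta> (length \<mu>) \<xi> T \<in> ssyt \<eta> (\<mu> @ [m])"
    unfolding ssyt_def E_def[unfolded r_def, symmetric] using ext rows cols count by blast
  show "ssyt_shape \<eta> (length \<mu>) (ssyt_extend \<eta> (length \<mu>) \<xi> T) = \<xi>"
  proof
    fix i
    have "{j. j < \<eta> i \<and> E (i, j) < r} = {..<\<xi> i}"
    proof (rule set_eqI)
      fix j
      show "j \<in> {j. j < \<eta> i \<and> E (i, j) < r} \<longleftrightarrow> j \<in> {..<\<xi> i}"
        using E_iff[of "(i, j)"] le[of i] by (auto simp: diagram_def)
    qed
    then show "ssyt_shape \<eta> (length \<mu>) (ssyt_extend \<eta> (length \<mu>) \<xi> T) i = \<xi> i"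
      by (simp add: ssyt_shape_def E_def r_def)
  qed
  show "restrict (ssyt_extend \<eta> (length \<mu>) \<xi> T) (diagram \<xi>) = T"
    using ssytD(1)[OF T] by (auto simp: fun_eq_iff restrict_def ssyt_extend_def PiE_def extensional_def)
qed

text \<open>A tableau is determined by what remains after deleting its largest letter, because the
  strip can be filled in only one way.\<close>

lemma kostka_snoc:
  assumes \<eta>: "is_partition \<eta>"
  shows "kostka \<eta> (\<mu> @ [m]) = (\<Sum>\<xi> | is_partition \<xi> \<and> horizontal_strip \<eta> \<xi> m. kostka \<xi> \<mu>)"
proof -
  let ?r = "length \<mu>" and ?D = "{\<xi>. is_partition \<xi> \<and> horizontal_strip \<eta> \<xi> m}"
  have "bij_betw (\<lambda>T. (ssyt_shape \<eta> ?r T, restrict T (diagram (ssyt_shape \<eta> ?r T))))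
      (ssyt \<eta> (\<mu> @ [m])) (SIGMA \<xi>:?D. ssyt \<xi> \<mu>)"
  proof (rule bij_betw_byWitness[where f' = "\<lambda>(\<xi>, T). ssyt_extend \<eta> ?r \<xi> T"])
    show "\<forall>T\<in>ssyt \<eta> (\<mu> @ [m]). (case (ssyt_shape \<eta> ?r T, restrict T (diagram (ssyt_shape \<eta> ?r T))) of
        (\<xi>, T) \<Rightarrow> ssyt_extend \<eta> ?r \<xi> T) = T"
    proof
      fix T assume T: "T \<in> ssyt \<eta> (\<mu> @ [m])"
      have "ssyt_extend \<eta> ?r (ssyt_shape \<eta> ?r T) (restrict T (diagram (ssyt_shape \<eta> ?r T))) c = T c" for c
        using PiE_mem[OF ssytD(1)[OF T], of c] PiE_arb[OF ssytD(1)[OF T], of c]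
        by (cases "c \<in> diagram \<eta>") (auto simp: ssyt_extend_def diagram_ssyt_shape[OF T] less_Suc_eq)
      then show "(case (ssyt_shape \<eta> ?r T, restrict T (diagram (ssyt_shape \<eta> ?r T))) of
        (\<xi>, T) \<Rightarrow> ssyt_extend \<eta> ?r \<xi> T) = T" by auto
    qed
  qed (use \<eta> in \<open>auto simp: ssyt_extend ssyt_shape_strip ssyt_restrict\<close>)
  then have "kostka \<eta> (\<mu> @ [m]) = card (SIGMA \<xi>:?D. ssyt \<xi> \<mu>)"
    unfolding kostka_def by (rule bij_betw_same_card)
  also have "finite ?D"
    by (rule finite_subset[OF _ finite_partitions_of[of "psize \<eta> - m"]])
       (auto simp: partitions_of_def horizontal_strip_def)
  then have "card (SIGMA \<xi>:?D. ssyt \<xi> \<mu>) = (\<Sum>\<xi>\<in>?D. kostka \<xi> \<mu>)"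
    unfolding kostka_def by (intro card_SigmaI) (auto intro: finite_ssyt)
  finally show ?thesis .
qed

lemma kostka_Nil:
  assumes "is_partition \<eta>"
  shows "kostka \<eta> [] = of_bool (\<eta> = (\<lambda>_. 0))"
proof (cases "\<eta> = (\<lambda>_. 0)")
  case True
  have "ssyt (\<lambda>_. 0) [] = {\<lambda>_. undefined}"
    by (auto simp: ssyt_def diagram_def)
  then show ?thesis by (simp add: True kostka_def)
next
  case False
  then have "\<exists>i. \<eta> i \<noteq> 0" by (metis ext)
  then obtain i where "0 < \<eta> i" by auto
  then have "(i, 0) \<in> diagram \<eta>" by (simp add: diagram_def)
  then have "ssyt \<eta> [] = {}" by (auto simp: ssyt_def dest: PiE_mem)
  then show ?thesis using False by (simp add: kostka_def)
qed

text \<open>The right-hand side of the theorem with an arbitrary final shape, as a recursion on the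
  number of strips requires.\<close>

definition flag_weight :: "(nat \<Rightarrow> nat) \<Rightarrow> nat list \<Rightarrow> int poly" where
  "flag_weight \<kappa> \<mu> = (\<Sum>\<nu>\<in>strip_flags \<kappa> \<mu>. \<Prod>k\<in>{1..<length \<mu>}. strip_coeff (\<nu> ! (k + 1)) (\<nu> ! k))"

lemma flag_weight_Nil:
  "flag_weight \<kappa> [] = of_bool (\<kappa> = (\<lambda>_. 0))"
proof -
  have "strip_flags \<kappa> [] = (if \<kappa> = (\<lambda>_. 0) then {[\<lambda>_. 0]} else {})"
    by (auto simp: strip_flags_def length_Suc_conv is_partition_0)
  then show ?thesis by (simp add: flag_weight_def)
qed

lemma strip_flags_snoc:
  "\<nu> @ [\<eta>] \<in> strip_flags \<kappa> (\<mu> @ [m]) \<longleftrightarrow>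
     \<eta> = \<kappa> \<and> is_partition \<kappa> \<and> (\<exists>\<xi>. \<nu> \<in> strip_flags \<xi> \<mu> \<and> horizontal_strip \<kappa> \<xi> m)"
proof (cases "length \<nu> = Suc (length \<mu>)")
  case len: True
  define r where "r = length \<mu>"
  have nth: "(\<nu> @ [\<eta>]) ! k = \<nu> ! k" if "k \<le> r" for k
    using that len by (simp add: nth_append r_def)
  have nth': "(\<nu> @ [\<eta>]) ! Suc r = \<eta>"
    using len by (simp add: nth_append r_def)
  have m: "(\<mu> @ [m]) ! k = \<mu> ! k" if "k < r" for k using that by (simp add: nth_append r_def)
  have m': "(\<mu> @ [m]) ! r = m" by (simp add: nth_append r_def)
  have part: "(\<forall>k\<le>Suc r. is_partition ((\<nu> @ [\<eta>]) ! k)) \<longleftrightarrow> (\<forall>k\<le>r. is_partition (\<nu> ! k)) \<and> is_partition \<eta>"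
    using nth nth' by (auto simp: le_Suc_eq)
  have "{1..Suc r} = insert (Suc r) {1..r}" by auto
  have hs: "(\<forall>k\<in>{1..Suc r}. horizontal_strip ((\<nu> @ [\<eta>]) ! k) ((\<nu> @ [\<eta>]) ! (k - 1)) ((\<mu> @ [m]) ! (k - 1))) \<longleftrightarrow>
      (\<forall>k\<in>{1..r}. horizontal_strip (\<nu> ! k) (\<nu> ! (k - 1)) (\<mu> ! (k - 1))) \<and> horizontal_strip \<eta> (\<nu> ! r) m"
  proof -
    have "horizontal_strip ((\<nu> @ [\<eta>]) ! k) ((\<nu> @ [\<eta>]) ! (k - 1)) ((\<mu> @ [m]) ! (k - 1)) \<longleftrightarrow>
        horizontal_strip (\<nu> ! k) (\<nu> ! (k - 1)) (\<mu> ! (k - 1))" if "k \<in> {1..r}" for k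
    proof -
      have "k \<le> r" "k - 1 \<le> r" "k - 1 < r" using that by auto
      then show ?thesis by (simp only: nth m)
    qed
    moreover have "horizontal_strip ((\<nu> @ [\<eta>]) ! Suc r) ((\<nu> @ [\<eta>]) ! (Suc r - 1)) ((\<mu> @ [m]) ! (Suc r - 1)) \<longleftrightarrow>
        horizontal_strip \<eta> (\<nu> ! r) m"
      using nth[of r] nth' m' by simp
    ultimately show ?thesis
      unfolding \<open>{1..Suc r} = insert (Suc r) {1..r}\<close> ball_simps by blast
  qed
  have "\<nu> @ [\<eta>] \<in> strip_flags \<kappa> (\<mu> @ [m]) \<longleftrightarrow>
      (\<forall>k\<le>r. is_partition (\<nu> ! k)) \<and> is_partition \<eta> \<and> \<nu> ! 0 = (\<lambda>_. 0) \<and> \<eta> = \<kappa> \<and>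
      (\<forall>k\<in>{1..r}. horizontal_strip (\<nu> ! k) (\<nu> ! (k - 1)) (\<mu> ! (k - 1))) \<and> horizontal_strip \<eta> (\<nu> ! r) m"
    unfolding strip_flags_def mem_Collect_eq length_append_singleton r_def[symmetric] part hs
    using nth nth' len by (auto simp: r_def)
  then show ?thesis using len by (auto simp: strip_flags_def r_def)
next
  case False
  then show ?thesis by (auto simp: strip_flags_def)
qed

text \<open>This reconciles the product in \<open>flag_weight\<close>, which starts at
  \<open>k = 1\<close>, with the Pieri rule, which gives a factor for the first strip as
  well.\<close>

lemma strip_coeff_single_row:
  assumes "horizontal_strip \<eta> (\<lambda>_. 0) m"
  shows "strip_coeff \<eta> (\<lambda>_. 0) = 1"
  using assms by (simp add: strip_coeff_def horizontal_strip_def)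

lemma flag_weight_snoc:
  assumes \<eta>: "is_partition \<eta>"
  shows "flag_weight \<eta> (\<mu> @ [m]) =
    (\<Sum>\<xi> | is_partition \<xi> \<and> horizontal_strip \<eta> \<xi> m. strip_coeff \<eta> \<xi> * flag_weight \<xi> \<mu>)"
proof -
  let ?D = "{\<xi>. is_partition \<xi> \<and> horizontal_strip \<eta> \<xi> m}"
  define r where "r = length \<mu>"
  define P where "P \<nu> = (\<Prod>k\<in>{1..<r}. strip_coeff (\<nu> ! (k + 1)) (\<nu> ! k))" for \<nu> :: "(nat \<Rightarrow> nat) list"
  have last: "\<nu> ! r = \<xi>" "length \<nu> = Suc r" "is_partition \<xi>" if "\<nu> \<in> strip_flags \<xi> \<mu>" for \<nu> \<xi>
    using that by (auto simp: strip_flags_def r_def)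
  have finD: "finite ?D"
    by (rule finite_subset[OF _ finite_partitions_of[of "psize \<eta> - m"]])
       (auto simp: partitions_of_def horizontal_strip_def)
  have "flag_weight \<eta> (\<mu> @ [m]) = (\<Sum>(\<xi>, \<nu>)\<in>(SIGMA \<xi>:?D. strip_flags \<xi> \<mu>). strip_coeff \<eta> \<xi> * P \<nu>)"
    unfolding flag_weight_def
  proof (rule sum.reindex_bij_witness[where i = "\<lambda>(\<xi>, \<nu>). \<nu> @ [\<eta>]" and j = "\<lambda>\<nu>. (\<nu> ! r, butlast \<nu>)"])
    fix x assume "x \<in> (SIGMA \<xi>:?D. strip_flags \<xi> \<mu>)"
    then obtain \<xi> \<nu> where x: "x = (\<xi>, \<nu>)" "is_partition \<xi>" "horizontal_strip \<eta> \<xi> m" "\<nu> \<in> strip_flags \<xi> \<mu>"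
      by auto
    show "(case x of (\<xi>, \<nu>) \<Rightarrow> \<nu> @ [\<eta>]) \<in> strip_flags \<eta> (\<mu> @ [m])"
      using x \<eta> by (auto simp: strip_flags_snoc)
    show "((case x of (\<xi>, \<nu>) \<Rightarrow> \<nu> @ [\<eta>]) ! r, butlast (case x of (\<xi>, \<nu>) \<Rightarrow> \<nu> @ [\<eta>])) = x"
      using x last[OF x(4)] by (simp add: nth_append)
  next
    fix \<nu>' assume \<nu>': "\<nu>' \<in> strip_flags \<eta> (\<mu> @ [m])"
    then have "length \<nu>' = Suc (Suc r)" by (simp add: strip_flags_def r_def)
    then obtain \<nu> \<eta>' where eq: "\<nu>' = \<nu> @ [\<eta>']" by (metis append_butlast_last_id length_0_conv nat.distinct(1))
    with \<nu>' obtain \<xi> where \<xi>: "\<eta>' = \<eta>" "\<nu> \<in> strip_flags \<xi> \<mu>" "horizontal_strip \<eta> \<xi> m"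
      by (auto simp: strip_flags_snoc)
    note l = last[OF \<xi>(2)]
    have nr: "\<nu>' ! r = \<xi>" "\<nu>' ! Suc r = \<eta>" using l eq \<xi>(1) by (simp_all add: nth_append)
    show "(case (\<nu>' ! r, butlast \<nu>') of (\<xi>, \<nu>) \<Rightarrow> \<nu> @ [\<eta>]) = \<nu>'"
      using eq \<xi>(1) by simp
    show "(\<nu>' ! r, butlast \<nu>') \<in> (SIGMA \<xi>:?D. strip_flags \<xi> \<mu>)"
      using eq \<xi> l nr by simp
    have P: "(\<Prod>k\<in>{1..<r}. strip_coeff (\<nu>' ! (k + 1)) (\<nu>' ! k)) = P \<nu>"
      unfolding P_def using l(2) by (intro prod.cong refl) (simp add: eq nth_append)
    have "(\<Prod>k\<in>{1..<length (\<mu> @ [m])}. strip_coeff (\<nu>' ! (k + 1)) (\<nu>' ! k)) = strip_coeff \<eta> \<xi> * P \<nu>"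
    \<comment> \<open>If \<open>r = 0\<close>, the new strip is the first one: it has no factor in
      the product, and its coefficient is 1.\<close>
    proof (cases "r = 0")
      case True
      then have "\<xi> = (\<lambda>_. 0)" using \<xi>(2) by (auto simp: strip_flags_def r_def)
      then show ?thesis using True strip_coeff_single_row \<xi>(3) by (simp add: r_def P_def)
    next
      case False
      have "{1..<Suc r} = insert r {1..<r}" using False by auto
      then have "(\<Prod>k\<in>{1..<Suc r}. strip_coeff (\<nu>' ! (k + 1)) (\<nu>' ! k)) =
          strip_coeff (\<nu>' ! Suc r) (\<nu>' ! r) * (\<Prod>k\<in>{1..<r}. strip_coeff (\<nu>' ! (k + 1)) (\<nu>' ! k))"
        by simp
      then show ?thesis unfolding P nr by (simp only: length_append_singleton r_def)
    qed
    then show "(case (\<nu>' ! r, butlast \<nu>') of (\<xi>, \<nu>) \<Rightarrow> strip_coeff \<eta> \<xi> * P \<nu>) =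
        (\<Prod>k\<in>{1..<length (\<mu> @ [m])}. strip_coeff (\<nu>' ! (k + 1)) (\<nu>' ! k))"
      using eq nr by simp
  qed
  also have "\<dots> = (\<Sum>\<xi>\<in>?D. \<Sum>\<nu>\<in>strip_flags \<xi> \<mu>. strip_coeff \<eta> \<xi> * P \<nu>)"
    using finD finite_strip_flags by (subst sum.Sigma) auto
  finally show ?thesis
    by (simp add: flag_weight_def sum_distrib_left P_def r_def)
qed

section \<open>Schur and Hall--Littlewood families\<close>

text \<open>In the deleted row the lower index is 0, in any other row the two indices agree.\<close>

lemma strip_coeff_drop_row: "strip_coeff \<eta> (drop_row \<eta>) = 1"
proof -
  have "tbinom (\<eta> i - \<eta> (i + 1)) (drop_row \<eta> i - \<eta> (i + 1)) = 1" for i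
    by (cases "i = plength \<eta> - 1") (simp_all add: drop_row_def)
  then show ?thesis by (simp add: strip_coeff_def)
qed

lemma pieri_family_hall_littlewood:
  "pieri_family (\<lambda>\<eta> n. hall_littlewood n (conj_part \<eta>)) strip_coeff"
  by unfold_locales
     (simp_all add: conj_part_0 hall_littlewood_0 hall_littlewood_pieri strip_coeff_drop_row)

text \<open>An exchange of neighbours changes the sign of one factor only, by
  \<open>pair_prod_transpose\<close>; conjugating such exchanges yields all transpositions, and
  these generate the permutations.\<close>

lemma pair_prod_diff_permutes:
  fixes y :: "nat \<Rightarrow> 'a::comm_ring_1" and n :: nat
  assumes "w permutes {..<n}"
  shows "(\<Prod>j<n. \<Prod>i<j. y (w i) - y (w j)) = of_int (sign w) * (\<Prod>j<n. \<Prod>i<j. y i - y j)"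
proof -
  define V where "V y = (\<Prod>j<n. \<Prod>i<j. y i - y j)" for y :: "nat \<Rightarrow> 'a"
  \<comment> \<open>All \<open>y\<close> are quantified inside, since composing \<open>p\<close>
    with \<open>q\<close> uses the property of \<open>q\<close> at
    \<open>y \<circ> p\<close>.\<close>
  define Q where "Q w \<longleftrightarrow> w permutes {..<n} \<and> (\<forall>y. V (y \<circ> w) = of_int (sign w) * V y)" for w
  have comp: "Q (p \<circ> q)" if "Q p" "Q q" for p q
  proof -
    have pq: "p permutes {..<n}" "q permutes {..<n}" using that by (auto simp: Q_def)
    have "V (y \<circ> (p \<circ> q)) = of_int (sign (p \<circ> q)) * V y" for y
    proof -
      have "V ((y \<circ> p) \<circ> q) = of_int (sign q) * (of_int (sign p) * V y)"
        using that by (simp add: Q_def)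
      moreover have "sign (p \<circ> q) = sign p * sign q"
        using pq permutation_permutes by (intro sign_compose) blast+
      ultimately show ?thesis by (simp add: o_assoc mult.left_commute mult.commute)
    qed
    then show ?thesis using permutes_compose[OF pq(2,1)] by (simp add: Q_def)
  qed
  have adjacent: "Q (transpose p (Suc p))" if p: "Suc p < n" for p
  proof -
    have "V (y \<circ> transpose p (Suc p)) = - V y" for y
    proof -
      obtain \<psi> where "V y = (y p - y (Suc p)) * \<psi>"
          "V (y \<circ> transpose p (Suc p)) = (y (Suc p) - y p) * \<psi>"
        using pair_prod_transpose[OF p, of "\<lambda>u v. u - v" y] unfolding V_def comp_def by blast
      then show ?thesis by (simp only: mult_minus_left[symmetric] minus_diff_eq)
    qed
    then show ?thesis using p by (simp add: Q_def sign_swap_id permutes_swap_id)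
  qed
  have trans: "Q (transpose p (p + Suc d))" if "p + Suc d < n" for p d
    using that
  proof (induction d)
    case 0
    then show ?case using adjacent by simp
  next
    case (Suc d)
    define b where "b = p + Suc d"
    \<comment> \<open>The transposition of distant points is conjugated by an adjacent one to a
      transposition of points one step closer.\<close>
    have "transpose p (Suc b) = transpose b (Suc b) \<circ> (transpose p b \<circ> transpose b (Suc b))"
      by (auto simp: fun_eq_iff transpose_def b_def)
    moreover have "Q (transpose b (Suc b))" "Q (transpose p b)"
      using Suc by (auto simp: b_def intro: adjacent)
    ultimately have "Q (transpose p (Suc b))" using comp by metis
    then show ?case by (simp add: b_def)
  qed
  have "Q id" by (simp add: Q_def permutes_id sign_id)
  have any: "Q (transpose a b)" if ab: "a < n" "b < n" for a b
  proof (cases a b rule: linorder_cases)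
    case less
    then obtain d where "b = a + Suc d" by (metis less_iff_Suc_add add_Suc_right)
    then show ?thesis using trans ab by simp
  next
    case equal
    then show ?thesis using \<open>Q id\<close> by (simp add: id_def)
  next
    case greater
    then obtain d where "a = b + Suc d" by (metis less_iff_Suc_add add_Suc_right)
    then show ?thesis using trans[of b d] ab by (simp add: transpose_commute)
  qed
  have "Q w"
    using assms finite_lessThan
    by (induction rule: permutes_induct) (rule \<open>Q id\<close>, rule comp, rule any, simp_all)
  then show ?thesis by (simp add: Q_def V_def)
qed

text \<open>The Weyl denominator formula is the case $t = 0$ of the formula for $v_n(t)$.\<close>

lemma schur_0: "schur n (\<lambda>_. 0) = 1"
proof -
  have ker: "hl_ker n 0 (xvar \<circ> w) = of_int (sign w) * (\<Prod>i<n. xvar (w i) ^ (n - 1 - i)) / vdm n"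
    if w: "w permutes {..<n}" for w
  proof -
    \<comment> \<open>At \<open>t = 0\<close> the numerator of the kernel has one factor
      \<open>z i\<close> for each \<open>j > i\<close>, which produces the exponents of the
      alternant.\<close>
    have num: "(\<Prod>j<n. \<Prod>i<j. z i) = (\<Prod>i<n. z i ^ (n - 1 - i))" for z :: "nat \<Rightarrow> xpoly fract"
    proof (induction n)
      case (Suc n)
      have "(\<Prod>i<Suc n. z i ^ (Suc n - 1 - i)) = (\<Prod>i<n. z i ^ (n - 1 - i) * z i)"
        by (auto intro!: prod.cong simp: Suc_diff_Suc simp flip: power_Suc2)
      then show ?case using Suc by (simp add: prod.distrib)
    qed simp
    have inv: "1 / (of_int (sign w) * vdm n) = of_int (sign w) / vdm n"
      by (cases "evenperm w") (simp_all add: sign_def)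
    have "hl_ker n 0 (xvar \<circ> w) = (\<Prod>i<n. xvar (w i) ^ (n - 1 - i)) * (1 / (of_int (sign w) * vdm n))"
      using num[of "xvar \<circ> w"] pair_prod_diff_permutes[OF w, of xvar]
      by (simp add: hl_ker_def prod_dividef vdm_def)
    then show ?thesis unfolding inv by (simp add: mult.commute)
  qed
  have "0 \<notin> xvar ` {..<n}" using xvar_nonzero by (metis imageE)
  from sum_hl_ker[OF inj_on_xvar this, of 0]
  have "(\<Sum>w | w permutes {..<n}. hl_ker n 0 (xvar \<circ> w)) = (\<Prod>i=1..n. 1 - 0 ^ i)" by simp
  also have "\<dots> = 1" by (intro prod.neutral) (auto simp: zero_power)
  finally show ?thesis
    by (simp add: schur_eq plength_def alternant_def ker sum_divide_distrib)
qed

lemma pieri_family_schur: "pieri_family (\<lambda>\<eta> n. schur n (conj_part \<eta>)) (\<lambda>_ _. 1)"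
  by unfold_locales (simp_all add: conj_part_0 schur_0 schur_pieri)

section \<open>Linear independence of the Schur and Hall-Littlewood families\<close>

lemma xvar_power: "xvar i ^ k = to_fract (Poly_Mapping.single (Poly_Mapping.single i k) 1)"
proof (induction k)
  case 0
  show ?case by (simp add: single_one)
next
  case (Suc k)
  have "xvar i ^ Suc k = xvar i * to_fract (Poly_Mapping.single (Poly_Mapping.single i k) 1)"
    by (simp add: Suc)
  also have "\<dots> = to_fract (Poly_Mapping.single (Poly_Mapping.single i 1) 1 * Poly_Mapping.single (Poly_Mapping.single i k) 1)"
    by (simp only: xvar_def to_fract_mult)
  also have "\<dots> = to_fract (Poly_Mapping.single (Poly_Mapping.single i (Suc k)) 1)"
    by (simp add: mult_single flip: single_add)
  finally show ?case .
qed

lemma prod_xvar_power: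
  fixes n :: nat
  shows "(\<Prod>i<n. xvar (w i) ^ \<alpha> i)
    = to_fract (Poly_Mapping.single (\<Sum>i<n. Poly_Mapping.single (w i) (\<alpha> i)) 1)"
proof (induction n)
  case 0
  show ?case by (simp add: single_one)
next
  case (Suc n)
  then show ?case by (simp add: xvar_power mult_single flip: to_fract_mult)
qed

text \<open>Moves the alternant from the fraction field into the polynomial ring, where coefficients
  of monomials can be read off.\<close>

lemma alternant_eq_to_fract:
  "alternant n \<alpha> = to_fract (\<Sum>w | w permutes {..<n}.
     Poly_Mapping.single (\<Sum>i<n. Poly_Mapping.single (w i) (\<alpha> i)) (of_int (sign w)))"
proof -
  have of_int: "of_int k = to_fract (Poly_Mapping.single 0 (of_int k))" for k :: int
  proof (cases k rule: int_cases2)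
    have nat: "of_nat m = to_fract (Poly_Mapping.single 0 (of_nat m))" for m
      by (induction m) (simp_all add: single_add to_fract_add single_one)
    {
      case (nonneg m)
      then show ?thesis using nat by simp
    next
      case (nonpos m)
      then show ?thesis using nat[of m] by (simp add: single_uminus to_fract_uminus)
    }
  qed
  show ?thesis
    unfolding alternant_def to_fract_sum prod_xvar_power
    by (intro sum.cong refl)
       (subst of_int, simp only: mult_single add_0_left mult_1_right flip: to_fract_mult)
qed

text \<open>Since \<open>w\<close> matches two strictly decreasing sequences it is increasing, and
  an increasing permutation of an initial segment is the identity.\<close>

lemma permutes_strict_decreasing:
  fixes \<alpha> \<beta> :: "nat \<Rightarrow> nat"
  assumes w: "w permutes {..<n}" and \<alpha>: "\<And>i j. i < j \<Longrightarrow> j < n \<Longrightarrow> \<alpha> j < \<alpha> i"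
    and \<beta>: "\<And>i j. i < j \<Longrightarrow> j < n \<Longrightarrow> \<beta> j < \<beta> i" and eq: "\<And>i. i < n \<Longrightarrow> \<beta> (w i) = \<alpha> i"
  shows "w = id"
proof -
  have wn: "w i < n" if "i < n" for i using permutes_in_image[OF w, of i] that by simp
  have mono: "w i < w j" if "i < j" "j < n" for i j
  proof (rule ccontr)
    assume "\<not> w i < w j"
    moreover have "w i \<noteq> w j" using injD[OF permutes_inj[OF w], of i j] that by auto
    ultimately have "w j < w i" by simp
    then have "\<beta> (w i) < \<beta> (w j)" using that wn[of i] by (intro \<beta>) auto
    then show False using eq[of i] eq[of j] \<alpha>[OF that] that by simp
  qed
  have "i \<le> w i" if "i < n" for i
    using that
  proof (induction i)
    case (Suc i)
    then show ?case using mono[of i "Suc i"] by simp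
  qed simp
  then show ?thesis by (intro permutes_natset_ge[OF w]) auto
qed

lemma lookup_monomial:
  fixes n :: nat
  assumes w: "w permutes {..<n}" and j: "j < n"
  shows "Poly_Mapping.lookup (\<Sum>i<n. Poly_Mapping.single (w i) (\<alpha> i)) (w j) = (\<alpha> j :: nat)"
proof -
  have "Poly_Mapping.lookup (\<Sum>i<n. Poly_Mapping.single (w i) (\<alpha> i)) (w j)
      = (\<Sum>i<n. if i = j then \<alpha> i else 0)"
    unfolding lookup_sum
    by (intro sum.cong refl) (auto simp: lookup_single when_def dest: injD[OF permutes_inj[OF w]])
  also have "\<dots> = \<alpha> j" using j by simp
  finally show ?thesis .
qed

text \<open>The coefficient of the dominant monomial $x^{\lambda + \delta}$ is extracted.\<close>

lemma alternant_independent: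
  assumes X: "finite X" and part: "\<And>lam. lam \<in> X \<Longrightarrow> is_partition lam"
    and pl: "\<And>lam. lam \<in> X \<Longrightarrow> plength lam \<le> n"
    and sum0: "(\<Sum>lam\<in>X. tconst (c lam) * alternant n (\<lambda>i. lam i + (n - 1 - i))) = 0"
    and \<mu>: "\<mu> \<in> X"
  shows "c \<mu> = 0"
proof -
  define \<delta> where "\<delta> lam i = lam i + (n - 1 - i)" for lam :: "nat \<Rightarrow> nat" and i
  define ex where "ex w \<alpha> = (\<Sum>i<n. Poly_Mapping.single (w i :: nat) (\<alpha> i :: nat))" for w \<alpha>
  have dec: "\<delta> lam j < \<delta> lam i" if "lam \<in> X" "i < j" "j < n" for lam i j
    using partition_le[OF part[OF that(1)], of i j] that(2,3) by (simp add: \<delta>_def)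
  \<comment> \<open>All exponent sequences \<open>\<delta> lam\<close> are strictly decreasing, so
    the dominant monomial of \<open>\<mu>\<close> arises from no other partition and no other
    permutation.\<close>
  have ex_eq: "ex w (\<delta> lam) = ex id (\<delta> \<mu>) \<longleftrightarrow> w = id \<and> lam = \<mu>"
    if lam: "lam \<in> X" and w: "w permutes {..<n}" for w lam
  proof
    assume eq: "ex w (\<delta> lam) = ex id (\<delta> \<mu>)"
    have d: "\<delta> \<mu> (w i) = \<delta> lam i" if i: "i < n" for i
    proof -
      have "w i < n" using permutes_in_image[OF w, of i] i by simp
      then show ?thesis
        using lookup_monomial[OF w i, of "\<delta> lam"] lookup_monomial[OF permutes_id, of "w i" n "\<delta> \<mu>"] eq
        by (simp add: ex_def)
    qed
    have "w = id"
      by (rule permutes_strict_decreasing[OF w, where \<alpha> = "\<delta> lam" and \<beta> = "\<delta> \<mu>"])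
         (auto intro: dec lam \<mu> d)
    moreover have "lam = \<mu>"
    proof
      fix i
      show "lam i = \<mu> i"
      proof (cases "i < n")
        case True
        then show ?thesis using d[OF True] \<open>w = id\<close> by (simp add: \<delta>_def)
      next
        case False
        then show ?thesis
          using eq_0_iff_plength_le[OF part[OF lam], of i] eq_0_iff_plength_le[OF part[OF \<mu>], of i]
            pl[OF lam] pl[OF \<mu>] by simp
      qed
    qed
    ultimately show "w = id \<and> lam = \<mu>" by simp
  qed simp
  have "to_fract (\<Sum>lam\<in>X. \<Sum>w | w permutes {..<n}. Poly_Mapping.single (ex w (\<delta> lam)) (c lam * of_int (sign w))) = 0"
    using sum0 unfolding \<delta>_def ex_def
    by (simp add: alternant_eq_to_fract tconst_def to_fract_sum mult_single sum_distrib_left flip: to_fract_mult)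
  then have "(\<Sum>lam\<in>X. \<Sum>w | w permutes {..<n}. Poly_Mapping.single (ex w (\<delta> lam)) (c lam * of_int (sign w))) = 0"
    by (simp only: to_fract_eq_0_iff)
  then have "0 = Poly_Mapping.lookup
      (\<Sum>lam\<in>X. \<Sum>w | w permutes {..<n}. Poly_Mapping.single (ex w (\<delta> lam)) (c lam * of_int (sign w))) (ex id (\<delta> \<mu>))"
    by (simp only: lookup_zero)
  also have "\<dots> = (\<Sum>lam\<in>X. \<Sum>w | w permutes {..<n}.
      (if ex w (\<delta> lam) = ex id (\<delta> \<mu>) then c lam * of_int (sign w) else 0))"
    by (simp only: lookup_sum lookup_single when_def)
  also have "\<dots> = (\<Sum>lam\<in>X. \<Sum>w | w permutes {..<n}. (if w = id then if lam = \<mu> then c \<mu> else 0 else 0))"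
    by (intro sum.cong refl) (auto simp: ex_eq sign_id)
  also have "\<dots> = (\<Sum>lam\<in>X. if lam = \<mu> then c \<mu> else 0)"
    by (intro sum.cong refl) (simp add: sum.delta finite_permutations permutes_id)
  also have "\<dots> = c \<mu>" using X \<mu> by simp
  finally show ?thesis by simp
qed

lemma conj_part_partition:
  assumes "is_partition lam"
  shows "is_partition (conj_part lam)" "psize (conj_part lam) = psize lam"
  using is_partition_conj_part[OF is_partition_finite[OF assms]]
    psize_conj_part[OF is_partition_finite[OF assms]] by auto

lemma inj_on_conj_part: "X \<subseteq> Collect is_partition \<Longrightarrow> inj_on conj_part X"
  by (rule inj_on_inverseI[of _ conj_part]) (auto simp: conj_part_conj_part)

lemma schur_independent: "fam_independent (\<lambda>\<eta> n. schur n (conj_part \<eta>))"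
  unfolding fam_independent_def
proof (intro allI impI ballI)
  fix X c \<xi>
  assume X: "finite X" "X \<subseteq> Collect is_partition" and \<xi>: "\<xi> \<in> X"
    and sum0: "\<forall>n. (\<Sum>\<xi>\<in>X. tconst (c \<xi>) * schur n (conj_part \<xi>)) = 0"
  \<comment> \<open>With this many variables no Schur polynomial of the relation is 0 by definition,
    and all are quotients by the same \<open>vdm n\<close>.\<close>
  define n where "n = Max ((\<lambda>\<xi>. plength (conj_part \<xi>)) ` X)"
  have pl: "plength (conj_part \<xi>) \<le> n" if "\<xi> \<in> X" for \<xi>
    using that X(1) by (auto simp: n_def)
  have inv: "conj_part (conj_part \<xi>) = \<xi>" if "\<xi> \<in> X" for \<xi>
    using that X(2) by (auto intro: conj_part_conj_part)
  have "(\<Sum>\<xi>\<in>X. tconst (c \<xi>) * alternant n (\<lambda>i. conj_part \<xi> i + (n - 1 - i))) / vdm n = 0"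
    using sum0[rule_format, of n] pl by (simp add: schur_eq sum_divide_distrib)
  then have "(\<Sum>\<xi>\<in>X. tconst (c \<xi>) * alternant n (\<lambda>i. conj_part \<xi> i + (n - 1 - i))) = 0"
    using vdm_nonzero by simp
  then have "(\<Sum>lam\<in>conj_part ` X. tconst (c (conj_part lam)) * alternant n (\<lambda>i. lam i + (n - 1 - i))) = 0"
    by (simp add: sum.reindex[OF inj_on_conj_part[OF X(2)]] inv)
  then have "c (conj_part (conj_part \<xi>)) = 0"
    using X pl \<xi> conj_part_partition(1)
    by (intro alternant_independent[where X = "conj_part ` X" and n = n and c = "\<lambda>lam. c (conj_part lam)"]) auto
  then show "c \<xi> = 0" by (simp add: inv[OF \<xi>])
qed

lemma hall_littlewood_independent:
  assumes X: "finite X" "X \<subseteq> Collect is_partition"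
    and sum0: "\<And>n. (\<Sum>\<kappa>\<in>X. tconst (c \<kappa>) * hall_littlewood n \<kappa>) = 0" and \<kappa>: "\<kappa> \<in> X"
  shows "c \<kappa> = 0"
proof -
  have inv: "conj_part (conj_part \<xi>) = \<xi>" if "\<xi> \<in> X" for \<xi>
    using that X(2) by (auto intro: conj_part_conj_part)
  have "fam_independent (\<lambda>\<eta> n. hall_littlewood n (conj_part \<eta>))"
    by (rule fam_independent_transfer[OF pieri_family_hall_littlewood pieri_family_schur schur_independent])
  moreover have "(\<Sum>\<xi>\<in>conj_part ` X. tconst (c (conj_part \<xi>)) * hall_littlewood n (conj_part \<xi>)) = 0" for n
    using sum0[of n] by (simp add: sum.reindex[OF inj_on_conj_part[OF X(2)]] inv)
  moreover have "conj_part ` X \<subseteq> Collect is_partition" using X(2) conj_part_partition(1) by auto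
  ultimately have "\<forall>\<xi>\<in>conj_part ` X. c (conj_part \<xi>) = 0"
    using X(1) unfolding fam_independent_def
    by (elim allE[of _ "conj_part ` X"] allE[of _ "\<lambda>\<xi>. c (conj_part \<xi>)"]) simp
  then show ?thesis using \<kappa> inv by fastforce
qed

section \<open>Kostka--Foulkes polynomials\<close>

lemma ex_schur_hl_expansion:
  assumes lam: "is_partition lam"
  shows "\<exists>K. schur_hl_expansion lam K"
proof -
  have conj: "is_partition (conj_part lam)" by (rule conj_part_partition(1)[OF lam])
  obtain Y d where Y: "finite Y" "Y \<subseteq> Collect is_partition"
    and eq: "\<And>n. schur n (conj_part (conj_part lam)) = (\<Sum>\<xi>\<in>Y. tconst (d \<xi>) * hall_littlewood n (conj_part \<xi>))"
    by (rule pieri_family_expand[OF pieri_family_schur pieri_family_hall_littlewood conj]) blast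
  have inv: "conj_part (conj_part \<xi>) = \<xi>" if "\<xi> \<in> Y" for \<xi>
    using that Y(2) by (auto intro: conj_part_conj_part)
  \<comment> \<open>Back from conjugate labels to the usual ones, with coefficient 0 outside the
    finite label set.\<close>
  define f where "f \<kappa> = (if \<kappa> \<in> conj_part ` Y then d (conj_part \<kappa>) else 0)" for \<kappa>
  have fin: "finite {\<kappa>. f \<kappa> \<noteq> 0}"
    by (rule finite_subset[of _ "conj_part ` Y"]) (use Y(1) in \<open>auto simp: f_def\<close>)
  define K where "K = Abs_poly_mapping f"
  have lookup: "Poly_Mapping.lookup K = f"
    unfolding K_def using fin by (simp add: Abs_poly_mapping_inverse)
  have keys: "Poly_Mapping.keys K \<subseteq> conj_part ` Y"
    by (auto simp: in_keys_iff lookup f_def split: if_splits)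
  have "schur n lam = (\<Sum>\<kappa>\<in>Poly_Mapping.keys K. tconst (Poly_Mapping.lookup K \<kappa>) * hall_littlewood n \<kappa>)" for n
  proof -
    have "(\<Sum>\<kappa>\<in>Poly_Mapping.keys K. tconst (Poly_Mapping.lookup K \<kappa>) * hall_littlewood n \<kappa>)
        = (\<Sum>\<kappa>\<in>conj_part ` Y. tconst (f \<kappa>) * hall_littlewood n \<kappa>)"
      unfolding lookup[symmetric] using Y(1) keys
      by (intro sum.mono_neutral_left) (auto simp: in_keys_iff)
    also have "\<dots> = (\<Sum>\<xi>\<in>Y. tconst (d \<xi>) * hall_littlewood n (conj_part \<xi>))"
      by (simp add: sum.reindex[OF inj_on_conj_part[OF Y(2)]] f_def inv)
    finally show ?thesis using eq[of n] by (simp add: conj_part_conj_part[OF lam])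
  qed
  moreover have "Poly_Mapping.keys K \<subseteq> {lam. is_partition lam}"
    using keys Y(2) conj_part_partition(1) by blast
  ultimately show ?thesis unfolding schur_hl_expansion_def by blast
qed

lemma schur_hl_expansion_superset:
  assumes "schur_hl_expansion lam K" "finite X" "Poly_Mapping.keys K \<subseteq> X"
  shows "schur n lam = (\<Sum>\<kappa>\<in>X. tconst (Poly_Mapping.lookup K \<kappa>) * hall_littlewood n \<kappa>)"
proof -
  have "schur n lam = (\<Sum>\<kappa>\<in>Poly_Mapping.keys K. tconst (Poly_Mapping.lookup K \<kappa>) * hall_littlewood n \<kappa>)"
    using assms(1) by (simp add: schur_hl_expansion_def)
  also have "\<dots> = (\<Sum>\<kappa>\<in>X. tconst (Poly_Mapping.lookup K \<kappa>) * hall_littlewood n \<kappa>)"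
    using assms(2,3) by (intro sum.mono_neutral_left) (auto simp: in_keys_iff)
  finally show ?thesis .
qed

text \<open>With existence, this gives meaning to \<open>THE\<close> in
  \<open>kostka_foulkes\<close>. The key sets may differ a priori, so the expansions are compared on
  their union.\<close>

lemma schur_hl_expansion_unique:
  assumes K: "schur_hl_expansion lam K" and L: "schur_hl_expansion lam L"
  shows "K = L"
proof (rule poly_mapping_eqI)
  fix \<kappa>
  define X where "X = Poly_Mapping.keys K \<union> Poly_Mapping.keys L"
  have X: "finite X" "X \<subseteq> Collect is_partition"
    using K L by (auto simp: X_def schur_hl_expansion_def)
  show "Poly_Mapping.lookup K \<kappa> = Poly_Mapping.lookup L \<kappa>"
  proof (cases "\<kappa> \<in> X")
    case True
    have "(\<Sum>\<kappa>\<in>X. tconst (Poly_Mapping.lookup K \<kappa> - Poly_Mapping.lookup L \<kappa>) * hall_littlewood n \<kappa>) = 0" for n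
      using schur_hl_expansion_superset[OF K X(1), of n] schur_hl_expansion_superset[OF L X(1), of n]
      by (simp add: X_def tconst_diff left_diff_distrib sum_subtractf)
    from hall_littlewood_independent[OF X this True] show ?thesis by simp
  next
    case False
    then show ?thesis by (simp add: X_def in_keys_iff)
  qed
qed

lemma schur_hl_expansion_the:
  "is_partition lam \<Longrightarrow> schur_hl_expansion lam (THE K. schur_hl_expansion lam K)"
  using ex_schur_hl_expansion schur_hl_expansion_unique by (metis theI)

theorem theorem3p4:
  fixes lam :: "nat \<Rightarrow> nat" and mu :: "nat list"
  assumes "is_partition lam"
    and "psize lam = sum_list mu"
  shows "(\<Sum>eta \<in> partitions_of (psize lam).
            of_nat (kostka eta mu) * kostka_foulkes (conj_part eta) lam) =
         (\<Sum>nu \<in> strip_flags (conj_part lam) mu.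
            \<Prod>k \<in> {1..<length mu}. \<Prod>i.
              tbinom ((nu ! (k + 1)) i - (nu ! (k + 1)) (i + 1))
                     ((nu ! k) i - (nu ! (k + 1)) (i + 1)))"
proof -
  let ?P = "partitions_of (psize lam)"
  define K where "K \<eta> = (THE K. schur_hl_expansion (conj_part \<eta>) K)" for \<eta>
  have partP: "is_partition \<eta>" if "\<eta> \<in> ?P" for \<eta> using that by (simp add: partitions_of_def)
  have K: "schur_hl_expansion (conj_part \<eta>) (K \<eta>)" if "\<eta> \<in> ?P" for \<eta>
    unfolding K_def by (rule schur_hl_expansion_the[OF conj_part_partition(1)[OF partP[OF that]]])
  \<comment> \<open>A common finite label set: \<open>?P\<close> covers the flags, and the keys
    cover the expanded Schur functions, whose labels have not been shown to be of size
    \<open>psize lam\<close>.\<close>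
  define U where "U = ?P \<union> (\<Union>\<eta>\<in>?P. Poly_Mapping.keys (K \<eta>))"
  have finU: "finite U" unfolding U_def by (simp add: finite_partitions_of)
  have partU: "U \<subseteq> Collect is_partition"
    using partP K by (auto simp: U_def schur_hl_expansion_def)
  define lhs where "lhs \<kappa> = (\<Sum>\<eta>\<in>?P. of_nat (kostka \<eta> mu) * Poly_Mapping.lookup (K \<eta>) \<kappa>)" for \<kappa>
  define rhs where "rhs \<kappa> = (if \<kappa> \<in> ?P then flag_weight (conj_part \<kappa>) mu else 0)" for \<kappa>
  have e_schur: "(\<Prod>m\<leftarrow>mu. esymp n xvar m) = (\<Sum>\<kappa>\<in>U. tconst (lhs \<kappa>) * hall_littlewood n \<kappa>)" for n
  proof -
    have "(\<Prod>m\<leftarrow>mu. esymp n xvar m) = (\<Sum>\<eta>\<in>?P. tconst (of_nat (kostka \<eta> mu)) * schur n (conj_part \<eta>))"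
      unfolding assms(2)
      by (rule pieri_family.prod_esymp_expand[OF pieri_family_schur]) (simp_all add: kostka_Nil kostka_snoc)
    also have "\<dots> = (\<Sum>\<eta>\<in>?P. \<Sum>\<kappa>\<in>U. tconst (of_nat (kostka \<eta> mu) * Poly_Mapping.lookup (K \<eta>) \<kappa>) * hall_littlewood n \<kappa>)"
    proof (rule sum.cong[OF refl])
      fix \<eta> assume \<eta>: "\<eta> \<in> ?P"
      have "schur n (conj_part \<eta>) = (\<Sum>\<kappa>\<in>U. tconst (Poly_Mapping.lookup (K \<eta>) \<kappa>) * hall_littlewood n \<kappa>)"
        by (rule schur_hl_expansion_superset[OF K[OF \<eta>] finU]) (use \<eta> in \<open>auto simp: U_def\<close>)
      then show "tconst (of_nat (kostka \<eta> mu)) * schur n (conj_part \<eta>) =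
          (\<Sum>\<kappa>\<in>U. tconst (of_nat (kostka \<eta> mu) * Poly_Mapping.lookup (K \<eta>) \<kappa>) * hall_littlewood n \<kappa>)"
        by (simp only: sum_distrib_left tconst_mult mult.assoc)
    qed
    also have "\<dots> = (\<Sum>\<kappa>\<in>U. \<Sum>\<eta>\<in>?P. tconst (of_nat (kostka \<eta> mu) * Poly_Mapping.lookup (K \<eta>) \<kappa>) * hall_littlewood n \<kappa>)"
      by (rule sum.swap)
    also have "\<dots> = (\<Sum>\<kappa>\<in>U. tconst (lhs \<kappa>) * hall_littlewood n \<kappa>)"
      by (simp only: lhs_def tconst_sum sum_distrib_right)
    finally show ?thesis .
  qed
  have e_hl: "(\<Prod>m\<leftarrow>mu. esymp n xvar m) = (\<Sum>\<kappa>\<in>U. tconst (rhs \<kappa>) * hall_littlewood n \<kappa>)" for n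
  proof -
    have "(\<Prod>m\<leftarrow>mu. esymp n xvar m) = (\<Sum>\<eta>\<in>?P. tconst (flag_weight \<eta> mu) * hall_littlewood n (conj_part \<eta>))"
      unfolding assms(2)
      by (rule pieri_family.prod_esymp_expand[OF pieri_family_hall_littlewood])
         (simp_all only: flag_weight_Nil flag_weight_snoc)
    \<comment> \<open>Passing from conjugate to usual labels makes the flags end at the conjugate of
      the label.\<close>
    also have "\<dots> = (\<Sum>\<kappa>\<in>?P. tconst (flag_weight (conj_part \<kappa>) mu) * hall_littlewood n \<kappa>)"
      by (rule sum.reindex_bij_witness[where i = conj_part and j = conj_part])
         (simp_all add: partitions_of_def conj_part_partition conj_part_conj_part)
    also have "\<dots> = (\<Sum>\<kappa>\<in>U. tconst (rhs \<kappa>) * hall_littlewood n \<kappa>)"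
      by (rule sum.mono_neutral_cong_left[OF finU]) (auto simp: U_def rhs_def)
    finally show ?thesis .
  qed
  have sum0: "(\<Sum>\<kappa>\<in>U. tconst (lhs \<kappa> - rhs \<kappa>) * hall_littlewood n \<kappa>) = 0" for n
    using e_schur[of n] e_hl[of n] by (simp add: tconst_diff left_diff_distrib sum_subtractf)
  have lamP: "lam \<in> ?P" using assms(1) by (simp add: partitions_of_def)
  \<comment> \<open>The relation \<open>sum0\<close> holds in every number of variables, as
    independence demands, so the coefficients at \<open>lam\<close> can be compared.\<close>
  have "lhs lam - rhs lam = 0"
    by (rule hall_littlewood_independent[OF finU partU, where c = "\<lambda>\<kappa>. lhs \<kappa> - rhs \<kappa>"])
       (use lamP sum0 in \<open>simp_all add: U_def\<close>)
  then have "lhs lam = flag_weight (conj_part lam) mu" using lamP by (simp add: rhs_def)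
  then show ?thesis
    by (simp only: lhs_def K_def kostka_foulkes_def flag_weight_def strip_coeff_def)
qed

end
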